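(* Let $\pi:E\to Q$ be a fibred manifold, $r\ge1$, and let $S\subset J^r\pi$ be a connected submanifold. Then $S$ is, around every one of its points, the image of an $r$-th holonomic prolongation $j^r\sigma$ (of a local section $\sigma$ of $\pi$) if and only if $S$ is a polarised Legendrian submanifold of $(J^r\pi,\mathcal C^r_\pi,\mathcal G^r_\pi)$, where $\mathcal G^r_\pi=\ker T\pi_{r,r-1}$.
   Context: $J^r\pi$ is the $r$-th jet bundle ($J^0\pi=E$) with projections $\pi_{r,s}$; $\mathcal C^r_\pi$ is the Cartan distribution, locally the common kernel of $\theta^\alpha_I=du^\alpha_I-\sum_iu^\alpha_{I+\widehat e_i}dx^i$, $|I|\le r-1$, in adapted jet coordinates. For a regular distribution $\mathcal D$ the Levi tensor is $\mathcal L_{\mathcal D}(X_x,Y_x)=[X,Y]_x\bmod\mathcal D_x$ ($X,Y\in\Gamma(\mathcal D)$ local extensions); a subspace $E_x\subset\mathcal D_x$ is isotropic if $\mathcal L_{\mathcal D}$ vanishes on $E_x\times E_x$. Given $(M,\mathcal D,\mathcal P)$ with $\mathcal P\subset\mathcal D$ a polarisation, a subspace $E_x\subset\mathcal D_x$ is polarised Legendrian if it is isotropic and $\mathcal D_x=E_x\oplus\mathcal P_x$; a submanifold $L\subset M$ is a polarised Legendrian submanifold if $T_xL\subset\mathcal D_x$ is polarised Legendrian for every $x\in L$ (equivalently $\mathcal D|_L=TL\oplus\mathcal P|_L$). *)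

theory Defs
  imports "HOL-Analysis.Analysis"
begin

section \<open>Smooth functions on open subsets of coordinate spaces\<close>

text \<open>
  For a finite set \<open>A\<close> of coordinate labels, \<open>\<real>\<^sup>A\<close> is modelled by the functions
  vanishing outside \<open>A\<close>, with the product topology. For \<open>A = {..<n}\<close> this is the underlying
  space of \<open>Euclidean_space n\<close>; arbitrary label sets are allowed because jet coordinates
  are labelled by multi-indices.
\<close>

definition coord_space :: "'i set \<Rightarrow> ('i \<Rightarrow> real) set" where
  "coord_space A = {x. \<forall>i. i \<notin> A \<longrightarrow> x i = 0}"

definition pd :: "'i \<Rightarrow> (('i \<Rightarrow> real) \<Rightarrow> real) \<Rightarrow> ('i \<Rightarrow> real) \<Rightarrow> real" where
  "pd i f x = deriv (\<lambda>t. f (x(i := t))) (x i)"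

primrec C_k :: "nat \<Rightarrow> 'i set \<Rightarrow> ('i \<Rightarrow> real) set \<Rightarrow> (('i \<Rightarrow> real) \<Rightarrow> real) \<Rightarrow> bool" where
  "C_k 0 A U f \<longleftrightarrow> continuous_on U f"
| "C_k (Suc k) A U f \<longleftrightarrow> continuous_on U f \<and>
     (\<forall>i\<in>A. (\<forall>x\<in>U. (\<lambda>t. f (x(i := t))) differentiable (at (x i))) \<and> C_k k A U (pd i f))"

definition C_inf :: "'i set \<Rightarrow> ('i \<Rightarrow> real) set \<Rightarrow> (('i \<Rightarrow> real) \<Rightarrow> real) \<Rightarrow> bool" where
  "C_inf A U f \<longleftrightarrow> (\<forall>k. C_k k A U f)"

section \<open>Smooth manifolds\<close>

type_synonym ('a, 'i) chart = "'a set \<times> ('a \<Rightarrow> 'i \<Rightarrow> real)"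

record ('a, 'i) mfd =
  mtop :: "'a topology"
  idx :: "'i set"
  atlas :: "('a, 'i) chart set"

abbreviation carr :: "('a, 'i) mfd \<Rightarrow> 'a set" where
  "carr M \<equiv> topspace (mtop M)"

definition mdim :: "('a, 'i) mfd \<Rightarrow> nat" where
  "mdim M = card (idx M)"

definition is_chart :: "'a topology \<Rightarrow> 'i set \<Rightarrow> ('a, 'i) chart \<Rightarrow> bool" where
  "is_chart T A = (\<lambda>(U, \<phi>). openin T U \<and>
     openin (top_of_set (coord_space A)) (\<phi> ` U) \<and>
     homeomorphic_map (subtopology T U) (top_of_set (\<phi> ` U)) \<phi>)"

definition smooth_transition :: "'i set \<Rightarrow> ('a, 'i) chart \<Rightarrow> ('a, 'i) chart \<Rightarrow> bool" where
  "smooth_transition A = (\<lambda>(U, \<phi>) (V, \<psi>).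
     \<forall>i\<in>A. C_inf A (\<phi> ` (U \<inter> V)) (\<lambda>y. \<psi> (inv_into U \<phi> y) i))"

definition smooth_manifold :: "('a, 'i) mfd \<Rightarrow> bool" where
  "smooth_manifold M \<longleftrightarrow>
     Hausdorff_space (mtop M) \<and> second_countable (mtop M) \<and> finite (idx M) \<and>
     (\<forall>c\<in>atlas M. is_chart (mtop M) (idx M) c) \<and>
     (\<forall>c\<in>atlas M. \<forall>d\<in>atlas M. smooth_transition (idx M) c d) \<and>
     (\<Union>c\<in>atlas M. fst c) = carr M"

definition charts :: "('a, 'i) mfd \<Rightarrow> ('a, 'i) chart set" where
  \<comment> \<open>the maximal atlas\<close>
  "charts M = {c. is_chart (mtop M) (idx M) c \<and>
     (\<forall>d\<in>atlas M. smooth_transition (idx M) c d \<and> smooth_transition (idx M) d c)}"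

definition smooth_fun :: "('a, 'i) mfd \<Rightarrow> 'a set \<Rightarrow> ('a \<Rightarrow> real) \<Rightarrow> bool" where
  "smooth_fun M W f \<longleftrightarrow>
     (\<forall>(U, \<phi>)\<in>atlas M. C_inf (idx M) (\<phi> ` (U \<inter> W)) (f \<circ> inv_into U \<phi>))"

definition smooth_near :: "('a, 'i) mfd \<Rightarrow> 'a \<Rightarrow> ('a \<Rightarrow> real) \<Rightarrow> bool" where
  "smooth_near M p f \<longleftrightarrow> (\<exists>W. openin (mtop M) W \<and> p \<in> W \<and> smooth_fun M W f)"

definition smooth_map_on ::
    "('a, 'i) mfd \<Rightarrow> 'a set \<Rightarrow> ('b, 'j) mfd \<Rightarrow> ('a \<Rightarrow> 'b) \<Rightarrow> bool" where
  "smooth_map_on M W N F \<longleftrightarrow>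
     continuous_map (subtopology (mtop M) W) (mtop N) F \<and>
     (\<forall>(V, \<psi>)\<in>atlas N. \<forall>j\<in>idx N. smooth_fun M {p \<in> W. F p \<in> V} (\<lambda>p. \<psi> (F p) j))"

section \<open>Tangent vectors, vector fields and Lie brackets\<close>

text \<open>
  Tangent vectors at \<open>p\<close> are derivations of the germs at \<open>p\<close> of smooth functions. Functions
  are total on the ambient type, so a tangent vector is made to vanish on functions that are
  not smooth near \<open>p\<close>. That the value depends on the germ only follows from the Leibniz rule.
\<close>

type_synonym 'a tvec = "('a \<Rightarrow> real) \<Rightarrow> real"

definition tangent_space :: "('a, 'i) mfd \<Rightarrow> 'a \<Rightarrow> 'a tvec set" where
  "tangent_space M p = {v.
     (\<forall>f. \<not> smooth_near M p f \<longrightarrow> v f = 0) \<and>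
     (\<forall>f g a b. smooth_near M p f \<longrightarrow> smooth_near M p g \<longrightarrow>
        v (\<lambda>x. a * f x + b * g x) = a * v f + b * v g) \<and>
     (\<forall>f g. smooth_near M p f \<longrightarrow> smooth_near M p g \<longrightarrow>
        v (\<lambda>x. f x * g x) = f p * v g + g p * v f)}"

definition tzero :: "'a tvec" where
  "tzero = (\<lambda>f. 0)"

definition tsubspace :: "'a tvec set \<Rightarrow> bool" where
  "tsubspace E \<longleftrightarrow> tzero \<in> E \<and> (\<forall>v\<in>E. \<forall>w\<in>E. \<forall>a b. (\<lambda>f. a * v f + b * w f) \<in> E)"

definition tangent_map :: "('b, 'j) mfd \<Rightarrow> ('a \<Rightarrow> 'b) \<Rightarrow> 'a \<Rightarrow> 'a tvec \<Rightarrow> 'b tvec" where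
  "tangent_map N F p v = (\<lambda>g. if smooth_near N (F p) g then v (g \<circ> F) else 0)"

text \<open>A distribution is given by its family of fibres.\<close>

type_synonym 'a distribution = "'a \<Rightarrow> 'a tvec set"

definition local_section_of ::
    "('a, 'i) mfd \<Rightarrow> 'a distribution \<Rightarrow> 'a set \<Rightarrow> ('a \<Rightarrow> 'a tvec) \<Rightarrow> bool" where
  "local_section_of M D W X \<longleftrightarrow> openin (mtop M) W \<and>
     (\<forall>p\<in>W. X p \<in> tangent_space M p \<and> X p \<in> D p) \<and>
     (\<forall>W' f. openin (mtop M) W' \<longrightarrow> W' \<subseteq> W \<longrightarrow> smooth_fun M W' f \<longrightarrow>
        smooth_fun M W' (\<lambda>p. X p f))"

definition lie_bracket ::
    "('a, 'i) mfd \<Rightarrow> ('a \<Rightarrow> 'a tvec) \<Rightarrow> ('a \<Rightarrow> 'a tvec) \<Rightarrow> 'a \<Rightarrow> 'a tvec" where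
  "lie_bracket M X Y p =
     (\<lambda>f. if smooth_near M p f then X p (\<lambda>q. Y q f) - Y p (\<lambda>q. X q f) else 0)"

section \<open>Levi tensor and polarised Legendrian submanifolds\<close>

text \<open>
  The value of the Levi tensor lies in the quotient of the tangent space by \<open>D p\<close>; it is
  represented as a coset, the class of the bracket at \<open>p\<close> of local extensions. The zero of
  the quotient is the coset \<open>D p\<close>.
\<close>

definition levi ::
    "('a, 'i) mfd \<Rightarrow> 'a distribution \<Rightarrow> 'a \<Rightarrow> 'a tvec \<Rightarrow> 'a tvec \<Rightarrow> 'a tvec set" where
  "levi M D p a b = {w \<in> tangent_space M p. \<exists>W X Y.
     p \<in> W \<and> local_section_of M D W X \<and> local_section_of M D W Y \<and> X p = a \<and> Y p = b \<and>
     (\<lambda>f. w f - lie_bracket M X Y p f) \<in> D p}"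

definition isotropic :: "('a, 'i) mfd \<Rightarrow> 'a distribution \<Rightarrow> 'a \<Rightarrow> 'a tvec set \<Rightarrow> bool" where
  "isotropic M D p E \<longleftrightarrow> tsubspace E \<and> E \<subseteq> D p \<and> (\<forall>a\<in>E. \<forall>b\<in>E. levi M D p a b = D p)"

definition polarised_legendrian ::
    "('a, 'i) mfd \<Rightarrow> 'a distribution \<Rightarrow> 'a distribution \<Rightarrow> 'a \<Rightarrow> 'a tvec set \<Rightarrow> bool" where
  "polarised_legendrian M D P p E \<longleftrightarrow> isotropic M D p E \<and>
     E \<inter> P p = {tzero} \<and> D p = {(\<lambda>f. v f + w f) | v w. v \<in> E \<and> w \<in> P p}"

definition embedded_submanifold :: "('a, 'k) mfd \<Rightarrow> ('a, 'i) mfd \<Rightarrow> bool" where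
  "embedded_submanifold S M \<longleftrightarrow> smooth_manifold S \<and> carr S \<subseteq> carr M \<and>
     mtop S = subtopology (mtop M) (carr S) \<and>
     smooth_map_on S (carr S) M (\<lambda>x. x) \<and>
     (\<forall>p\<in>carr S. inj_on (tangent_map M (\<lambda>x. x) p) (tangent_space S p))"

definition sub_tangent_space :: "('a, 'k) mfd \<Rightarrow> ('a, 'i) mfd \<Rightarrow> 'a \<Rightarrow> 'a tvec set" where
  \<comment> \<open>the tangent space of a submanifold \<open>S\<close>, as a subspace of that of \<open>M\<close>\<close>
  "sub_tangent_space S M p = tangent_map M (\<lambda>x. x) p ` tangent_space S p"

definition polarised_legendrian_submanifold ::
    "('a, 'k) mfd \<Rightarrow> ('a, 'i) mfd \<Rightarrow> 'a distribution \<Rightarrow> 'a distribution \<Rightarrow> bool" where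
  "polarised_legendrian_submanifold S M D P \<longleftrightarrow> embedded_submanifold S M \<and>
     (\<forall>p\<in>carr S. polarised_legendrian M D P p (sub_tangent_space S M p))"

section \<open>Fibred manifolds and jet bundles\<close>

record ('e, 'q) fibration =
  total :: "('e, nat) mfd"
  base :: "('q, nat) mfd"
  prj :: "'e \<Rightarrow> 'q"

definition fibred_manifold :: "('e, 'q) fibration \<Rightarrow> bool" where
  "fibred_manifold F \<longleftrightarrow> smooth_manifold (total F) \<and> smooth_manifold (base F) \<and>
     idx (total F) = {..<mdim (total F)} \<and> idx (base F) = {..<mdim (base F)} \<and>
     prj F ` carr (total F) = carr (base F) \<and>
     smooth_map_on (total F) (carr (total F)) (base F) (prj F) \<and>
     (\<forall>e\<in>carr (total F).
        tangent_map (base F) (prj F) e ` tangent_space (total F) e =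
        tangent_space (base F) (prj F e))"

abbreviation bdim :: "('e, 'q) fibration \<Rightarrow> nat" where
  "bdim F \<equiv> mdim (base F)"

definition fdim :: "('e, 'q) fibration \<Rightarrow> nat" where
  "fdim F = mdim (total F) - mdim (base F)"

definition local_section ::
    "('e, 'q) fibration \<Rightarrow> 'q set \<Rightarrow> ('q \<Rightarrow> 'e) \<Rightarrow> bool" where
  "local_section F U \<sigma> \<longleftrightarrow> openin (mtop (base F)) U \<and>
     smooth_map_on (base F) U (total F) \<sigma> \<and> (\<forall>x\<in>U. prj F (\<sigma> x) = x)"

definition section_near :: "('e, 'q) fibration \<Rightarrow> 'q \<Rightarrow> ('q \<Rightarrow> 'e) \<Rightarrow> bool" where
  "section_near F x \<sigma> \<longleftrightarrow> (\<exists>U. x \<in> U \<and> local_section F U \<sigma>)"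

text \<open>
  Fibred (adapted) charts: a chart of the total space whose first \<open>bdim F\<close> coordinates are
  the pull-back of a chart of the base; coordinate number \<open>bdim F + \<alpha>\<close> is the fibre
  coordinate \<open>u\<^sup>\<alpha>\<close>.
\<close>

type_synonym ('e, 'q) fchart = "('e, nat) chart \<times> ('q, nat) chart"

definition fcharts :: "('e, 'q) fibration \<Rightarrow> ('e, 'q) fchart set" where
  "fcharts F = {((V, \<psi>), (U, \<phi>)).
     (V, \<psi>) \<in> charts (total F) \<and> (U, \<phi>) \<in> charts (base F) \<and> U = prj F ` V \<and>
     (\<forall>e\<in>V. \<forall>i<bdim F. \<psi> e i = \<phi> (prj F e) i)}"

definition multi_indices :: "nat \<Rightarrow> nat \<Rightarrow> (nat \<Rightarrow> nat) set" where
  "multi_indices n r = {I. (\<forall>i\<ge>n. I i = 0) \<and> (\<Sum>i<n. I i) \<le> r}"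

primrec mpd :: "nat \<Rightarrow> (nat \<Rightarrow> nat) \<Rightarrow> ((nat \<Rightarrow> real) \<Rightarrow> real) \<Rightarrow> (nat \<Rightarrow> real) \<Rightarrow> real" where
  \<comment> \<open>\<open>mpd n I f\<close> is the iterated partial derivative \<open>\<partial>\<^sup>|\<^sup>I\<^sup>| f / \<partial>x\<^sup>I\<close> in the variables \<open>0, \<dots>, n - 1\<close>\<close>
  "mpd 0 I f = f"
| "mpd (Suc k) I f = mpd k I ((pd k ^^ I k) f)"

definition section_deriv ::
    "('e, 'q) fibration \<Rightarrow> ('e, 'q) fchart \<Rightarrow> nat \<Rightarrow> (nat \<Rightarrow> nat) \<Rightarrow> ('q \<Rightarrow> 'e) \<Rightarrow> 'q \<Rightarrow> real" where
  "section_deriv F = (\<lambda>((V, \<psi>), (U, \<phi>)) \<alpha> I \<sigma> x.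
     mpd (bdim F) I (\<lambda>y. \<psi> (\<sigma> (inv_into U \<phi> y)) (bdim F + \<alpha>)) (\<phi> x))"

definition jet_eq :: "('e, 'q) fibration \<Rightarrow> nat \<Rightarrow> 'q \<Rightarrow> ('q \<Rightarrow> 'e) \<Rightarrow> ('q \<Rightarrow> 'e) \<Rightarrow> bool" where
  "jet_eq F r x \<sigma> \<tau> \<longleftrightarrow> section_near F x \<sigma> \<and> section_near F x \<tau> \<and> \<sigma> x = \<tau> x \<and>
     (\<forall>c\<in>fcharts F. \<sigma> x \<in> fst (fst c) \<longrightarrow>
        (\<forall>\<alpha><fdim F. \<forall>I\<in>multi_indices (bdim F) r.
           section_deriv F c \<alpha> I \<sigma> x = section_deriv F c \<alpha> I \<tau> x))"

text \<open>An \<open>r\<close>-jet is a base point together with an equivalence class of sections near it.\<close>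

type_synonym ('e, 'q) jet = "'q \<times> ('q \<Rightarrow> 'e) set"

definition jet_of :: "('e, 'q) fibration \<Rightarrow> nat \<Rightarrow> ('q \<Rightarrow> 'e) \<Rightarrow> 'q \<Rightarrow> ('e, 'q) jet" where
  \<comment> \<open>\<open>jet_of F r \<sigma>\<close> is the holonomic prolongation \<open>j\<^sup>r\<sigma>\<close>\<close>
  "jet_of F r \<sigma> x = (x, {\<tau>. jet_eq F r x \<sigma> \<tau>})"

datatype jet_coord = Base nat | Deriv nat "nat \<Rightarrow> nat"

definition jet_idx :: "('e, 'q) fibration \<Rightarrow> nat \<Rightarrow> jet_coord set" where
  "jet_idx F r = Base ` {..<bdim F} \<union>
     {Deriv \<alpha> I | \<alpha> I. \<alpha> < fdim F \<and> I \<in> multi_indices (bdim F) r}"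

definition jet_dom :: "('e, 'q) fibration \<Rightarrow> nat \<Rightarrow> ('e, 'q) fchart \<Rightarrow> ('e, 'q) jet set" where
  "jet_dom F r c = {jet_of F r \<sigma> x | \<sigma> x. section_near F x \<sigma> \<and> \<sigma> x \<in> fst (fst c)}"

definition jet_coords ::
    "('e, 'q) fibration \<Rightarrow> nat \<Rightarrow> ('e, 'q) fchart \<Rightarrow> ('e, 'q) jet \<Rightarrow> jet_coord \<Rightarrow> real" where
  \<comment> \<open>the adapted jet coordinates \<open>x\<^sup>i\<close> and \<open>u\<^sup>\<alpha>\<^sub>I\<close>; by definition of \<open>jet_eq\<close> they do not depend on
      the representative of the jet\<close>
  "jet_coords F r c j k = (if k \<notin> jet_idx F r then 0 else
     (case k of
        Base i \<Rightarrow> snd (snd c) (fst j) i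
      | Deriv \<alpha> I \<Rightarrow> section_deriv F c \<alpha> I (SOME \<sigma>. \<sigma> \<in> snd j) (fst j)))"

definition jet_bundle :: "('e, 'q) fibration \<Rightarrow> nat \<Rightarrow> (('e, 'q) jet, jet_coord) mfd" where
  \<comment> \<open>the topology is generated by the preimages of open sets under adapted jet charts\<close>
  "jet_bundle F r = \<lparr>
     mtop = topology_generated_by
       {{j \<in> jet_dom F r c. jet_coords F r c j \<in> B} | c B.
          c \<in> fcharts F \<and> openin (top_of_set (coord_space (jet_idx F r))) B},
     idx = jet_idx F r,
     atlas = {(jet_dom F r c, jet_coords F r c) | c. c \<in> fcharts F} \<rparr>"

definition jet_proj :: "('e, 'q) fibration \<Rightarrow> nat \<Rightarrow> ('e, 'q) jet \<Rightarrow> ('e, 'q) jet" where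
  \<comment> \<open>\<open>\<pi>\<^sub>r\<^sub>,\<^sub>s\<close>, mapping \<open>j\<^sup>r\<^sub>x\<sigma>\<close> to \<open>j\<^sup>s\<^sub>x\<sigma>\<close> for any \<open>r \<ge> s\<close>\<close>
  "jet_proj F s = (\<lambda>(x, C). (x, {\<tau>. \<exists>\<sigma>\<in>C. jet_eq F s x \<sigma> \<tau>}))"

definition contact_form ::
    "('e, 'q) fibration \<Rightarrow> nat \<Rightarrow> ('e, 'q) fchart \<Rightarrow> nat \<Rightarrow> (nat \<Rightarrow> nat) \<Rightarrow>
     ('e, 'q) jet \<Rightarrow> ('e, 'q) jet tvec \<Rightarrow> real" where
  \<comment> \<open>\<open>\<theta>\<^sup>\<alpha>\<^sub>I = du\<^sup>\<alpha>\<^sub>I - \<Sum>\<^sub>i u\<^sup>\<alpha>\<^bsub>I + e\<^sub>i\<^esub> dx\<^sup>i\<close>, with \<open>df(v) = v f\<close>\<close>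
  "contact_form F r c \<alpha> I j v =
     v (\<lambda>j'. jet_coords F r c j' (Deriv \<alpha> I)) -
     (\<Sum>i<bdim F. jet_coords F r c j (Deriv \<alpha> (I(i := Suc (I i)))) *
        v (\<lambda>j'. jet_coords F r c j' (Base i)))"

definition cartan_distribution ::
    "('e, 'q) fibration \<Rightarrow> nat \<Rightarrow> ('e, 'q) jet distribution" where
  \<comment> \<open>for \<open>r \<ge> 1\<close>\<close>
  "cartan_distribution F r j = {v \<in> tangent_space (jet_bundle F r) j.
     \<forall>c\<in>fcharts F. j \<in> jet_dom F r c \<longrightarrow>
       (\<forall>\<alpha><fdim F. \<forall>I\<in>multi_indices (bdim F) (r - 1). contact_form F r c \<alpha> I j v = 0)}"

definition vertical_polarisation ::
    "('e, 'q) fibration \<Rightarrow> nat \<Rightarrow> ('e, 'q) jet distribution" where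
  \<comment> \<open>the kernel of the tangent map of \<open>\<pi>\<^bsub>r,r-1\<^esub>\<close>, for \<open>r \<ge> 1\<close>\<close>
  "vertical_polarisation F r j = {v \<in> tangent_space (jet_bundle F r) j.
     tangent_map (jet_bundle F (r - 1)) (jet_proj F (r - 1)) j v = tzero}"

definition locally_holonomic ::
    "('e, 'q) fibration \<Rightarrow> nat \<Rightarrow> (('e, 'q) jet, 'k) mfd \<Rightarrow> bool" where
  "locally_holonomic F r S \<longleftrightarrow> (\<forall>p\<in>carr S. \<exists>W U \<sigma>.
     openin (mtop S) W \<and> p \<in> W \<and> local_section F U \<sigma> \<and> W = jet_of F r \<sigma> ` U)"

end

theory Submission
  imports Defs
begin

text \<open>
  In adapted jet coordinates \<open>x\<^sup>i\<close>, \<open>u\<^sub>I\<close> a vector \<open>v\<close> lies in the Cartan distribution if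
  \<open>v (u\<^sub>I) = \<Sum>\<^sub>i u\<^bsub>I + e\<^sub>i\<^esub> v (x\<^sup>i)\<close> for all \<open>|I| < r\<close>, and it is vertical if all its components vanish except those
  along the \<open>u\<^sub>I\<close> with \<open>|I| = r\<close>. So a Cartan vector is determined modulo vertical vectors by its
  projection to the base, every base vector has such a lift, and a polarised Legendrian subspace
  projects isomorphically onto the tangent space of the base.

  Let \<open>S\<close> be polarised Legendrian. The base coordinates \<open>x\<^sup>i\<close> then restrict to a chart of \<open>S\<close>, and \<open>S\<close> is
  locally a graph \<open>u\<^sub>I = g\<^sub>I (x)\<close>. Since the contact forms vanish on \<open>S\<close>, the functions satisfy
  \<open>\<partial>\<^sub>i g\<^sub>I = g\<^bsub>I + e\<^sub>i\<^esub>\<close> for \<open>|I| < r\<close>, so \<open>g\<^sub>I = \<partial>\<^sub>I g\<^sub>0\<close> and \<open>S\<close> is the prolongation of the section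
  \<open>u = g\<^sub>0 (x)\<close>; this is \<open>polarised_legendrian_prolongation\<close>.

  Conversely, on the image of \<open>j\<^sup>r\<sigma>\<close> one has \<open>u\<^sub>I = \<partial>\<^sub>I s (x)\<close>, hence
  \<open>v (u\<^sub>I) = \<Sum>\<^sub>l \<partial>\<^bsub>I + e\<^sub>l\<^esub> s v (x\<^sup>l)\<close> for tangent vectors \<open>v\<close> and \<open>|I| \<le> r\<close>. The orders below \<open>r\<close> give the contact
  conditions. Order \<open>r\<close> gives isotropy: for sections \<open>X\<close>, \<open>Y\<close> of the Cartan distribution the contact form
  with index \<open>I\<close> takes on \<open>[X, Y]\<close> the value \<open>\<Sum>\<^sub>i (X (u\<^bsub>I + e\<^sub>i\<^esub>) Y (x\<^sup>i) - Y (u\<^bsub>I + e\<^sub>i\<^esub>) X (x\<^sup>i))\<close>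
  (\<open>bracket_in_cartan\<close>, \<open>levi_eqI\<close>), which vanishes because the derivatives of \<open>s\<close> commute. Again
  the \<open>x\<^sup>i\<close> restrict to a chart, so \<open>S\<close> has a tangent vector over each base vector and the complement
  condition follows; this is \<open>prolongation_polarised_legendrian\<close>.

  Three pieces of theory carry this out. First, calculus for functions of finitely many labelled real
  variables: chain rule, symmetry of second derivatives, Hadamard's lemma, and the replacement of one
  coordinate by a function with nonzero derivative in its direction (\<open>replace_coordinate\<close>). Second,
  tangent vectors as derivations: Hadamard's lemma gives their chain rule (\<open>tvec_chain\<close>), and functions whose
  differentials span the cotangent space contain a chart, by exchanging coordinates one at a time
  (\<open>exchange_coordinates\<close>). Third, the jet bundle: derivatives of a section in one fibred chart are smooth
  functions of the derivatives in another (\<open>jet_transition\<close>), so that adapted jet coordinates are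
  charts (\<open>jet_coords_on\<close>) and the Cartan distribution can be tested in a single chart (\<open>cartan_iff\<close>).
\<close>


section \<open>Calculus on open subsets of coordinate spaces\<close>

abbreviation copen :: "'i set \<Rightarrow> ('i \<Rightarrow> real) set \<Rightarrow> bool" where
  "copen A U \<equiv> openin (top_of_set (coord_space A)) U"

definition cube :: "'i set \<Rightarrow> ('i \<Rightarrow> real) \<Rightarrow> real \<Rightarrow> ('i \<Rightarrow> real) set" where
  "cube A x e = {y \<in> coord_space A. \<forall>i\<in>A. \<bar>y i - x i\<bar> < e}"

lemma finite_common_radius:
  fixes Q :: "'i \<Rightarrow> real \<Rightarrow> bool"
  assumes "finite A" "\<And>i. i \<in> A \<Longrightarrow> \<exists>e>0. Q i e"
    and "\<And>i d e. 0 < d \<Longrightarrow> d \<le> e \<Longrightarrow> Q i e \<Longrightarrow> Q i d"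
  shows "\<exists>e>0. \<forall>i\<in>A. Q i e"
  using assms(1,2)
proof (induction A)
  case empty
  then show ?case by (auto intro: exI[of _ 1])
next
  case (insert a A)
  obtain e where e: "e > 0" "\<forall>i\<in>A. Q i e" using insert.IH insert.prems by blast
  obtain d where d: "d > 0" "Q a d" using insert.prems by blast
  have "Q i (min e d)" if "i \<in> A" for i
    by (rule assms(3)[of _ e]) (use e d that in auto)
  moreover have "Q a (min e d)" by (rule assms(3)[of _ d]) (use e d in auto)
  ultimately show ?case using e d by (intro exI[of _ "min e d"]) auto
qed

lemma fun_upd_in_coord_space: "x \<in> coord_space A \<Longrightarrow> i \<in> A \<Longrightarrow> x(i := t) \<in> coord_space A"
  by (auto simp: coord_space_def)

lemma coord_space_eqI:
  "x \<in> coord_space A \<Longrightarrow> y \<in> coord_space A \<Longrightarrow> (\<And>i. i \<in> A \<Longrightarrow> x i = y i) \<Longrightarrow> x = y"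
  by (rule ext) (metis (mono_tags, lifting) coord_space_def mem_Collect_eq)

lemma copen_imp_coord_space: "copen A U \<Longrightarrow> x \<in> U \<Longrightarrow> x \<in> coord_space A"
  by (drule openin_imp_subset) auto

lemma cube_subset: "d \<le> e \<Longrightarrow> cube A x d \<subseteq> cube A x e"
  by (force simp: cube_def)

lemma centre_in_cube: "x \<in> coord_space A \<Longrightarrow> e > 0 \<Longrightarrow> x \<in> cube A x e"
  by (auto simp: cube_def)

lemma copen_cube:
  assumes "finite A"
  shows "copen A (cube A x e)"
proof -
  have "open ((\<lambda>y::'a \<Rightarrow> real. y i) -` {x i - e<..<x i + e})" for i
    by (rule open_vimage) (auto intro: continuous_on_product_coordinates)
  then have "open (\<Inter>i\<in>A. (\<lambda>y::'a \<Rightarrow> real. y i) -` {x i - e<..<x i + e})"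
    using assms by (intro open_INT) auto
  moreover have "cube A x e = coord_space A \<inter> (\<Inter>i\<in>A. (\<lambda>y::'a \<Rightarrow> real. y i) -` {x i - e<..<x i + e})"
    unfolding cube_def by (auto simp: abs_diff_less_iff)
  ultimately show ?thesis
    unfolding openin_open by blast
qed

text \<open>Only finitely many coordinates are free in \<open>coord_space A\<close>, so the cubes form a basis of its
  topology.\<close>

lemma copen_contains_cube:
  assumes "finite A" "copen A U" "x \<in> U"
  obtains e where "e > 0" "cube A x e \<subseteq> U"
proof -
  obtain T where T: "open T" "U = coord_space A \<inter> T"
    using assms(2) by (auto simp: openin_open)
  then have "openin (product_topology (\<lambda>i. euclidean) UNIV) T"
    by (simp add: open_fun_def)
  then obtain W where W: "\<And>i. open (W i)" "x \<in> Pi\<^sub>E UNIV W" "Pi\<^sub>E UNIV W \<subseteq> T"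
    using assms(3) T(2) by (fastforce simp: openin_product_topology_alt)
  have "\<exists>e>0. ball (x i) e \<subseteq> W i" for i
    using W(1,2) by (metis PiE_mem UNIV_I open_contains_ball)
  then obtain e where e: "e > 0" "\<forall>i\<in>A. ball (x i) e \<subseteq> W i"
    using finite_common_radius[OF assms(1), of "\<lambda>i e. ball (x i) e \<subseteq> W i"]
      subset_ball order_trans by blast
  have "cube A x e \<subseteq> U"
  proof
    fix y assume y: "y \<in> cube A x e"
    have "y i \<in> W i" for i
    proof (cases "i \<in> A")
      case True
      then show ?thesis using y e(2) by (force simp: cube_def dist_real_def)
    next
      case False
      then have "y i = x i" using y assms(3) T(2) by (auto simp: cube_def coord_space_def)
      then show ?thesis using W(2) by (auto simp: PiE_iff)
    qed
    then show "y \<in> U" using W(3) T(2) y by (auto simp: cube_def)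
  qed
  then show ?thesis using that e(1) by blast
qed

lemma copenI:
  assumes "finite A" "U \<subseteq> coord_space A" "\<And>x. x \<in> U \<Longrightarrow> \<exists>e>0. cube A x e \<subseteq> U"
  shows "copen A U"
proof (subst openin_subopen, intro ballI)
  fix x assume "x \<in> U"
  then obtain e where "e > 0" "cube A x e \<subseteq> U" using assms(3) by blast
  then show "\<exists>T. copen A T \<and> x \<in> T \<and> T \<subseteq> U"
    by (intro exI[of _ "cube A x e"] conjI copen_cube[OF assms(1)] centre_in_cube)
      (use \<open>x \<in> U\<close> assms(2) in auto)
qed

lemma copen_Int: "copen A U \<Longrightarrow> copen A V \<Longrightarrow> copen A (U \<inter> V)"
  by (rule openin_Int)

lemma continuous_on_cubeD:
  fixes f :: "('i \<Rightarrow> real) \<Rightarrow> real"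
  assumes "finite A" "copen A U" "continuous_on U f" "x \<in> U" "\<epsilon> > 0"
  obtains \<delta> where "\<delta> > 0" "cube A x \<delta> \<subseteq> U" "\<And>y. y \<in> cube A x \<delta> \<Longrightarrow> \<bar>f y - f x\<bar> < \<epsilon>"
proof -
  have "openin (top_of_set U) (U \<inter> f -` {f x - \<epsilon><..<f x + \<epsilon>})"
    by (rule continuous_openin_preimage_gen[OF assms(3)]) simp
  then have "copen A (U \<inter> f -` {f x - \<epsilon><..<f x + \<epsilon>})"
    using assms(2) openin_trans by blast
  moreover have "x \<in> U \<inter> f -` {f x - \<epsilon><..<f x + \<epsilon>}" using assms by auto
  ultimately obtain \<delta> where "\<delta> > 0" "cube A x \<delta> \<subseteq> U \<inter> f -` {f x - \<epsilon><..<f x + \<epsilon>}"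
    using copen_contains_cube[OF assms(1)] by blast
  then show ?thesis using that[of \<delta>] by (fastforce simp: abs_less_iff)
qed

lemma continuous_on_cubeI:
  fixes f :: "('i \<Rightarrow> real) \<Rightarrow> real"
  assumes "finite A" "U \<subseteq> coord_space A"
    and "\<And>x \<epsilon>. x \<in> U \<Longrightarrow> \<epsilon> > 0 \<Longrightarrow> \<exists>\<delta>>0. \<forall>y\<in>U \<inter> cube A x \<delta>. \<bar>f y - f x\<bar> < \<epsilon>"
  shows "continuous_on U f"
  unfolding continuous_on_def
proof (intro ballI tendstoI)
  fix x and \<epsilon> :: real assume x: "x \<in> U" "\<epsilon> > 0"
  obtain \<delta> where d: "\<delta> > 0" "\<forall>y\<in>U \<inter> cube A x \<delta>. \<bar>f y - f x\<bar> < \<epsilon>"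
    using assms(3) x by blast
  obtain T where T: "open T" "cube A x \<delta> = coord_space A \<inter> T"
    using copen_cube[OF assms(1)] unfolding openin_open by blast
  have "x \<in> T" using centre_in_cube x d T assms(2) by blast
  then show "\<forall>\<^sub>F y in at x within U. dist (f y) (f x) < \<epsilon>"
    unfolding eventually_at_topological using T d(2) assms(2)
    by (auto simp: dist_real_def intro!: exI[of _ T])
qed

lemma eventually_in_cube:
  assumes "finite A" "\<And>i. i \<in> A \<Longrightarrow> ((\<lambda>t. \<gamma> t i) \<longlongrightarrow> x i) F"
    and "\<forall>\<^sub>F t in F. \<gamma> t \<in> coord_space A" "e > 0"
  shows "\<forall>\<^sub>F t in F. \<gamma> t \<in> cube A x e"
proof -
  have "\<forall>\<^sub>F t in F. \<bar>\<gamma> t i - x i\<bar> < e" if "i \<in> A" for i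
    using tendstoD[OF assms(2)[OF that] assms(4)] by (simp add: dist_real_def)
  then have "\<forall>\<^sub>F t in F. \<forall>i\<in>A. \<bar>\<gamma> t i - x i\<bar> < e"
    using assms(1) by (simp add: eventually_ball_finite)
  with assms(3) show ?thesis by eventually_elim (auto simp: cube_def)
qed

lemma eventually_in_copen:
  assumes "finite A" "copen A U" "x \<in> U" "\<And>i. i \<in> A \<Longrightarrow> ((\<lambda>t. \<gamma> t i) \<longlongrightarrow> x i) F"
    and "\<forall>\<^sub>F t in F. \<gamma> t \<in> coord_space A"
  shows "\<forall>\<^sub>F t in F. \<gamma> t \<in> U"
proof -
  obtain e where "e > 0" "cube A x e \<subseteq> U" using copen_contains_cube assms(1-3) by blast
  with eventually_in_cube[OF assms(1,4,5) this(1)] show ?thesis by (auto elim: eventually_mono)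
qed

lemma tendsto_along_cubes:
  fixes g :: "('i \<Rightarrow> real) \<Rightarrow> real"
  assumes "finite A" "copen A U" "continuous_on U g" "x \<in> U"
    and "\<And>e. e > 0 \<Longrightarrow> \<forall>\<^sub>F t in F. \<gamma> t \<in> cube A x e"
  shows "((\<lambda>t. g (\<gamma> t)) \<longlongrightarrow> g x) F"
proof (rule tendstoI)
  fix \<epsilon> :: real assume "\<epsilon> > 0"
  then obtain \<delta> where "\<delta> > 0" "\<And>y. y \<in> cube A x \<delta> \<Longrightarrow> \<bar>g y - g x\<bar> < \<epsilon>"
    using continuous_on_cubeD[OF assms(1-4)] by metis
  then show "\<forall>\<^sub>F t in F. dist (g (\<gamma> t)) (g x) < \<epsilon>"
    using assms(5)[of \<delta>] by (auto simp: dist_real_def elim: eventually_mono)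
qed

lemma eventually_fun_upd_in:
  assumes "finite A" "copen A U" "x \<in> U" "i \<in> A"
  shows "\<forall>\<^sub>F t in nhds (x i). x(i := t) \<in> U"
proof -
  have "((\<lambda>t. (x(i := t)) j) \<longlongrightarrow> x j) (nhds (x i))" for j
    by (cases "j = i") (auto intro: filterlim_ident)
  moreover have "x(i := t) \<in> coord_space A" for t
    by (rule fun_upd_in_coord_space[OF copen_imp_coord_space[OF assms(2,3)] assms(4)])
  ultimately show ?thesis
    by (intro eventually_in_copen[OF assms(1-3)] always_eventually allI)
qed

subsection \<open>Partial derivatives\<close>

abbreviation has_pd :: "'i \<Rightarrow> (('i \<Rightarrow> real) \<Rightarrow> real) \<Rightarrow> ('i \<Rightarrow> real) \<Rightarrow> real \<Rightarrow> bool" where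
  "has_pd i f x d \<equiv> ((\<lambda>t. f (x(i := t))) has_real_derivative d) (at (x i))"

lemma has_pd_imp_pd: "has_pd i f x d \<Longrightarrow> pd i f x = d"
  by (simp add: pd_def DERIV_imp_deriv)

lemma has_pd_cong:
  assumes "finite A" "copen A U" "\<forall>y\<in>U. f y = g y" "x \<in> U" "i \<in> A"
  shows "has_pd i f x d \<longleftrightarrow> has_pd i g x d"
proof (rule DERIV_cong_ev)
  show "\<forall>\<^sub>F t in nhds (x i). f (x(i := t)) = g (x(i := t))"
    using eventually_fun_upd_in[OF assms(1,2,4,5)] by eventually_elim (use assms(3) in blast)
qed auto

lemma pd_cong:
  assumes "finite A" "copen A U" "\<forall>y\<in>U. f y = g y" "x \<in> U" "i \<in> A"
  shows "pd i f x = pd i g x"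
  using has_pd_cong[OF assms] unfolding pd_def deriv_def by simp

lemma C_k_imp_has_pd:
  "C_k (Suc k) A U f \<Longrightarrow> x \<in> U \<Longrightarrow> i \<in> A \<Longrightarrow> has_pd i f x (pd i f x)"
  by (simp add: pd_def DERIV_deriv_iff_real_differentiable)

lemma C_k_imp_continuous: "C_k k A U f \<Longrightarrow> continuous_on U f"
  by (cases k) auto

lemma C_k_pd: "C_k (Suc k) A U f \<Longrightarrow> i \<in> A \<Longrightarrow> C_k k A U (pd i f)"
  by simp

lemma C_k_cong:
  assumes "finite A" "copen A U"
  shows "\<forall>x\<in>U. f x = g x \<Longrightarrow> C_k k A U f \<Longrightarrow> C_k k A U g"
proof (induction k arbitrary: f g)
  case 0
  then show ?case using continuous_on_cong[of U U f g] by auto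
next
  case (Suc k)
  have 1: "continuous_on U g"
    using continuous_on_cong[of U U f g] Suc.prems by auto
  have 2: "(\<lambda>t. g (x(i := t))) differentiable (at (x i))" if "i \<in> A" "x \<in> U" for i x
    using has_pd_cong[OF assms Suc.prems(1) that(2,1)] C_k_imp_has_pd[OF Suc.prems(2) that(2,1)]
    unfolding real_differentiable_def by blast
  have 3: "C_k k A U (pd i g)" if "i \<in> A" for i
    using Suc.IH[of "pd i f" "pd i g"] pd_cong[OF assms Suc.prems(1) _ that] Suc.prems(2) that
    by auto
  show ?case using 1 2 3 by simp
qed

text \<open>Calculus rules produce candidates for the partial derivatives rather than statements about
  \<^const>\<open>pd\<close>, which is a \<^const>\<open>deriv\<close>; uniqueness of derivatives connects the two.\<close>

lemma C_k_SucI: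
  assumes "finite A" "copen A U" "continuous_on U f"
    and "\<And>i x. i \<in> A \<Longrightarrow> x \<in> U \<Longrightarrow> has_pd i f x (g i x)" "\<And>i. i \<in> A \<Longrightarrow> C_k k A U (g i)"
  shows "C_k (Suc k) A U f"
proof -
  have "C_k k A U (pd i f)" if "i \<in> A" for i
    using C_k_cong[OF assms(1,2), of "g i" "pd i f"] assms(4,5)[OF that] has_pd_imp_pd by metis
  then show ?thesis using assms(3,4) by (auto simp: real_differentiable_def)
qed

lemma C_k_subset: "V \<subseteq> U \<Longrightarrow> C_k k A U f \<Longrightarrow> C_k k A V f"
  by (induction k arbitrary: f) (auto intro: continuous_on_subset)

lemma C_k_mono:
  assumes "C_k (Suc k) A U f"
  shows "C_k k A U f"
  using assms by (induction k arbitrary: f) auto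

lemma continuous_on_local:
  assumes "\<And>x. x \<in> U \<Longrightarrow> \<exists>V. openin (top_of_set U) V \<and> x \<in> V \<and> continuous_on V f"
  shows "continuous_on U f"
  unfolding continuous_on_def
proof
  fix x assume x: "x \<in> U"
  then obtain V where V0: "openin (top_of_set U) V" "x \<in> V" "continuous_on V f"
    using assms by blast
  then obtain T where "open T" "V = U \<inter> T" unfolding openin_open by blast
  note V = V0(2,3) this
  have "at x within U = at x within V"
    by (rule at_within_nhd[of x T]) (use V in auto)
  then show "(f \<longlongrightarrow> f x) (at x within U)"
    using V(1,2) unfolding continuous_on_def by simp
qed

lemma continuous_on_copen_local:
  assumes "copen A U" "\<And>x. x \<in> U \<Longrightarrow> \<exists>V. copen A V \<and> x \<in> V \<and> continuous_on V f"
  shows "continuous_on U f"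
proof (rule continuous_on_local)
  fix x assume "x \<in> U"
  then obtain V where V: "copen A V" "x \<in> V" "continuous_on V f" using assms(2) by blast
  then obtain T where "open T" "V = coord_space A \<inter> T" unfolding openin_open by blast
  then have "openin (top_of_set U) (U \<inter> V)"
    using openin_imp_subset[OF assms(1)] unfolding openin_open by blast
  moreover have "continuous_on (U \<inter> V) f" by (rule continuous_on_subset[OF V(3)]) blast
  ultimately show "\<exists>V. openin (top_of_set U) V \<and> x \<in> V \<and> continuous_on V f"
    using V(2) \<open>x \<in> U\<close> by blast
qed

lemma C_k_local:
  assumes "copen A U"
  shows "(\<And>x. x \<in> U \<Longrightarrow> \<exists>V. copen A V \<and> x \<in> V \<and> C_k k A V f) \<Longrightarrow> C_k k A U f"
proof (induction k arbitrary: f)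
  case (0 f)
  then show ?case by (intro C_k.simps(1)[THEN iffD2] continuous_on_copen_local[OF assms]) simp
next
  case (Suc k f)
  have "continuous_on U f"
    by (rule continuous_on_copen_local[OF assms]) (use Suc.prems in force)
  moreover have "C_k k A U (pd i f)" if "i \<in> A" for i
  proof (rule Suc.IH)
    fix x assume "x \<in> U"
    then show "\<exists>V. copen A V \<and> x \<in> V \<and> C_k k A V (pd i f)" using Suc.prems that by force
  qed
  moreover have "(\<lambda>t. f (x(i := t))) differentiable (at (x i))" if "i \<in> A" "x \<in> U" for i x
    using Suc.prems that by force
  ultimately show ?case by simp
qed

lemma mvt_segment:
  fixes g :: "real \<Rightarrow> real"
  assumes "\<And>t. t \<in> closed_segment a b \<Longrightarrow> (g has_real_derivative g' t) (at t)"
  shows "\<exists>t\<in>closed_segment a b. g b - g a = g' t * (b - a)"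
proof (cases a b rule: linorder_cases)
  case less
  then obtain t where "a < t" "t < b" "g b - g a = (b - a) * g' t"
    using MVT2[of a b g g'] assms by (auto simp: closed_segment_eq_real_ivl)
  then show ?thesis by (auto simp: closed_segment_eq_real_ivl intro!: bexI[of _ t])
next
  case equal
  then show ?thesis by auto
next
  case greater
  then obtain t where "b < t" "t < a" "g a - g b = (a - b) * g' t"
    using MVT2[of b a g g'] assms by (auto simp: closed_segment_eq_real_ivl)
  then show ?thesis
    by (auto simp: closed_segment_eq_real_ivl algebra_simps intro!: bexI[of _ t])
qed

text \<open>Changing the coordinates one after the other and applying the mean value theorem at each
  change writes the increment of \<open>f\<close> exactly in terms of its partial derivatives at points between
  \<open>x\<close> and \<open>y\<close>. This plays the role of total differentiability.\<close>

lemma increment_expansion: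
  assumes "finite A" "x \<in> coord_space A"
    and d: "\<And>i y. i \<in> A \<Longrightarrow> y \<in> cube A x e \<Longrightarrow> has_pd i f y (pd i f y)"
    and y: "y \<in> cube A x e"
  shows "\<exists>\<xi>. (\<forall>i\<in>A. \<xi> i \<in> coord_space A \<and> (\<forall>j\<in>A. \<bar>\<xi> i j - x j\<bar> \<le> \<bar>y j - x j\<bar>)) \<and>
    f y - f x = (\<Sum>i\<in>A. pd i f (\<xi> i) * (y i - x i))"
proof -
  have "\<exists>\<xi>. (\<forall>i\<in>B. \<xi> i \<in> coord_space A \<and> (\<forall>j\<in>A. \<bar>\<xi> i j - x j\<bar> \<le> \<bar>y j - x j\<bar>)) \<and>
    f y - f x = (\<Sum>i\<in>B. pd i f (\<xi> i) * (y i - x i))"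
    if "finite B" "B \<subseteq> A" "y \<in> cube A x e" "\<And>j. j \<notin> B \<Longrightarrow> y j = x j" for B y
    using that
  proof (induction B arbitrary: y)
    case empty
    then have "y = x" by auto
    then show ?case by simp
  next
    case (insert b B)
    define z where "z = y(b := x b)"
    have bA: "b \<in> A" using insert by auto
    have z: "z \<in> cube A x e"
      using insert.prems bA fun_upd_in_coord_space by (force simp: z_def cube_def)
    obtain \<xi> where \<xi>: "\<forall>i\<in>B. \<xi> i \<in> coord_space A \<and> (\<forall>j\<in>A. \<bar>\<xi> i j - x j\<bar> \<le> \<bar>z j - x j\<bar>)"
      "f z - f x = (\<Sum>i\<in>B. pd i f (\<xi> i) * (z i - x i))"
    proof -
      have "z j = x j" if "j \<notin> B" for j using insert.prems(3)[of j] that by (auto simp: z_def)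
      from insert.IH[OF _ z this] insert.prems(1) show ?thesis using that by blast
    qed
    have seg: "y(b := t) \<in> cube A x e \<and> \<bar>t - x b\<bar> \<le> \<bar>y b - x b\<bar>"
      if "t \<in> closed_segment (x b) (y b)" for t
    proof -
      have "\<bar>t - x b\<bar> \<le> \<bar>y b - x b\<bar>"
        using that by (auto simp: closed_segment_eq_real_ivl split: if_splits)
      then show ?thesis
        using insert.prems(2) bA fun_upd_in_coord_space by (force simp: cube_def)
    qed
    have "((\<lambda>t. f (y(b := t))) has_real_derivative pd b f (y(b := t))) (at t)"
      if "t \<in> closed_segment (x b) (y b)" for t
      using d[OF bA, of "y(b := t)"] seg[OF that] by simp
    from mvt_segment[of "x b" "y b" "\<lambda>t. f (y(b := t))" "\<lambda>t. pd b f (y(b := t))", OF this]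
    obtain t where t: "t \<in> closed_segment (x b) (y b)"
      "f (y(b := y b)) - f (y(b := x b)) = pd b f (y(b := t)) * (y b - x b)" by blast
    define \<xi>' where "\<xi>' = \<xi>(b := y(b := t))"
    have s: "(\<Sum>i\<in>B. pd i f (\<xi> i) * (z i - x i)) = (\<Sum>i\<in>B. pd i f (\<xi>' i) * (y i - x i))"
      using insert.hyps by (intro sum.cong) (auto simp: \<xi>'_def z_def)
    have "\<bar>\<xi> i j - x j\<bar> \<le> \<bar>y j - x j\<bar>" if "i \<in> B" "j \<in> A" for i j
    proof -
      have "\<bar>z j - x j\<bar> \<le> \<bar>y j - x j\<bar>" by (simp add: z_def)
      then show ?thesis using \<xi>(1) that by (meson order_trans)
    qed
    then have "\<forall>i\<in>insert b B. \<xi>' i \<in> coord_space A \<and> (\<forall>j\<in>A. \<bar>\<xi>' i j - x j\<bar> \<le> \<bar>y j - x j\<bar>)"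
      using \<xi>(1) seg[OF t(1)] by (auto simp: \<xi>'_def cube_def)
    moreover have "f y - f x = (\<Sum>i\<in>insert b B. pd i f (\<xi>' i) * (y i - x i))"
      using t(2) \<xi>(2) insert.hyps s by (simp add: z_def \<xi>'_def)
    ultimately show ?case by blast
  qed
  moreover have "j \<notin> A \<Longrightarrow> y j = x j" for j
    using assms(2) y by (auto simp: cube_def coord_space_def)
  ultimately show ?thesis using assms(1) y by blast
qed

text \<open>As \<open>t\<close> tends to \<open>t0\<close>, the intermediate points of the expansion of \<open>f (\<gamma> t) - f (\<gamma> t0)\<close>
  tend to \<open>\<gamma> t0\<close>, and continuity of the partial derivatives gives the limit of the difference
  quotient.\<close>

lemma chain_rule:
  fixes \<gamma> :: "real \<Rightarrow> 'i \<Rightarrow> real"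
  assumes A: "finite A" "copen A U" and f: "C_k (Suc 0) A U f" and x: "\<gamma> t0 \<in> U"
    and ev: "\<forall>\<^sub>F t in at t0. \<gamma> t \<in> coord_space A"
    and \<gamma>: "\<And>i. i \<in> A \<Longrightarrow> ((\<lambda>t. \<gamma> t i) has_real_derivative d i) (at t0)"
  shows "((\<lambda>t. f (\<gamma> t)) has_real_derivative (\<Sum>i\<in>A. pd i f (\<gamma> t0) * d i)) (at t0)"
proof -
  define x where "x = \<gamma> t0"
  have xc: "x \<in> coord_space A" using A x by (simp add: x_def copen_imp_coord_space)
  obtain e where e: "e > 0" "cube A x e \<subseteq> U"
    using copen_contains_cube[OF A x] x_def by metis
  have tends: "((\<lambda>t. \<gamma> t i) \<longlongrightarrow> x i) (at t0)" if "i \<in> A" for i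
    using DERIV_isCont[OF \<gamma>[OF that]] by (simp add: isCont_def x_def)
  have evc: "\<forall>\<^sub>F t in at t0. \<gamma> t \<in> cube A x \<delta>" if "\<delta> > 0" for \<delta>
    by (rule eventually_in_cube[OF A(1) tends ev that])
  have "\<exists>\<xi>. \<gamma> t \<in> cube A x e \<longrightarrow>
    (\<forall>i\<in>A. \<xi> i \<in> coord_space A \<and> (\<forall>j\<in>A. \<bar>\<xi> i j - x j\<bar> \<le> \<bar>\<gamma> t j - x j\<bar>)) \<and>
    f (\<gamma> t) - f x = (\<Sum>i\<in>A. pd i f (\<xi> i) * (\<gamma> t i - x i))" for t
  proof (cases "\<gamma> t \<in> cube A x e")
    case True
    have "has_pd i f y (pd i f y)" if "i \<in> A" "y \<in> cube A x e" for i y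
      using C_k_imp_has_pd[OF f _ that(1)] e(2) that(2) by blast
    from increment_expansion[OF A(1) xc this True] show ?thesis by blast
  qed blast
  then have "\<forall>t. \<exists>\<xi>. \<gamma> t \<in> cube A x e \<longrightarrow>
    (\<forall>i\<in>A. \<xi> i \<in> coord_space A \<and> (\<forall>j\<in>A. \<bar>\<xi> i j - x j\<bar> \<le> \<bar>\<gamma> t j - x j\<bar>)) \<and>
    f (\<gamma> t) - f x = (\<Sum>i\<in>A. pd i f (\<xi> i) * (\<gamma> t i - x i))" by blast
  from choice[OF this] obtain \<Xi> where \<Xi>: "\<And>t. \<gamma> t \<in> cube A x e \<Longrightarrow>
    (\<forall>i\<in>A. \<Xi> t i \<in> coord_space A \<and> (\<forall>j\<in>A. \<bar>\<Xi> t i j - x j\<bar> \<le> \<bar>\<gamma> t j - x j\<bar>)) \<and>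
    f (\<gamma> t) - f x = (\<Sum>i\<in>A. pd i f (\<Xi> t i) * (\<gamma> t i - x i))" by blast
  have lim: "((\<lambda>t. pd i f (\<Xi> t i)) \<longlongrightarrow> pd i f x) (at t0)" if i: "i \<in> A" for i
  proof (rule tendsto_along_cubes[OF A, where g = "pd i f" and x = x and \<gamma> = "\<lambda>t. \<Xi> t i"])
    show "continuous_on U (pd i f)" using f i by simp
    show "x \<in> U" using x x_def by simp
    fix \<delta> :: real assume "\<delta> > 0"
    show "\<forall>\<^sub>F t in at t0. \<Xi> t i \<in> cube A x \<delta>"
      using evc[OF \<open>\<delta> > 0\<close>] evc[OF e(1)]
    proof eventually_elim
      case (elim t)
      then show ?case using \<Xi>[OF elim(2)] i by (force simp: cube_def)
    qed
  qed
  have "((\<lambda>t. \<Sum>i\<in>A. pd i f (\<Xi> t i) * ((\<gamma> t i - x i) / (t - t0))) \<longlongrightarrow>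
      (\<Sum>i\<in>A. pd i f x * d i)) (at t0)"
    using \<gamma> by (intro tendsto_sum tendsto_mult lim) (auto simp: has_field_derivative_iff x_def)
  moreover have "\<forall>\<^sub>F t in at t0. (\<Sum>i\<in>A. pd i f (\<Xi> t i) * ((\<gamma> t i - x i) / (t - t0))) =
      (f (\<gamma> t) - f (\<gamma> t0)) / (t - t0)"
    using evc[OF e(1)]
  proof eventually_elim
    case (elim t)
    then show ?case using \<Xi>[OF elim] by (simp add: x_def sum_divide_distrib)
  qed
  ultimately have "((\<lambda>t. (f (\<gamma> t) - f (\<gamma> t0)) / (t - t0)) \<longlongrightarrow> (\<Sum>i\<in>A. pd i f x * d i)) (at t0)"
    by (rule Lim_transform_eventually)
  then show ?thesis by (simp add: has_field_derivative_iff x_def)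
qed

subsection \<open>Closure properties\<close>

lemma C_k_const:
  assumes "finite A" "copen A U"
  shows "C_k k A U (\<lambda>_. c)"
proof (induction k arbitrary: c)
  case (Suc k)
  show ?case
    by (rule C_k_SucI[OF assms, where g = "\<lambda>_ _. 0"]) (use Suc in \<open>auto\<close>)
qed simp

lemma C_k_coord:
  assumes "finite A" "copen A U"
  shows "C_k k A U (\<lambda>x. x j)"
proof (cases k)
  case 0
  then show ?thesis
    by (auto intro: continuous_on_subset[OF continuous_on_product_coordinates])
next
  case (Suc k')
  have "has_pd i (\<lambda>x. x j) x (if i = j then 1 else 0)" for i x
    by (cases "i = j") auto
  then show ?thesis unfolding Suc
    by (intro C_k_SucI[OF assms, where g = "\<lambda>i _. if i = j then 1 else 0"])
      (auto intro: continuous_on_subset[OF continuous_on_product_coordinates] C_k_const[OF assms])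
qed

lemma C_k_add:
  assumes "finite A" "copen A U"
  shows "C_k k A U f \<Longrightarrow> C_k k A U g \<Longrightarrow> C_k k A U (\<lambda>x. f x + g x)"
proof (induction k arbitrary: f g)
  case (Suc k)
  show ?case
  proof (rule C_k_SucI[OF assms, where g = "\<lambda>i x. pd i f x + pd i g x"])
    show "continuous_on U (\<lambda>x. f x + g x)"
      using Suc.prems by (intro continuous_on_add C_k_imp_continuous)
    show "has_pd i (\<lambda>x. f x + g x) x (pd i f x + pd i g x)" if "i \<in> A" "x \<in> U" for i x
      by (rule DERIV_add[OF C_k_imp_has_pd[OF Suc.prems(1) that(2,1)] C_k_imp_has_pd[OF Suc.prems(2) that(2,1)]])
    show "C_k k A U (\<lambda>x. pd i f x + pd i g x)" if "i \<in> A" for i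
      by (rule Suc.IH) (use Suc.prems that in auto)
  qed
qed (auto intro: continuous_on_add)

lemma C_k_mult:
  assumes "finite A" "copen A U"
  shows "C_k k A U f \<Longrightarrow> C_k k A U g \<Longrightarrow> C_k k A U (\<lambda>x. f x * g x)"
proof (induction k arbitrary: f g)
  case (Suc k)
  show ?case
  proof (rule C_k_SucI[OF assms, where g = "\<lambda>i x. pd i f x * g x + pd i g x * f x"])
    show "continuous_on U (\<lambda>x. f x * g x)"
      using Suc.prems by (intro continuous_on_mult C_k_imp_continuous)
    show "has_pd i (\<lambda>x. f x * g x) x (pd i f x * g x + pd i g x * f x)" if "i \<in> A" "x \<in> U" for i x
      by (rule DERIV_cong[OF DERIV_mult[OF C_k_imp_has_pd[OF Suc.prems(1) that(2,1)]
        C_k_imp_has_pd[OF Suc.prems(2) that(2,1)]]]) simp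
    show "C_k k A U (\<lambda>x. pd i f x * g x + pd i g x * f x)" if "i \<in> A" for i
      by (intro C_k_add[OF assms] Suc.IH C_k_mono[of k A U f] C_k_mono[of k A U g])
        (use Suc.prems that in auto)
  qed
qed (auto intro: continuous_on_mult)

lemma C_k_sum:
  assumes "finite A" "copen A U" "\<And>b. b \<in> B \<Longrightarrow> C_k k A U (f b)"
  shows "C_k k A U (\<lambda>x. \<Sum>b\<in>B. f b x)"
  using assms(3)
proof (induction B rule: infinite_finite_induct)
  case (insert b B)
  then show ?case using C_k_add[OF assms(1,2), of k "f b" "\<lambda>x. \<Sum>b\<in>B. f b x"] by simp
qed (simp_all add: C_k_const[OF assms(1,2)])

lemma C_k_inverse:
  assumes "finite A" "copen A U" "\<forall>x\<in>U. f x \<noteq> 0"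
  shows "C_k k A U f \<Longrightarrow> C_k k A U (\<lambda>x. inverse (f x))"
proof (induction k)
  case 0
  then show ?case using assms(3) by (auto intro!: continuous_on_inverse)
next
  case (Suc k)
  have IH: "C_k k A U (\<lambda>x. inverse (f x))" by (rule Suc.IH[OF C_k_mono[OF Suc.prems]])
  show ?case
  proof (rule C_k_SucI[OF assms(1,2), where g = "\<lambda>i x. (-1) * (inverse (f x) * (inverse (f x) * pd i f x))"])
    show "continuous_on U (\<lambda>x. inverse (f x))"
      using C_k_imp_continuous[OF IH] .
    show "has_pd i (\<lambda>x. inverse (f x)) x ((-1) * (inverse (f x) * (inverse (f x) * pd i f x)))"
      if "i \<in> A" "x \<in> U" for i x
      by (rule DERIV_cong[OF DERIV_inverse'[OF C_k_imp_has_pd[OF Suc.prems that(2,1)]]])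
        (use assms(3) that in \<open>simp_all add: mult_ac\<close>)
    show "C_k k A U (\<lambda>x. (-1) * (inverse (f x) * (inverse (f x) * pd i f x)))" if "i \<in> A" for i
      using Suc.prems that
      by (intro C_k_mult[OF assms(1,2)] C_k_const[OF assms(1,2)] IH) auto
  qed
qed

lemma continuous_on_into_coord_space:
  assumes "\<And>i. i \<in> A \<Longrightarrow> continuous_on V (\<lambda>y. g y i)" "\<And>y. y \<in> V \<Longrightarrow> g y \<in> coord_space A"
  shows "continuous_on V g"
proof (rule continuous_on_coordinatewise_then_product)
  fix i show "continuous_on V (\<lambda>y. g y i)"
  proof (cases "i \<in> A")
    case False
    then have "\<forall>y\<in>V. g y i = 0" using assms(2) by (auto simp: coord_space_def)
    then show ?thesis using continuous_on_cong[of V V "\<lambda>y. g y i" "\<lambda>_. 0"] by auto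
  qed (use assms(1) in auto)
qed

lemma has_pd_compose:
  assumes A: "finite A" "copen A U" and B: "finite B" "copen B V"
    and f: "C_k (Suc 0) A U f" and gU: "\<forall>y\<in>V. g y \<in> U"
    and j: "j \<in> B" and y: "y \<in> V"
    and g: "\<And>i. i \<in> A \<Longrightarrow> has_pd j (\<lambda>y. g y i) y (d i)"
  shows "has_pd j (\<lambda>y. f (g y)) y (\<Sum>i\<in>A. pd i f (g y) * d i)"
proof -
  have "\<forall>\<^sub>F t in at (y j). y(j := t) \<in> V"
    using eventually_fun_upd_in[OF B y j] by (simp add: eventually_nhds_conv_at)
  then have ev: "\<forall>\<^sub>F t in at (y j). g (y(j := t)) \<in> coord_space A"
    by eventually_elim (use gU copen_imp_coord_space[OF A(2)] in blast)
  have "((\<lambda>t. f (g (y(j := t)))) has_real_derivative (\<Sum>i\<in>A. pd i f (g (y(j := y j))) * d i)) (at (y j))"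
    by (rule chain_rule[OF A f _ ev]) (use gU y g in auto)
  then show ?thesis by simp
qed

text \<open>The chain rule expresses the partial derivatives of the composition through
  \<open>pd i f \<circ> g\<close>, so the induction on \<open>k\<close> has to run over all \<open>f\<close>.\<close>

lemma C_k_compose:
  assumes A: "finite A" "copen A U" and B: "finite B" "copen B V"
    and gU: "\<forall>y\<in>V. g y \<in> U"
  shows "C_k k A U f \<Longrightarrow> (\<And>i. i \<in> A \<Longrightarrow> C_k k B V (\<lambda>y. g y i)) \<Longrightarrow> C_k k B V (\<lambda>y. f (g y))"
proof (induction k arbitrary: f)
  case 0
  have "continuous_on V g"
    by (rule continuous_on_into_coord_space[of A])
      (use 0 gU copen_imp_coord_space[OF A(2)] in auto)
  then show ?case using 0 gU continuous_on_compose2[of U f V g] by auto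
next
  case (Suc k)
  have "C_k k A U f" by (rule C_k_mono[OF Suc.prems(1)])
  moreover have gk: "C_k k B V (\<lambda>y. g y i)" if "i \<in> A" for i
    by (rule C_k_mono[OF Suc.prems(2)[OF that]])
  ultimately have c: "C_k k B V (\<lambda>y. f (g y))" using Suc.IH by blast
  have f1: "C_k (Suc 0) A U f"
    using Suc.prems(1) C_k_imp_continuous by (auto intro: C_k_imp_continuous)
  show ?case
  proof (rule C_k_SucI[OF B, where g = "\<lambda>j y. \<Sum>i\<in>A. pd i f (g y) * pd j (\<lambda>y. g y i) y"])
    show "continuous_on V (\<lambda>y. f (g y))" by (rule C_k_imp_continuous[OF c])
    show "has_pd j (\<lambda>y. f (g y)) y (\<Sum>i\<in>A. pd i f (g y) * pd j (\<lambda>y. g y i) y)"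
      if "j \<in> B" "y \<in> V" for j y
      by (rule has_pd_compose[OF A B f1 gU that C_k_imp_has_pd[OF Suc.prems(2) that(2,1)]])
    show "C_k k B V (\<lambda>y. \<Sum>i\<in>A. pd i f (g y) * pd j (\<lambda>y. g y i) y)" if "j \<in> B" for j
    proof (rule C_k_sum[OF B], rule C_k_mult[OF B])
      fix i assume i: "i \<in> A"
      show "C_k k B V (\<lambda>y. pd i f (g y))" by (rule Suc.IH[OF C_k_pd[OF Suc.prems(1) i] gk])
      show "C_k k B V (pd j (\<lambda>y. g y i))" by (rule C_k_pd[OF Suc.prems(2)[OF i] that])
    qed
  qed
qed

subsection \<open>Symmetry of second partial derivatives\<close>

text \<open>The second difference of \<open>f\<close> over a square is symmetric in \<open>i\<close> and \<open>j\<close>, while two applications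
  of the mean value theorem, first in direction \<open>i\<close>, evaluate it as a value of \<open>pd j (pd i f)\<close>. Shrinking
  the square gives the symmetry of second derivatives.\<close>

lemma second_difference_mvt:
  assumes A: "finite A" "copen A U" and f: "C_k (Suc (Suc 0)) A U f"
    and ij: "i \<in> A" "j \<in> A" "i \<noteq> j" and x: "x \<in> U" and e: "cube A x e \<subseteq> U" and d: "0 < d" "d < e"
  shows "\<exists>p\<in>cube A x e. f (x(i := x i + d, j := x j + d)) - f (x(i := x i + d)) - f (x(j := x j + d)) + f x
    = d * d * pd j (pd i f) p"
proof -
  have xc: "x \<in> coord_space A" by (rule copen_imp_coord_space[OF A(2) x])
  define P where "P s t = x(i := s, j := t)" for s t
  have inU: "P s t \<in> cube A x e" if "\<bar>s - x i\<bar> < e" "\<bar>t - x j\<bar> < e" for s t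
    using that xc ij d by (auto simp: P_def cube_def coord_space_def)
  have f1: "C_k (Suc 0) A U f" by (rule C_k_mono[OF f])
  have ds: "((\<lambda>s. f (P s t)) has_real_derivative pd i f (P s t)) (at s)"
    if "\<bar>s - x i\<bar> < e" "\<bar>t - x j\<bar> < e" for s t
  proof -
    have "has_pd i f (P s t) (pd i f (P s t))"
      using C_k_imp_has_pd[OF f1 _ ij(1)] inU[OF that] e by blast
    moreover have "(P s t)(i := u) = P u t" for u using ij by (auto simp: P_def fun_upd_twist)
    ultimately show ?thesis using ij(3) by (simp add: P_def)
  qed
  have dt: "((\<lambda>t. pd i f (P s t)) has_real_derivative pd j (pd i f) (P s t)) (at t)"
    if "\<bar>s - x i\<bar> < e" "\<bar>t - x j\<bar> < e" for s t
  proof -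
    have "has_pd j (pd i f) (P s t) (pd j (pd i f) (P s t))"
      using C_k_imp_has_pd[OF C_k_pd[OF f ij(1)] _ ij(2)] inU[OF that] e by blast
    moreover have "(P s t)(j := u) = P s u" for u by (auto simp: P_def)
    ultimately show ?thesis by (simp add: P_def)
  qed
  have "\<exists>s. x i < s \<and> s < x i + d \<and> (f (P (x i + d) (x j + d)) - f (P (x i + d) (x j)))
      - (f (P (x i) (x j + d)) - f (P (x i) (x j)))
      = (x i + d - x i) * (pd i f (P s (x j + d)) - pd i f (P s (x j)))"
    by (rule MVT2) (use d in \<open>auto intro!: DERIV_diff ds\<close>)
  then obtain s where s: "x i < s" "s < x i + d"
    "(f (P (x i + d) (x j + d)) - f (P (x i + d) (x j))) - (f (P (x i) (x j + d)) - f (P (x i) (x j)))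
      = d * (pd i f (P s (x j + d)) - pd i f (P s (x j)))" by auto
  have "\<exists>t. x j < t \<and> t < x j + d \<and> pd i f (P s (x j + d)) - pd i f (P s (x j))
      = (x j + d - x j) * pd j (pd i f) (P s t)"
    by (rule MVT2) (use d s in \<open>auto intro!: dt\<close>)
  then obtain t where t: "x j < t" "t < x j + d"
    "pd i f (P s (x j + d)) - pd i f (P s (x j)) = d * pd j (pd i f) (P s t)" by auto
  have "P s t \<in> cube A x e" by (rule inU) (use s t d in auto)
  moreover have "P (x i + d) (x j) = x(i := x i + d)" "P (x i) (x j + d) = x(j := x j + d)" "P (x i) (x j) = x"
    using ij by (auto simp: P_def fun_upd_twist)
  ultimately show ?thesis using s(3) t(3) by (intro bexI[of _ "P s t"]) (auto simp: P_def)
qed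

lemma pd_commute:
  assumes A: "finite A" "copen A U" and f: "C_k (Suc (Suc 0)) A U f"
    and ij: "i \<in> A" "j \<in> A" and x: "x \<in> U"
  shows "pd i (pd j f) x = pd j (pd i f) x"
proof (cases "i = j")
  case False
  have "\<bar>pd i (pd j f) x - pd j (pd i f) x\<bar> \<le> \<epsilon>" if "\<epsilon> > 0" for \<epsilon>
  proof -
    have "continuous_on U (pd i (pd j f))" "continuous_on U (pd j (pd i f))" using f ij by auto
    from continuous_on_cubeD[OF A this(1) x, of "\<epsilon>/2"] continuous_on_cubeD[OF A this(2) x, of "\<epsilon>/2"]
    obtain d1 d2 where d: "d1 > 0" "\<And>y. y \<in> cube A x d1 \<Longrightarrow> \<bar>pd i (pd j f) y - pd i (pd j f) x\<bar> < \<epsilon>/2"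
       "d2 > 0" "\<And>y. y \<in> cube A x d2 \<Longrightarrow> \<bar>pd j (pd i f) y - pd j (pd i f) x\<bar> < \<epsilon>/2" "cube A x d1 \<subseteq> U"
      using \<open>\<epsilon> > 0\<close> by (metis half_gt_zero)
    define e where "e = min d1 d2"
    have e: "e > 0" "cube A x e \<subseteq> cube A x d1" "cube A x e \<subseteq> cube A x d2"
      using d by (auto simp: e_def intro!: cube_subset)
    have h: "0 < e/2" "e/2 < e" using e by auto
    obtain p where p: "p \<in> cube A x e" "f (x(i := x i + e/2, j := x j + e/2)) - f (x(i := x i + e/2))
        - f (x(j := x j + e/2)) + f x = e/2 * (e/2) * pd j (pd i f) p"
      using second_difference_mvt[OF A f ij False x _ h] e d(5) by blast
    obtain q where q: "q \<in> cube A x e" "f (x(j := x j + e/2, i := x i + e/2)) - f (x(j := x j + e/2))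
        - f (x(i := x i + e/2)) + f x = e/2 * (e/2) * pd i (pd j f) q"
      using second_difference_mvt[OF A f ij(2,1) False[symmetric] x _ h] e d(5) by blast
    have tw: "x(j := x j + e/2, i := x i + e/2) = x(i := x i + e/2, j := x j + e/2)"
      using False by (simp add: fun_upd_twist)
    have "e/2 * (e/2) * pd j (pd i f) p = e/2 * (e/2) * pd i (pd j f) q"
      using p(2) q(2) unfolding tw by linarith
    then have "pd j (pd i f) p = pd i (pd j f) q" using e(1) by simp
    moreover have "\<bar>pd j (pd i f) p - pd j (pd i f) x\<bar> < \<epsilon>/2" "\<bar>pd i (pd j f) q - pd i (pd j f) x\<bar> < \<epsilon>/2"
      using d(2,4) p(1) q(1) e by blast+
    ultimately show ?thesis by linarith
  qed
  then show ?thesis by (metis abs_le_zero_iff dense_ge eq_iff_diff_eq_0)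
qed simp

subsection \<open>Smooth functions\<close>

lemma C_infD: "C_inf A U f \<Longrightarrow> C_k k A U f"
  by (simp add: C_inf_def)

lemma C_inf_imp_continuous: "C_inf A U f \<Longrightarrow> continuous_on U f"
  by (blast dest: C_infD intro: C_k_imp_continuous)

lemma C_inf_has_pd: "C_inf A U f \<Longrightarrow> x \<in> U \<Longrightarrow> i \<in> A \<Longrightarrow> has_pd i f x (pd i f x)"
  by (rule C_k_imp_has_pd[OF C_infD])

lemma C_inf_pd: "C_inf A U f \<Longrightarrow> i \<in> A \<Longrightarrow> C_inf A U (pd i f)"
  unfolding C_inf_def using C_k_pd by metis

lemma C_inf_cong:
  assumes "finite A" "copen A U" "\<forall>x\<in>U. f x = g x" "C_inf A U f"
  shows "C_inf A U g"
  using C_k_cong[OF assms(1-3)] assms(4) by (simp add: C_inf_def)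

lemma C_inf_subset: "V \<subseteq> U \<Longrightarrow> C_inf A U f \<Longrightarrow> C_inf A V f"
  unfolding C_inf_def using C_k_subset by metis

lemma C_inf_local:
  assumes "copen A U" "\<And>x. x \<in> U \<Longrightarrow> \<exists>V. copen A V \<and> x \<in> V \<and> C_inf A V f"
  shows "C_inf A U f"
  unfolding C_inf_def by (intro allI C_k_local[OF assms(1)]) (use assms(2) C_infD in metis)

lemma C_inf_const: "finite A \<Longrightarrow> copen A U \<Longrightarrow> C_inf A U (\<lambda>_. c)"
  by (simp add: C_inf_def C_k_const)

lemma C_inf_coord: "finite A \<Longrightarrow> copen A U \<Longrightarrow> C_inf A U (\<lambda>x. x j)"
  by (simp add: C_inf_def C_k_coord)

lemma C_inf_add: "finite A \<Longrightarrow> copen A U \<Longrightarrow> C_inf A U f \<Longrightarrow> C_inf A U g \<Longrightarrow> C_inf A U (\<lambda>x. f x + g x)"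
  by (simp add: C_inf_def C_k_add)

lemma C_inf_mult: "finite A \<Longrightarrow> copen A U \<Longrightarrow> C_inf A U f \<Longrightarrow> C_inf A U g \<Longrightarrow> C_inf A U (\<lambda>x. f x * g x)"
  by (simp add: C_inf_def C_k_mult)

lemma C_inf_sum:
  "finite A \<Longrightarrow> copen A U \<Longrightarrow> (\<And>b. b \<in> B \<Longrightarrow> C_inf A U (f b)) \<Longrightarrow> C_inf A U (\<lambda>x. \<Sum>b\<in>B. f b x)"
  by (simp add: C_inf_def C_k_sum)

lemma C_inf_inverse:
  "finite A \<Longrightarrow> copen A U \<Longrightarrow> \<forall>x\<in>U. f x \<noteq> 0 \<Longrightarrow> C_inf A U f \<Longrightarrow> C_inf A U (\<lambda>x. inverse (f x))"
  by (simp add: C_inf_def C_k_inverse)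

lemma C_inf_compose:
  assumes "finite A" "copen A U" "finite B" "copen B V" "\<forall>y\<in>V. g y \<in> U"
    and "C_inf A U f" "\<And>i. i \<in> A \<Longrightarrow> C_inf B V (\<lambda>y. g y i)"
  shows "C_inf B V (\<lambda>y. f (g y))"
  using C_k_compose[OF assms(1-5)] assms(6,7) by (simp add: C_inf_def)

lemma pd_compose:
  assumes "finite A" "copen A U" "finite B" "copen B V" "\<forall>y\<in>V. g y \<in> U"
    and "C_inf A U f" "\<And>i. i \<in> A \<Longrightarrow> C_inf B V (\<lambda>y. g y i)" "j \<in> B" "y \<in> V"
  shows "pd j (\<lambda>y. f (g y)) y = (\<Sum>i\<in>A. pd i f (g y) * pd j (\<lambda>y. g y i) y)"
  by (rule has_pd_imp_pd[OF has_pd_compose[OF assms(1-4) C_infD[OF assms(6)] assms(5,8,9)]])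
    (rule C_inf_has_pd[OF assms(7,9,8)])

subsection \<open>Hadamard's lemma\<close>

definition seg :: "('i \<Rightarrow> real) \<Rightarrow> ('i \<Rightarrow> real) \<Rightarrow> real \<Rightarrow> 'i \<Rightarrow> real" where
  "seg x y t = (\<lambda>j. x j + t * (y j - x j))"

lemma seg_in_cube:
  assumes "x \<in> coord_space A" "y \<in> cube A x e" "t \<in> {0..1}"
  shows "seg x y t \<in> cube A x e"
proof -
  have "\<bar>t * (y j - x j)\<bar> < e" if "j \<in> A" for j
  proof -
    have "\<bar>t * (y j - x j)\<bar> \<le> \<bar>y j - x j\<bar>"
      using assms(3) by (simp add: abs_mult mult_left_le_one_le)
    then show ?thesis using assms(2) that by (auto simp: cube_def)
  qed
  then show ?thesis using assms by (auto simp: cube_def seg_def coord_space_def)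
qed

lemma continuous_on_seg: "continuous_on S (\<lambda>p. seg x (fst p) (snd p))"
proof (rule continuous_on_coordinatewise_then_product)
  fix j
  have "continuous_on S (\<lambda>p. fst p j)"
    by (rule continuous_on_compose2[OF continuous_on_product_coordinates continuous_on_fst])
      (auto intro: continuous_on_id)
  then show "continuous_on S (\<lambda>p. seg x (fst p) (snd p) j)"
    unfolding seg_def by (intro continuous_intros)
qed

lemma continuous_on_seg_integrand:
  assumes "x \<in> coord_space A" "continuous_on (cube A x e) F"
  shows "continuous_on (cube A x e \<times> cbox 0 1) (\<lambda>(y, t). t ^ m * F (seg x y t))"
proof -
  have "continuous_on (cube A x e \<times> cbox 0 1) (\<lambda>p. F (seg x (fst p) (snd p)))"
    by (rule continuous_on_compose2[OF assms(2) continuous_on_seg])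
      (use seg_in_cube[OF assms(1)] in auto)
  then show ?thesis unfolding split_beta by (intro continuous_intros)
qed

lemma continuous_on_fun_upd:
  fixes y :: "'i \<Rightarrow> real"
  shows "continuous_on S (\<lambda>s. y(i := s))"
proof (rule continuous_on_coordinatewise_then_product)
  fix j show "continuous_on S (\<lambda>s. (y(i := s)) j)"
    by (cases "j = i") (auto intro: continuous_on_id)
qed

text \<open>Differentiation under the integral sign raises the weight \<open>t ^ m\<close> by one factor and replaces
  \<open>F\<close> by a partial derivative, so the statement has to cover all weights at once.\<close>

lemma C_k_segment_integral:
  assumes A: "finite A" and x: "x \<in> coord_space A"
  shows "C_k k A (cube A x e) F \<Longrightarrow>
    C_k k A (cube A x e) (\<lambda>y. integral (cbox 0 1) (\<lambda>t. t ^ m * F (seg x y t)))"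
proof (induction k arbitrary: F m)
  case 0
  then show ?case
    using integral_continuous_on_param[OF continuous_on_seg_integrand[OF x]] by simp
next
  case (Suc k)
  let ?Q = "cube A x e"
  have Q: "copen A ?Q" by (rule copen_cube[OF A])
  show ?case
  proof (rule C_k_SucI[OF A Q, where g = "\<lambda>i y. integral (cbox 0 1) (\<lambda>t. t ^ Suc m * pd i F (seg x y t))"])
    show "continuous_on ?Q (\<lambda>y. integral (cbox 0 1) (\<lambda>t. t ^ m * F (seg x y t)))"
      by (rule integral_continuous_on_param[OF continuous_on_seg_integrand[OF x C_k_imp_continuous[OF Suc.prems]]])
    show "C_k k A ?Q (\<lambda>y. integral (cbox 0 1) (\<lambda>t. t ^ Suc m * pd i F (seg x y t)))" if "i \<in> A" for i
      by (rule Suc.IH[OF C_k_pd[OF Suc.prems that]])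
    show "has_pd i (\<lambda>y. integral (cbox 0 1) (\<lambda>t. t ^ m * F (seg x y t))) y
        (integral (cbox 0 1) (\<lambda>t. t ^ Suc m * pd i F (seg x y t)))" if i: "i \<in> A" and y: "y \<in> ?Q" for i y
    proof -
      let ?I = "{x i - e<..<x i + e}"
      have yI: "y(i := s) \<in> ?Q" if "s \<in> ?I" for s
        using y i that by (auto simp: cube_def coord_space_def abs_less_iff)
      have "((\<lambda>s. integral (cbox 0 1) (\<lambda>t. t ^ m * F (seg x (y(i := s)) t))) has_real_derivative
        integral (cbox 0 1) (\<lambda>t. t ^ Suc m * pd i F (seg x (y(i := y i)) t))) (at (y i) within ?I)"
      proof (rule leibniz_rule_field_derivative)
        show "y i \<in> ?I" using y i by (auto simp: cube_def abs_less_iff)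
        show "convex ?I" by simp
        show "((\<lambda>s. t ^ m * F (seg x (y(i := s)) t)) has_real_derivative
            t ^ Suc m * pd i F (seg x (y(i := s)) t)) (at s within ?I)"
          if s: "s \<in> ?I" and t: "t \<in> cbox 0 1" for s t
        proof -
          define z where "z = seg x (y(i := s)) t"
          have z: "z \<in> ?Q" unfolding z_def by (rule seg_in_cube[OF x yI[OF s]]) (use t in auto)
          have eq: "seg x (y(i := u)) t = z(i := x i + t * (u - x i))" for u
            by (auto simp: z_def seg_def)
          have zi: "z i = x i + t * (s - x i)" by (simp add: z_def seg_def)
          have "((\<lambda>u. F (z(i := u))) has_real_derivative pd i F z) (at (x i + t * (s - x i)))"
            using C_k_imp_has_pd[OF Suc.prems z i] by (simp only: zi)
          moreover have "((\<lambda>u. x i + t * (u - x i)) has_real_derivative t) (at s within ?I)"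
            by (auto intro!: derivative_eq_intros)
          ultimately have "((\<lambda>u. F (z(i := x i + t * (u - x i)))) has_real_derivative pd i F z * t) (at s within ?I)"
            by (rule DERIV_chain2)
          then have "((\<lambda>u. t ^ m * F (z(i := x i + t * (u - x i)))) has_real_derivative t ^ m * (pd i F z * t)) (at s within ?I)"
            by (rule DERIV_cmult)
          then show ?thesis unfolding eq[symmetric]
            by (rule DERIV_cong) (simp add: z_def)
        qed
        show "(\<lambda>t. t ^ m * F (seg x (y(i := s)) t)) integrable_on cbox 0 1" if s: "s \<in> ?I" for s
        proof (rule integrable_continuous)
          have "continuous_on (cbox 0 1) (\<lambda>t. (case (y(i := s), t) of (y, t) \<Rightarrow> t ^ m * F (seg x y t)))"
            by (rule continuous_on_compose2[OF continuous_on_seg_integrand[OF x C_k_imp_continuous[OF Suc.prems]]])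
              (use yI[OF s] in \<open>auto intro!: continuous_intros\<close>)
          then show "continuous_on (cbox 0 1) (\<lambda>t. t ^ m * F (seg x (y(i := s)) t))" by simp
        qed
        have "continuous_on (?I \<times> cbox 0 1)
            (\<lambda>p. (case (y(i := fst p), snd p) of (y, t) \<Rightarrow> t ^ Suc m * pd i F (seg x y t)))"
        proof (rule continuous_on_compose2[OF continuous_on_seg_integrand[OF x C_k_imp_continuous[OF C_k_pd[OF Suc.prems i]]]])
          show "continuous_on (?I \<times> cbox 0 1) (\<lambda>p. (y(i := fst p), snd p))"
            by (intro continuous_on_Pair continuous_on_snd continuous_on_id
                continuous_on_compose2[OF continuous_on_fun_upd[of UNIV y i] continuous_on_fst]) auto
        qed (use yI in auto)
        then show "continuous_on (?I \<times> cbox 0 1) (\<lambda>(s, t). t ^ Suc m * pd i F (seg x (y(i := s)) t))"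
          by (simp add: split_beta)
      qed
      moreover have "at (y i) within ?I = at (y i)"
        by (rule at_within_open) (use y i in \<open>auto simp: cube_def abs_less_iff\<close>)
      ultimately show ?thesis by simp
    qed
  qed
qed

text \<open>Integrating the derivative of \<open>f\<close> along the segment from \<open>x\<close> to \<open>y\<close> splits off the factors
  \<open>y i - x i\<close>. For smooth \<open>f\<close> the cofactors are again smooth, which is why derivations of germs of
  smooth functions are determined by their values on coordinates.\<close>

lemma hadamard:
  assumes A: "finite A" "copen A U" and f: "C_inf A U f" and x: "x \<in> U"
  obtains e q where "e > 0" "cube A x e \<subseteq> U" "\<And>i. i \<in> A \<Longrightarrow> C_inf A (cube A x e) (q i)"
    "\<And>i. i \<in> A \<Longrightarrow> q i x = pd i f x"
    "\<And>y. y \<in> cube A x e \<Longrightarrow> f y = f x + (\<Sum>i\<in>A. (y i - x i) * q i y)"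
proof -
  obtain e where e: "e > 0" "cube A x e \<subseteq> U" using copen_contains_cube[OF A x] .
  have xc: "x \<in> coord_space A" by (rule copen_imp_coord_space[OF A(2) x])
  define q where "q i y = integral (cbox 0 1) (\<lambda>t. t ^ 0 * pd i f (seg x y t))" for i y
  have fe: "C_inf A (cube A x e) f" by (rule C_inf_subset[OF e(2) f])
  have "C_inf A (cube A x e) (q i)" if "i \<in> A" for i
    unfolding C_inf_def q_def
    by (intro allI C_k_segment_integral[OF A(1) xc] C_infD[OF C_inf_pd[OF fe that]])
  moreover have "q i x = pd i f x" for i
    by (simp add: q_def seg_def)
  moreover have "f y = f x + (\<Sum>i\<in>A. (y i - x i) * q i y)" if y: "y \<in> cube A x e" for y
  proof -
    have d: "((\<lambda>t. f (seg x y t)) has_real_derivative (\<Sum>i\<in>A. pd i f (seg x y t) * (y i - x i))) (at t)"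
      if "t \<in> {0..1}" for t
    proof (rule chain_rule[OF A C_infD[OF f]])
      show "seg x y t \<in> U" using seg_in_cube[OF xc y that] e(2) by blast
      show "\<forall>\<^sub>F t in at t. seg x y t \<in> coord_space A"
        using xc y by (auto simp: seg_def coord_space_def cube_def)
      show "((\<lambda>t. seg x y t i) has_real_derivative y i - x i) (at t)" for i
        unfolding seg_def by (auto intro!: derivative_eq_intros)
    qed
    have "((\<lambda>t. \<Sum>i\<in>A. pd i f (seg x y t) * (y i - x i)) has_integral f (seg x y 1) - f (seg x y 0)) {0..1}"
      by (rule fundamental_theorem_of_calculus)
        (auto simp flip: has_real_derivative_iff_has_vector_derivative intro: has_field_derivative_at_within[OF d])
    then have "integral (cbox 0 1) (\<lambda>t. \<Sum>i\<in>A. pd i f (seg x y t) * (y i - x i)) = f y - f x"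
      by (simp add: integral_unique seg_def)
    moreover have "integral (cbox 0 1) (\<lambda>t. \<Sum>i\<in>A. pd i f (seg x y t) * (y i - x i))
      = (\<Sum>i\<in>A. (y i - x i) * q i y)"
    proof (subst integral_sum[OF A(1)])
      fix i assume i: "i \<in> A"
      have "continuous_on (cbox 0 1) (\<lambda>t. pd i f (seg x y t))"
      proof (rule continuous_on_compose2[OF C_inf_imp_continuous[OF C_inf_pd[OF fe i]]])
        show "continuous_on (cbox 0 1) (seg x y)"
          by (rule continuous_on_coordinatewise_then_product)
            (auto simp: seg_def intro!: continuous_intros)
      qed (use seg_in_cube[OF xc y] in auto)
      then show "(\<lambda>t. pd i f (seg x y t) * (y i - x i)) integrable_on cbox 0 1"
        by (intro integrable_continuous continuous_on_mult continuous_on_const)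
    qed (simp add: q_def mult.commute)
    ultimately show ?thesis by linarith
  qed
  ultimately show ?thesis using that e by blast
qed

subsection \<open>Replacing one coordinate by a function\<close>

text \<open>The one-dimensional inverse function theorem with parameters: if \<open>\<partial>G/\<partial>y\<^sub>a\<close> does not vanish at
  \<open>y0\<close>, then \<open>G\<close> can replace the coordinate \<open>y\<^sub>a\<close>. On a small cube \<open>G\<close> is strictly monotone in
  \<open>y\<^sub>a\<close>, which gives injectivity; the intermediate value theorem gives openness of the map and
  continuity of the inverse. Hadamard's lemma expresses the increments of \<open>G\<close> with continuous
  cofactors, so the inverse \<open>h\<close> has the partial derivatives predicted by implicit differentiation;
  these are smooth functions of \<open>z(a := h z)\<close>, and smoothness of \<open>h\<close> follows by induction.\<close>

lemma replace_coordinate: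
  assumes A: "finite A" "copen A U" and G: "C_inf A U G" and a: "a \<in> A"
    and y0: "y0 \<in> U" and nz: "pd a G y0 \<noteq> 0"
  obtains X h where "copen A X" "y0 \<in> X" "X \<subseteq> U" "\<And>y. y \<in> X \<Longrightarrow> h (y(a := G y)) = y a"
    "\<And>W. copen A W \<Longrightarrow> W \<subseteq> X \<Longrightarrow> copen A ((\<lambda>y. y(a := G y)) ` W)"
    "C_inf A ((\<lambda>y. y(a := G y)) ` X) h"
proof -
  define \<Phi> where "\<Phi> y = y(a := G y)" for y
  have "\<bar>pd a G y0\<bar> > 0" using nz by simp
  from continuous_on_cubeD[OF A C_inf_imp_continuous[OF C_inf_pd[OF G a]] y0 this]
  obtain e where e: "e > 0" "cube A y0 e \<subseteq> U" "\<And>y. y \<in> cube A y0 e \<Longrightarrow> \<bar>pd a G y - pd a G y0\<bar> < \<bar>pd a G y0\<bar>"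
    by blast
  define X where "X = cube A y0 e"
  \<comment> \<open>The sign of the derivative on the cube; multiplying by it makes \<open>G\<close> increasing in the coordinate \<open>a\<close>.\<close>
  define s where "s = sgn (pd a G y0)"
  have X: "copen A X" unfolding X_def by (rule copen_cube[OF A(1)])
  have y0X: "y0 \<in> X" unfolding X_def by (rule centre_in_cube[OF copen_imp_coord_space[OF A(2) y0] e(1)])
  have XU: "X \<subseteq> U" using e X_def by simp
  have Xc: "y \<in> coord_space A" if "y \<in> X" for y by (rule copen_imp_coord_space[OF X that])
  have pos: "s * pd a G y > 0" if "y \<in> X" for y
    using e(3)[of y] that by (auto simp: X_def s_def sgn_if split: if_splits)
  have ss: "s * s = 1" using nz by (auto simp: s_def sgn_if)
  have line: "y(a := t) \<in> X" if "y \<in> X" "y(a := u) \<in> X" "t \<in> closed_segment (y a) u" for y t u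
  proof -
    have "\<bar>t - y0 a\<bar> < e"
      using that a by (auto simp: X_def cube_def closed_segment_eq_real_ivl split: if_splits)
    then show ?thesis using that a by (auto simp: X_def cube_def coord_space_def)
  qed
  have mvt: "\<exists>t\<in>closed_segment (y a) u. y(a := t) \<in> X \<and> G (y(a := u)) - G y = pd a G (y(a := t)) * (u - y a)"
    if "y \<in> X" "y(a := u) \<in> X" for y u
  proof -
    have "((\<lambda>t. G (y(a := t))) has_real_derivative pd a G (y(a := t))) (at t)" if "t \<in> closed_segment (y a) u" for t
      using C_inf_has_pd[OF G _ a, of "y(a := t)"] line[OF \<open>y \<in> X\<close> \<open>y(a := u) \<in> X\<close> that] XU by auto
    from mvt_segment[of "y a" u "\<lambda>t. G (y(a := t))" "\<lambda>t. pd a G (y(a := t))", OF this] line[OF that]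
    show ?thesis by (simp only: fun_upd_triv) blast
  qed
  have uniq: "u = y a" if asm: "y \<in> X" "y(a := u) \<in> X" "G (y(a := u)) = G y" for y u
  proof -
    obtain t where "y(a := t) \<in> X" "G (y(a := u)) - G y = pd a G (y(a := t)) * (u - y a)"
      using mvt[OF asm(1,2)] by blast
    then show ?thesis using asm(3) pos[of "y(a := t)"] by auto
  qed
  define h where "h z = (THE t. z(a := t) \<in> X \<and> G (z(a := t)) = z a)" for z
  have h: "h z = t" if "z(a := t) \<in> X" "G (z(a := t)) = z a" for z t
    unfolding h_def
  proof (rule the_equality)
    fix u assume "z(a := u) \<in> X \<and> G (z(a := u)) = z a"
    then show "u = t" using uniq[OF that(1), of u] that(2) by simp
  qed (use that in simp)
  have h\<Phi>: "h (\<Phi> y) = y a" if "y \<in> X" for y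
    by (rule h) (use that in \<open>simp_all add: \<Phi>_def\<close>)
  \<comment> \<open>Values at \<open>y a - d\<close> and \<open>y a + d\<close> lie strictly on both sides of \<open>G y\<close>; this persists near \<open>\<Phi> y\<close>, and
    an intermediate value is taken in between.\<close>
  have surj: "\<exists>\<rho>>0. \<forall>z\<in>cube A (\<Phi> y) \<rho>. \<exists>t. \<bar>t - y a\<bar> < \<delta> \<and> z(a := t) \<in> X \<and> G (z(a := t)) = z a"
    if y: "y \<in> X" and \<delta>: "\<delta> > 0" for y \<delta>
  proof -
    obtain d0 where d0: "d0 > 0" "cube A y d0 \<subseteq> X" using copen_contains_cube[OF A(1) X y] .
    define d where "d = min \<delta> d0 / 2"
    have d: "0 < d" "d < \<delta>" "d < d0" using \<delta> d0 by (auto simp: d_def min_def)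
    have b: "y(a := y a + u) \<in> X" if "\<bar>u\<bar> \<le> d" for u
    proof -
      have "y(a := y a + u) \<in> cube A y d0" using that d Xc[OF y] a by (auto simp: cube_def coord_space_def)
      then show ?thesis using d0 by blast
    qed
    have Gb: "\<exists>p\<in>X. s * (G (y(a := y a + u)) - G y) = s * pd a G p * u" if "\<bar>u\<bar> \<le> d" for u
      using mvt[OF y b[OF that]] by (auto simp: mult.assoc)
    have up: "s * (G (y(a := y a + d)) - G y) > 0"
    proof -
      obtain p where p: "p \<in> X" "s * (G (y(a := y a + d)) - G y) = s * pd a G p * d"
        using Gb[of d] d(1) by (simp only: abs_of_pos order.refl) blast
      show ?thesis unfolding p(2) by (rule mult_pos_pos[OF pos[OF p(1)] d(1)])
    qed
    have dn: "s * (G (y(a := y a + (-d))) - G y) < 0"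
    proof -
      obtain p where p: "p \<in> X" "s * (G (y(a := y a + (-d))) - G y) = s * pd a G p * (-d)"
        using Gb[of "-d"] d(1) by (simp only: abs_minus_cancel abs_of_pos order.refl) blast
      show ?thesis unfolding p(2) by (rule mult_pos_neg[OF pos[OF p(1)]]) (use d(1) in simp)
    qed
    have near: "\<exists>\<rho>>0. \<forall>z\<in>cube A (\<Phi> y) \<rho>. \<bar>(G (z(a := y a + u)) - z a) - (G (y(a := y a + u)) - G y)\<bar> < \<epsilon>"
      if u: "\<bar>u\<bar> \<le> d" and \<epsilon>: "\<epsilon> > 0" for u \<epsilon>
    proof -
      have "y(a := y a + u) \<in> U" using b[OF u] XU by blast
      moreover have "\<epsilon>/2 > 0" using \<epsilon> by simp
      ultimately obtain r where r: "r > 0" "\<And>w. w \<in> cube A (y(a := y a + u)) r \<Longrightarrow> \<bar>G w - G (y(a := y a + u))\<bar> < \<epsilon>/2"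
        using continuous_on_cubeD[OF A C_inf_imp_continuous[OF G]] by metis
      have "\<bar>(G (z(a := y a + u)) - z a) - (G (y(a := y a + u)) - G y)\<bar> < \<epsilon>"
        if z: "z \<in> cube A (\<Phi> y) (min r (\<epsilon>/2))" for z
      proof -
        have "z(a := y a + u) \<in> cube A (y(a := y a + u)) r"
          using z r(1) a by (auto simp: cube_def \<Phi>_def coord_space_def)
        moreover have "\<bar>z a - G y\<bar> < \<epsilon>/2" using z a by (auto simp: cube_def \<Phi>_def)
        ultimately show ?thesis using r(2)[of "z(a := y a + u)"] by linarith
      qed
      then show ?thesis using r(1) \<epsilon> by (intro exI[of _ "min r (\<epsilon>/2)"]) auto
    qed
    have sabs: "\<bar>s * v\<bar> = \<bar>v\<bar>" for v using nz by (simp add: s_def abs_mult abs_sgn_eq)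
    obtain \<rho>1 where \<rho>1: "\<rho>1 > 0" "\<And>z. z \<in> cube A (\<Phi> y) \<rho>1 \<Longrightarrow> \<bar>(G (z(a := y a + d)) - z a) - (G (y(a := y a + d)) - G y)\<bar>
        < s * (G (y(a := y a + d)) - G y)"
      using near[of d, OF _ up] d by auto
    obtain \<rho>2 where \<rho>2: "\<rho>2 > 0" "\<And>z. z \<in> cube A (\<Phi> y) \<rho>2 \<Longrightarrow> \<bar>(G (z(a := y a + (-d))) - z a) - (G (y(a := y a + (-d))) - G y)\<bar>
        < - (s * (G (y(a := y a + (-d))) - G y))"
      using near[of "-d" "- (s * (G (y(a := y a + (-d))) - G y))"] d dn by auto
    define \<rho> where "\<rho> = min (min \<rho>1 \<rho>2) d"
    have "\<exists>t. \<bar>t - y a\<bar> < \<delta> \<and> z(a := t) \<in> X \<and> G (z(a := t)) = z a" if z: "z \<in> cube A (\<Phi> y) \<rho>" for z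
    proof -
      have z12: "z \<in> cube A (\<Phi> y) \<rho>1" "z \<in> cube A (\<Phi> y) \<rho>2"
      proof -
        have "\<rho> \<le> \<rho>1" "\<rho> \<le> \<rho>2" by (simp_all add: \<rho>_def)
        then show "z \<in> cube A (\<Phi> y) \<rho>1" "z \<in> cube A (\<Phi> y) \<rho>2" using z cube_subset by blast+
      qed
      have inX: "z(a := t) \<in> X" if "\<bar>t - y a\<bar> \<le> d" for t
      proof -
        have "z(a := t) \<in> cube A y d0"
          using z that d a by (auto simp: cube_def \<Phi>_def \<rho>_def coord_space_def split: if_splits)
        then show ?thesis using d0 by blast
      qed
      define k where "k t = s * (G (z(a := t)) - z a)" for t
      have k1: "0 \<le> k (y a + d)"
        using \<rho>1(2)[OF z12(1)] sabs[of "(G (z(a := y a + d)) - z a) - (G (y(a := y a + d)) - G y)"]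
        by (simp add: k_def right_diff_distrib abs_if split: if_splits)
      have k2: "k (y a + (-d)) \<le> 0"
        using \<rho>2(2)[OF z12(2)] sabs[of "(G (z(a := y a + (-d))) - z a) - (G (y(a := y a + (-d))) - G y)"]
        by (simp add: k_def right_diff_distrib abs_if split: if_splits)
      have "continuous_on {y a + (-d)..y a + d} k"
      proof (rule continuous_at_imp_continuous_on, rule ballI)
        fix t assume t: "t \<in> {y a + (-d)..y a + d}"
        have "\<bar>t - y a\<bar> \<le> d" using t by (auto simp: abs_le_iff)
        then have "z(a := t) \<in> U" using inX XU by blast
        from C_inf_has_pd[OF G this a] have "((\<lambda>t. G (z(a := t))) has_real_derivative pd a G (z(a := t))) (at t)" by simp
        from DERIV_isCont[OF this] show "isCont k t" unfolding k_def by (intro continuous_intros)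
      qed
      from IVT'[of k, OF k2 k1 _ this] d obtain t where t: "y a + (-d) \<le> t" "t \<le> y a + d" "k t = 0" by auto
      have "s \<noteq> 0" using ss by auto
      then have "G (z(a := t)) = z a" using t(3) by (simp add: k_def)
      moreover have "\<bar>t - y a\<bar> \<le> d" using t by (auto simp: abs_le_iff)
      ultimately show ?thesis using inX[of t] d by (intro exI[of _ t]) auto
    qed
    moreover have "\<rho> > 0" using \<rho>1 \<rho>2 d by (simp add: \<rho>_def)
    ultimately show ?thesis by blast
  qed
  have openmap: "copen A (\<Phi> ` W)" if W: "copen A W" "W \<subseteq> X" for W
  proof (rule copenI[OF A(1)])
    show "\<Phi> ` W \<subseteq> coord_space A" using W Xc a by (auto simp: \<Phi>_def intro!: fun_upd_in_coord_space)
    fix z assume "z \<in> \<Phi> ` W"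
    then obtain y where y: "y \<in> W" "z = \<Phi> y" by blast
    obtain d where d: "d > 0" "cube A y d \<subseteq> W" using copen_contains_cube[OF A(1) W(1) y(1)] .
    have "y \<in> X" using y W by blast
    from surj[OF this d(1)] obtain \<rho> where \<rho>: "\<rho> > 0" "\<And>z. z \<in> cube A (\<Phi> y) \<rho> \<Longrightarrow>
      \<exists>t. \<bar>t - y a\<bar> < d \<and> z(a := t) \<in> X \<and> G (z(a := t)) = z a" by blast
    have "cube A z (min \<rho> d) \<subseteq> \<Phi> ` W"
    proof
      fix w assume w: "w \<in> cube A z (min \<rho> d)"
      then have "w \<in> cube A (\<Phi> y) \<rho>" using cube_subset[of "min \<rho> d" \<rho>] y(2) by auto
      from \<rho>(2)[OF this] obtain t where t: "\<bar>t - y a\<bar> < d" "w(a := t) \<in> X" "G (w(a := t)) = w a" by blast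
      have "w(a := t) \<in> cube A y d"
        using w t(1) a y(2) by (auto simp: cube_def \<Phi>_def coord_space_def split: if_splits)
      moreover have "\<Phi> (w(a := t)) = w" using t(3) by (auto simp: \<Phi>_def)
      ultimately show "w \<in> \<Phi> ` W" using d(2) by (metis image_eqI subsetD)
    qed
    then show "\<exists>e>0. cube A z e \<subseteq> \<Phi> ` W" using \<rho>(1) d(1) by (intro exI[of _ "min \<rho> d"]) auto
  qed
  define V where "V = \<Phi> ` X"
  have V: "copen A V" unfolding V_def by (rule openmap[OF X]) simp
  have inv: "z(a := h z) \<in> X \<and> G (z(a := h z)) = z a" if "z \<in> V" for z
  proof -
    obtain y where "y \<in> X" "z = \<Phi> y" using \<open>z \<in> V\<close> by (auto simp: V_def)
    then show ?thesis using h\<Phi>[of y] by (simp add: \<Phi>_def)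
  qed
  have hcont: "continuous_on V h"
  proof (rule continuous_on_cubeI[OF A(1)])
    show "V \<subseteq> coord_space A" using V by (rule openin_imp_subset)
    fix z and \<epsilon> :: real assume "z \<in> V" "\<epsilon> > 0"
    then obtain y where y: "y \<in> X" "z = \<Phi> y" by (auto simp: V_def)
    from surj[OF y(1) \<open>\<epsilon> > 0\<close>] obtain \<rho> where \<rho>: "\<rho> > 0" "\<And>z. z \<in> cube A (\<Phi> y) \<rho> \<Longrightarrow>
      \<exists>t. \<bar>t - y a\<bar> < \<epsilon> \<and> z(a := t) \<in> X \<and> G (z(a := t)) = z a" by blast
    have "\<bar>h w - h z\<bar> < \<epsilon>" if "w \<in> cube A z \<rho>" for w
      using \<rho>(2)[of w] h[of w] h\<Phi>[OF y(1)] that y(2) by auto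
    then show "\<exists>\<delta>>0. \<forall>y\<in>V \<inter> cube A z \<delta>. \<bar>h y - h z\<bar> < \<epsilon>" using \<rho>(1) by blast
  qed
  \<comment> \<open>The partial derivatives of \<open>h\<close>, by implicit differentiation of \<open>G (z(a := h z)) = z a\<close>.\<close>
  define D where "D j y = (if j = a then 1 else (-1) * pd j G y) * inverse (pd a G y)" for j y
  have hpd: "has_pd j h z (D j (z(a := h z)))" if j: "j \<in> A" and z: "z \<in> V" for j z
  proof -
    define y where "y = z(a := h z)"
    have y: "y \<in> X" "G y = z a" using inv[OF z] by (auto simp: y_def)
    obtain e q where q: "e > 0" "cube A y e \<subseteq> X" "\<And>i. i \<in> A \<Longrightarrow> C_inf A (cube A y e) (q i)"
      "\<And>i. i \<in> A \<Longrightarrow> q i y = pd i G y"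
      "\<And>w. w \<in> cube A y e \<Longrightarrow> G w = G y + (\<Sum>i\<in>A. (w i - y i) * q i w)"
      using hadamard[OF A(1) X C_inf_subset[OF XU G] y(1)] by blast
    define H where "H t = h (z(j := t))" for t
    define Y where "Y t = (z(j := t))(a := H t)" for t
    have evV: "\<forall>\<^sub>F t in at (z j). z(j := t) \<in> V"
      using eventually_fun_upd_in[OF A(1) V z j] by (simp add: eventually_nhds_conv_at)
    have zt: "\<forall>\<^sub>F t in at (z j). z(j := t) \<in> cube A z r" if "r > 0" for r
      using eventually_fun_upd_in[OF A(1) copen_cube[OF A(1)] centre_in_cube[OF copen_imp_coord_space[OF V z] that] j]
      by (simp add: eventually_nhds_conv_at)
    have Hlim: "(H \<longlongrightarrow> h z) (at (z j))"
      unfolding H_def by (rule tendsto_along_cubes[OF A(1) V hcont z zt])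
    have Ylim: "((\<lambda>t. Y t i) \<longlongrightarrow> y i) (at (z j))" for i
    proof (cases "i = a")
      case True
      then show ?thesis using Hlim by (simp add: Y_def y_def)
    next
      case False
      then show ?thesis by (cases "i = j") (auto simp: Y_def y_def)
    qed
    have Yc: "\<forall>\<^sub>F t in at (z j). Y t \<in> coord_space A"
      using copen_imp_coord_space[OF V z] a j by (auto simp: Y_def coord_space_def)
    have evY: "\<forall>\<^sub>F t in at (z j). Y t \<in> cube A y r" if "r > 0" for r
      by (rule eventually_in_cube[OF A(1) Ylim Yc that])
    have qlim: "((\<lambda>t. q i (Y t)) \<longlongrightarrow> pd i G y) (at (z j))" if "i \<in> A" for i
      using tendsto_along_cubes[OF A(1) copen_cube[OF A(1)] C_inf_imp_continuous[OF q(3)[OF that]]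
          centre_in_cube[OF Xc[OF y(1)] q(1)] evY] q(4)[OF that] by simp
    have nza: "pd a G y \<noteq> 0" using pos[OF y(1)] by auto
    have "((\<lambda>t. (if j = a then 1 else (-1) * q j (Y t)) * inverse (q a (Y t))) \<longlongrightarrow> D j y) (at (z j))"
      unfolding D_def using qlim[OF j] qlim[OF a] nza
      by (cases "j = a") (auto intro!: tendsto_intros)
    moreover have "\<forall>\<^sub>F t in at (z j). (if j = a then 1 else (-1) * q j (Y t)) * inverse (q a (Y t))
        = (H t - H (z j)) / (t - z j)"
      using evV evY[OF q(1)] tendsto_imp_eventually_ne[OF qlim[OF a] nza] eventually_neq_at_within[of "z j" "z j" UNIV]
    proof eventually_elim
      case (elim t)
      have "G (Y t) = (z(j := t)) a" using inv[OF elim(1)] by (simp add: Y_def H_def)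
      then have eq: "(z(j := t)) a - z a = (\<Sum>i\<in>A. (Y t i - y i) * q i (Y t))"
        using q(5)[OF elim(2)] y(2) by simp
      have ya: "y a = H (z j)" by (simp add: y_def H_def)
      show ?case
      proof (cases "j = a")
        case True
        have "(\<Sum>i\<in>A. (Y t i - y i) * q i (Y t)) = (\<Sum>i\<in>{a}. (Y t i - y i) * q i (Y t))"
          using a A(1) True by (intro sum.mono_neutral_right) (auto simp: Y_def y_def)
        then have "t - z j = (H t - H (z j)) * q a (Y t)" using eq True ya by (simp add: Y_def)
        then show ?thesis using True elim(3,4) by (auto simp: field_simps)
      next
        case False
        have "(\<Sum>i\<in>A. (Y t i - y i) * q i (Y t)) = (\<Sum>i\<in>{a, j}. (Y t i - y i) * q i (Y t))"
          using a j A(1) by (intro sum.mono_neutral_right) (auto simp: Y_def y_def)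
        then have "0 = (H t - H (z j)) * q a (Y t) + (t - z j) * q j (Y t)"
          using eq False ya by (simp add: Y_def y_def)
        then show ?thesis using False elim(3,4) by (auto simp: field_simps)
      qed
    qed
    ultimately have "((\<lambda>t. (H t - H (z j)) / (t - z j)) \<longlongrightarrow> D j y) (at (z j))"
      by (rule Lim_transform_eventually)
    then show ?thesis by (simp add: has_field_derivative_iff H_def y_def)
  qed
  have "C_k k A V h" for k
  proof (induction k)
    case 0
    then show ?case using hcont by simp
  next
    case (Suc k)
    show ?case
    proof (rule C_k_SucI[OF A(1) V hcont hpd])
      fix j assume j: "j \<in> A"
      have GX: "C_inf A X (pd i G)" if "i \<in> A" for i by (rule C_inf_subset[OF XU C_inf_pd[OF G that]])
      have "C_inf A X (\<lambda>y. if j = a then 1 else (-1) * pd j G y)"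
      proof (cases "j = a")
        case False
        have "C_inf A X (\<lambda>y. (-1) * pd j G y)"
          by (rule C_inf_mult[OF A(1) X C_inf_const[OF A(1) X] GX[OF j]])
        with False show ?thesis by simp
      qed (simp add: C_inf_const[OF A(1) X])
      moreover have "C_inf A X (\<lambda>y. inverse (pd a G y))"
        by (rule C_inf_inverse[OF A(1) X _ GX[OF a]]) (use pos in force)
      ultimately have "C_inf A X (D j)"
        unfolding D_def by (rule C_inf_mult[OF A(1) X])
      then have "C_k k A X (D j)" by (rule C_infD)
      then show "C_k k A V (\<lambda>z. D j (z(a := h z)))"
      proof (rule C_k_compose[OF A(1) X A(1) V, rotated])
        fix i show "C_k k A V (\<lambda>z. (z(a := h z)) i)"
          using Suc C_k_coord[OF A(1) V] by (cases "i = a") auto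
      qed (use inv in auto)
    qed
  qed
  then have "C_inf A V h" by (simp add: C_inf_def)
  then show ?thesis using that[of X h] X y0X XU h\<Phi> openmap by (simp add: V_def \<Phi>_def)
qed

section \<open>Coordinate systems and tangent vectors\<close>

text \<open>A chart of the maximal atlas up to relabelling, described by what it does to open sets and to smooth functions. The
  labels \<open>B\<close> need not be those of the atlas of \<open>M\<close>: a submanifold of the jet bundle comes with
  labels of its own, but will be parametrised by base coordinates.\<close>

definition coords_on :: "('a, 'i) mfd \<Rightarrow> 'a set \<Rightarrow> ('a \<Rightarrow> 'b \<Rightarrow> real) \<Rightarrow> 'b set \<Rightarrow> bool" where
  "coords_on M W \<kappa> B \<longleftrightarrow> finite B \<and> openin (mtop M) W \<and> inj_on \<kappa> W \<and>
     (\<forall>W'. openin (mtop M) W' \<longrightarrow> W' \<subseteq> W \<longrightarrow> copen B (\<kappa> ` W')) \<and>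
     (\<forall>V. copen B V \<longrightarrow> openin (mtop M) {p \<in> W. \<kappa> p \<in> V}) \<and>
     (\<forall>b\<in>B. smooth_fun M W (\<lambda>p. \<kappa> p b)) \<and>
     (\<forall>W' f. openin (mtop M) W' \<longrightarrow> W' \<subseteq> W \<longrightarrow> smooth_fun M W' f \<longrightarrow>
        C_inf B (\<kappa> ` W') (f \<circ> inv_into W \<kappa>))"

text \<open>The part of the definition of a smooth manifold that concerns charts. The arguments below
  are local and apply to the jet bundle as soon as its adapted charts are known to satisfy this.\<close>

definition charted_mfd :: "('a, 'i) mfd \<Rightarrow> bool" where
  "charted_mfd M \<longleftrightarrow> (\<forall>(U, \<phi>)\<in>atlas M. coords_on M U \<phi> (idx M)) \<and> (\<Union>c\<in>atlas M. fst c) = carr M"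

lemma coords_onD:
  assumes "coords_on M W \<kappa> B"
  shows "finite B" "openin (mtop M) W" "inj_on \<kappa> W"
    "\<And>W'. openin (mtop M) W' \<Longrightarrow> W' \<subseteq> W \<Longrightarrow> copen B (\<kappa> ` W')"
    "\<And>V. copen B V \<Longrightarrow> openin (mtop M) {p \<in> W. \<kappa> p \<in> V}"
    "\<And>b. b \<in> B \<Longrightarrow> smooth_fun M W (\<lambda>p. \<kappa> p b)"
    "\<And>W' f. openin (mtop M) W' \<Longrightarrow> W' \<subseteq> W \<Longrightarrow> smooth_fun M W' f \<Longrightarrow> C_inf B (\<kappa> ` W') (f \<circ> inv_into W \<kappa>)"
  using assms unfolding coords_on_def by blast+

lemma coords_on_in_coord_space: "coords_on M W \<kappa> B \<Longrightarrow> p \<in> W \<Longrightarrow> \<kappa> p \<in> coord_space B"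
  using coords_onD(2,4)[of M W \<kappa> B] copen_imp_coord_space by blast

lemma charted_mfd_atlas: "charted_mfd M \<Longrightarrow> (U, \<phi>) \<in> atlas M \<Longrightarrow> coords_on M U \<phi> (idx M)"
  unfolding charted_mfd_def by blast

lemma charted_mfd_cover:
  assumes "charted_mfd M" "p \<in> carr M"
  obtains U \<phi> where "(U, \<phi>) \<in> atlas M" "p \<in> U" "coords_on M U \<phi> (idx M)"
proof -
  obtain c where "c \<in> atlas M" "p \<in> fst c" using assms unfolding charted_mfd_def by blast
  then show ?thesis using that[of "fst c" "snd c"] charted_mfd_atlas[OF assms(1)] by simp
qed

subsection \<open>Smooth functions\<close>

lemma smooth_funI:
  assumes "\<And>U \<phi>. (U, \<phi>) \<in> atlas M \<Longrightarrow> C_inf (idx M) (\<phi> ` (U \<inter> W)) (\<lambda>y. f (inv_into U \<phi> y))"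
  shows "smooth_fun M W f"
  using assms unfolding smooth_fun_def o_def by blast

lemma smooth_funD:
  assumes "smooth_fun M W f" "(U, \<phi>) \<in> atlas M"
  shows "C_inf (idx M) (\<phi> ` (U \<inter> W)) (\<lambda>y. f (inv_into U \<phi> y))"
  using assms unfolding smooth_fun_def o_def by blast

lemma smooth_fun_subset: "smooth_fun M W f \<Longrightarrow> W' \<subseteq> W \<Longrightarrow> smooth_fun M W' f"
  by (rule smooth_funI, rule C_inf_subset[OF _ smooth_funD]) auto

lemma atlas_image_copen:
  "charted_mfd M \<Longrightarrow> (U, \<phi>) \<in> atlas M \<Longrightarrow> openin (mtop M) W \<Longrightarrow> copen (idx M) (\<phi> ` (U \<inter> W))"
  using charted_mfd_atlas coords_onD(2,4)[of M U \<phi> "idx M"] by blast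

lemma smooth_fun_compose:
  assumes M: "charted_mfd M" and W: "openin (mtop M) W" and B: "finite B" "copen B X"
    and h: "C_inf B X h" and F: "\<And>b. b \<in> B \<Longrightarrow> smooth_fun M W (\<lambda>q. F q b)" "\<And>q. q \<in> W \<Longrightarrow> F q \<in> X"
  shows "smooth_fun M W (\<lambda>q. h (F q))"
proof (rule smooth_funI)
  fix U \<phi> assume U: "(U, \<phi>) \<in> atlas M"
  have c: "coords_on M U \<phi> (idx M)" by (rule charted_mfd_atlas[OF M U])
  show "C_inf (idx M) (\<phi> ` (U \<inter> W)) (\<lambda>y. h (F (inv_into U \<phi> y)))"
  proof (rule C_inf_compose[OF B coords_onD(1)[OF c] atlas_image_copen[OF M U W] _ h])
    show "\<forall>y\<in>\<phi> ` (U \<inter> W). F (inv_into U \<phi> y) \<in> X"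
      using F(2) inv_into_f_f[OF coords_onD(3)[OF c]] by auto
  qed (use smooth_funD[OF F(1) U] in auto)
qed

lemma smooth_fun_cong:
  assumes M: "charted_mfd M" and W: "openin (mtop M) W" and f: "smooth_fun M W f" "\<forall>q\<in>W. f q = g q"
  shows "smooth_fun M W g"
proof (rule smooth_funI)
  fix U \<phi> assume U: "(U, \<phi>) \<in> atlas M"
  have c: "coords_on M U \<phi> (idx M)" by (rule charted_mfd_atlas[OF M U])
  show "C_inf (idx M) (\<phi> ` (U \<inter> W)) (\<lambda>y. g (inv_into U \<phi> y))"
    by (rule C_inf_cong[OF coords_onD(1)[OF c] atlas_image_copen[OF M U W] _ smooth_funD[OF f(1) U]])
      (use f(2) inv_into_f_f[OF coords_onD(3)[OF c]] in auto)
qed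

lemma smooth_fun_local:
  assumes M: "charted_mfd M" and W: "openin (mtop M) W"
    and l: "\<And>p. p \<in> W \<Longrightarrow> \<exists>W'. openin (mtop M) W' \<and> p \<in> W' \<and> smooth_fun M W' f"
  shows "smooth_fun M W f"
proof (rule smooth_funI)
  fix U \<phi> assume U: "(U, \<phi>) \<in> atlas M"
  show "C_inf (idx M) (\<phi> ` (U \<inter> W)) (\<lambda>y. f (inv_into U \<phi> y))"
  proof (rule C_inf_local[OF atlas_image_copen[OF M U W]])
    fix y assume "y \<in> \<phi> ` (U \<inter> W)"
    then obtain p where p: "p \<in> U" "p \<in> W" "y = \<phi> p" by blast
    then obtain W' where W': "openin (mtop M) W'" "p \<in> W'" "smooth_fun M W' f" using l by blast
    then show "\<exists>V. copen (idx M) V \<and> y \<in> V \<and> C_inf (idx M) V (\<lambda>y. f (inv_into U \<phi> y))"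
      using atlas_image_copen[OF M U W'(1)] smooth_funD[OF W'(3) U] p
      by (intro exI[of _ "\<phi> ` (U \<inter> W')"]) blast
  qed
qed

lemma smooth_fun_const: "charted_mfd M \<Longrightarrow> openin (mtop M) W \<Longrightarrow> smooth_fun M W (\<lambda>_. c)"
  by (rule smooth_funI, rule C_inf_const)
    (use charted_mfd_atlas coords_onD(1) atlas_image_copen in \<open>blast+\<close>)

lemma smooth_fun_add:
  "charted_mfd M \<Longrightarrow> openin (mtop M) W \<Longrightarrow> smooth_fun M W f \<Longrightarrow> smooth_fun M W g \<Longrightarrow> smooth_fun M W (\<lambda>q. f q + g q)"
  by (rule smooth_funI, rule C_inf_add)
    (use charted_mfd_atlas coords_onD(1) atlas_image_copen smooth_funD in \<open>blast+\<close>)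

lemma smooth_fun_mult:
  "charted_mfd M \<Longrightarrow> openin (mtop M) W \<Longrightarrow> smooth_fun M W f \<Longrightarrow> smooth_fun M W g \<Longrightarrow> smooth_fun M W (\<lambda>q. f q * g q)"
  by (rule smooth_funI, rule C_inf_mult)
    (use charted_mfd_atlas coords_onD(1) atlas_image_copen smooth_funD in \<open>blast+\<close>)

lemma smooth_fun_sum:
  assumes "charted_mfd M" "openin (mtop M) W" "\<And>b. b \<in> B \<Longrightarrow> smooth_fun M W (f b)"
  shows "smooth_fun M W (\<lambda>q. \<Sum>b\<in>B. f b q)"
  using assms(3)
proof (induction B rule: infinite_finite_induct)
  case (insert b B)
  then show ?case using smooth_fun_add[OF assms(1,2), of "f b" "\<lambda>q. \<Sum>b\<in>B. f b q"] by simp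
qed (simp_all add: smooth_fun_const[OF assms(1,2)])

lemma openin_local: "(\<And>p. p \<in> S \<Longrightarrow> \<exists>T. openin X T \<and> p \<in> T \<and> T \<subseteq> S) \<Longrightarrow> openin X S"
  by (subst openin_subopen) blast

lemma smooth_fun_preimage_open:
  assumes M: "charted_mfd M" and W: "openin (mtop M) W" and B: "copen B X"
    and F: "\<And>b. b \<in> B \<Longrightarrow> smooth_fun M W (\<lambda>q. F q b)" "\<And>q. q \<in> W \<Longrightarrow> F q \<in> coord_space B"
  shows "openin (mtop M) {q \<in> W. F q \<in> X}"
proof (rule openin_local)
  fix p assume p: "p \<in> {q \<in> W. F q \<in> X}"
  have "p \<in> carr M" using p openin_subset[OF W] by blast
  then obtain U \<phi> where U: "(U, \<phi>) \<in> atlas M" "p \<in> U" and c: "coords_on M U \<phi> (idx M)"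
    by (rule charted_mfd_cover[OF M])
  note inv = inv_into_f_f[OF coords_onD(3)[OF c]]
  obtain T where T: "open T" "X = coord_space B \<inter> T" using B unfolding openin_open by blast
  let ?Y = "\<phi> ` (U \<inter> W)"
  have "continuous_on ?Y (\<lambda>y. F (inv_into U \<phi> y))"
  proof (rule continuous_on_into_coord_space[of B])
    show "continuous_on ?Y (\<lambda>y. F (inv_into U \<phi> y) b)" if "b \<in> B" for b
      using C_inf_imp_continuous[OF smooth_funD[OF F(1)[OF that] U(1)]] .
    show "F (inv_into U \<phi> y) \<in> coord_space B" if "y \<in> ?Y" for y
      using that F(2) inv by auto
  qed
  then have "openin (top_of_set ?Y) (?Y \<inter> (\<lambda>y. F (inv_into U \<phi> y)) -` T)"
    by (rule continuous_openin_preimage_gen[OF _ T(1)])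
  then have "copen (idx M) (?Y \<inter> (\<lambda>y. F (inv_into U \<phi> y)) -` T)"
    using atlas_image_copen[OF M U(1) W] openin_trans by blast
  then have op: "openin (mtop M) {q \<in> U. \<phi> q \<in> ?Y \<inter> (\<lambda>y. F (inv_into U \<phi> y)) -` T}"
    by (rule coords_onD(5)[OF c])
  have "{q \<in> U. \<phi> q \<in> ?Y \<inter> (\<lambda>y. F (inv_into U \<phi> y)) -` T} = {q \<in> U \<inter> W. F q \<in> X}"
    using inv F(2) T(2) by (auto dest: inj_onD[OF coords_onD(3)[OF c]])
  with op p U(2) show "\<exists>T. openin (mtop M) T \<and> p \<in> T \<and> T \<subseteq> {q \<in> W. F q \<in> X}"
    by (intro exI[of _ "{q \<in> U \<inter> W. F q \<in> X}"]) auto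
qed

text \<open>A smooth function is smooth in the charts of the atlas by definition; near each point one of them
  is available, and the transition to it is smooth.\<close>

lemma charts_coords_on:
  assumes M: "smooth_manifold M" and c: "(U, \<phi>) \<in> charts M"
  shows "coords_on M U \<phi> (idx M)"
proof -
  let ?A = "idx M"
  have A: "finite ?A" using M by (simp add: smooth_manifold_def)
  have chart: "openin (mtop V') V \<and> copen ?A (\<psi> ` V) \<and> inj_on \<psi> V \<and>
      (\<forall>W'. openin (mtop M) W' \<longrightarrow> W' \<subseteq> V \<longrightarrow> copen ?A (\<psi> ` W')) \<and>
      (\<forall>X. copen ?A X \<longrightarrow> openin (mtop M) {p \<in> V. \<psi> p \<in> X})"
    if ch: "is_chart (mtop M) ?A (V, \<psi>)" and V': "V' = M" for V \<psi> V'
  proof -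
    have V: "openin (mtop M) V" "copen ?A (\<psi> ` V)" and hom: "homeomorphic_map (subtopology (mtop M) V) (top_of_set (\<psi> ` V)) \<psi>"
      using ch by (auto simp: is_chart_def)
    have ts: "topspace (subtopology (mtop M) V) = V" using openin_subset[OF V(1)] by auto
    have "inj_on \<psi> V" using homeomorphic_imp_injective_map[OF hom] ts by simp
    moreover have "copen ?A (\<psi> ` W')" if "openin (mtop M) W'" "W' \<subseteq> V" for W'
    proof -
      have "openin (subtopology (mtop M) V) W'" using that by (metis openin_open_subtopology V(1))
      then have "openin (top_of_set (\<psi> ` V)) (\<psi> ` W')"
        using homeomorphic_imp_open_map[OF hom] unfolding open_map_def by blast
      then show ?thesis using V(2) openin_trans by blast
    qed
    moreover have "openin (mtop M) {p \<in> V. \<psi> p \<in> X}" if X: "copen ?A X" for X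
    proof -
      have "openin (top_of_set (\<psi> ` V)) (\<psi> ` V \<inter> X)"
        using X openin_imp_subset[OF V(2)] unfolding openin_open by blast
      then have "openin (subtopology (mtop M) V) {p \<in> V. \<psi> p \<in> \<psi> ` V \<inter> X}"
        using openin_continuous_map_preimage[OF homeomorphic_imp_continuous_map[OF hom]] ts by metis
      moreover have "{p \<in> V. \<psi> p \<in> \<psi> ` V \<inter> X} = {p \<in> V. \<psi> p \<in> X}" by blast
      ultimately show ?thesis using V(1) openin_trans_full by force
    qed
    ultimately show ?thesis using V V' by blast
  qed
  have "is_chart (mtop M) ?A (U, \<phi>)" and tr: "\<And>d. d \<in> atlas M \<Longrightarrow> smooth_transition ?A (U, \<phi>) d \<and> smooth_transition ?A d (U, \<phi>)"
    using c by (auto simp: charts_def)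
  note cU = chart[OF this(1) refl]
  have at: "is_chart (mtop M) ?A d" if "d \<in> atlas M" for d using M that by (simp add: smooth_manifold_def)
  have "smooth_fun M U (\<lambda>p. \<phi> p b)" if b: "b \<in> ?A" for b
  proof (rule smooth_funI)
    fix V \<psi> assume "(V, \<psi>) \<in> atlas M"
    then show "C_inf ?A (\<psi> ` (V \<inter> U)) (\<lambda>y. \<phi> (inv_into V \<psi> y) b)"
      using tr b unfolding smooth_transition_def by blast
  qed
  moreover have "C_inf ?A (\<phi> ` W') (f \<circ> inv_into U \<phi>)"
    if W': "openin (mtop M) W'" "W' \<subseteq> U" and f: "smooth_fun M W' f" for W' f
  proof (rule C_inf_local)
    show "copen ?A (\<phi> ` W')" using cU W' by blast
    fix y assume "y \<in> \<phi> ` W'"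
    then obtain p where p: "p \<in> W'" "y = \<phi> p" by blast
    have "p \<in> carr M" using p(1) openin_subset[OF W'(1)] by blast
    then obtain d where "d \<in> atlas M" "p \<in> fst d" using M unfolding smooth_manifold_def by blast
    then obtain V \<psi> where V: "(V, \<psi>) \<in> atlas M" "p \<in> V" by (metis prod.collapse)
    note cV = chart[OF at[OF V(1)] refl]
    have op: "openin (mtop M) (V \<inter> W')" using cV W' by blast
    have C1: "C_inf ?A (\<psi> ` (V \<inter> W')) (\<lambda>y. f (inv_into V \<psi> y))" by (rule smooth_funD[OF f V(1)])
    have cop: "copen ?A (\<phi> ` (V \<inter> W'))" using cU op W' by blast
    have "C_inf ?A (\<phi> ` (V \<inter> W')) (\<lambda>y. f (inv_into V \<psi> (\<psi> (inv_into U \<phi> y))))"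
    proof (rule C_inf_compose[OF A _ A cop _ C1])
      show "copen ?A (\<psi> ` (V \<inter> W'))" using cV op by blast
      show "\<forall>y\<in>\<phi> ` (V \<inter> W'). \<psi> (inv_into U \<phi> y) \<in> \<psi> ` (V \<inter> W')"
        using cU W' inv_into_f_f[of \<phi> U] by auto
      show "C_inf ?A (\<phi> ` (V \<inter> W')) (\<lambda>y. \<psi> (inv_into U \<phi> y) i)" if "i \<in> ?A" for i
        by (rule C_inf_subset[of _ "\<phi> ` (U \<inter> V)"])
          (use tr[OF V(1)] W' that in \<open>auto simp: smooth_transition_def\<close>)
    qed
    then have "C_inf ?A (\<phi> ` (V \<inter> W')) (f \<circ> inv_into U \<phi>)"
    proof (rule C_inf_cong[OF A cop, rotated], intro ballI)
      fix z assume "z \<in> \<phi> ` (V \<inter> W')"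
      then obtain x where x: "x \<in> V" "x \<in> W'" "z = \<phi> x" by blast
      then have "inv_into U \<phi> z = x" "inv_into V \<psi> (\<psi> x) = x"
        using cU cV W'(2) by (auto intro: inv_into_f_f)
      then show "f (inv_into V \<psi> (\<psi> (inv_into U \<phi> z))) = (f \<circ> inv_into U \<phi>) z" by simp
    qed
    then show "\<exists>X. copen ?A X \<and> y \<in> X \<and> C_inf ?A X (f \<circ> inv_into U \<phi>)"
      using cop p V(2) by blast
  qed
  ultimately show ?thesis using A cU unfolding coords_on_def by blast
qed

lemma atlas_subset_charts: "smooth_manifold M \<Longrightarrow> atlas M \<subseteq> charts M"
  by (auto simp: smooth_manifold_def charts_def)

lemma smooth_manifold_charted: "smooth_manifold M \<Longrightarrow> charted_mfd M"
  unfolding charted_mfd_def using charts_coords_on[of M] atlas_subset_charts[of M] smooth_manifold_def[of M]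
  by blast

subsection \<open>Tangent vectors\<close>

lemma smooth_nearI: "openin (mtop M) W \<Longrightarrow> p \<in> W \<Longrightarrow> smooth_fun M W f \<Longrightarrow> smooth_near M p f"
  unfolding smooth_near_def by blast

lemma smooth_nearE:
  assumes "smooth_near M p f"
  obtains W where "openin (mtop M) W" "p \<in> W" "smooth_fun M W f"
  using assms unfolding smooth_near_def by blast

lemma smooth_nearE_in:
  assumes "smooth_near M p f" "openin (mtop M) U" "p \<in> U"
  obtains W where "openin (mtop M) W" "p \<in> W" "W \<subseteq> U" "smooth_fun M W f"
proof -
  obtain W where "openin (mtop M) W" "p \<in> W" "smooth_fun M W f" using assms(1) by (rule smooth_nearE)
  then show ?thesis using that[of "W \<inter> U"] assms smooth_fun_subset by blast
qed

lemma smooth_near_cong: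
  assumes "charted_mfd M" "openin (mtop M) W" "p \<in> W" "\<forall>q\<in>W. f q = g q" "smooth_near M p f"
  shows "smooth_near M p g"
proof -
  obtain W' where W': "openin (mtop M) W'" "p \<in> W'" "W' \<subseteq> W" "smooth_fun M W' f"
    using assms by (metis smooth_nearE_in)
  then have "smooth_fun M W' g" by (intro smooth_fun_cong[OF assms(1) W'(1,4)]) (use assms(4) in blast)
  then show ?thesis using smooth_nearI[OF W'(1,2)] by simp
qed

lemma smooth_near_binary:
  assumes "smooth_near M p f" "smooth_near M p g"
  obtains W where "openin (mtop M) W" "p \<in> W" "smooth_fun M W f" "smooth_fun M W g"
proof -
  obtain W1 where W1: "openin (mtop M) W1" "p \<in> W1" "smooth_fun M W1 f" using assms(1) by (rule smooth_nearE)
  obtain W2 where W2: "openin (mtop M) W2" "p \<in> W2" "smooth_fun M W2 g" using assms(2) by (rule smooth_nearE)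
  show ?thesis
    by (rule that[of "W1 \<inter> W2"]) (use W1 W2 smooth_fun_subset in blast)+
qed

lemma smooth_near_const: "charted_mfd M \<Longrightarrow> p \<in> carr M \<Longrightarrow> smooth_near M p (\<lambda>_. c)"
  by (rule smooth_nearI[of M "carr M"]) (auto intro: smooth_fun_const)

lemma smooth_near_lincomb:
  assumes "charted_mfd M" "smooth_near M p f" "smooth_near M p g"
  shows "smooth_near M p (\<lambda>x. a * f x + b * g x)"
proof -
  obtain W where W: "openin (mtop M) W" "p \<in> W" "smooth_fun M W f" "smooth_fun M W g"
    using smooth_near_binary[OF assms(2,3)] .
  have "smooth_fun M W (\<lambda>x. a * f x + b * g x)"
    by (rule smooth_fun_add[OF assms(1) W(1)]; rule smooth_fun_mult[OF assms(1) W(1)])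
      (use W smooth_fun_const[OF assms(1) W(1)] in auto)
  then show ?thesis using smooth_nearI[OF W(1,2)] by simp
qed

lemma smooth_near_mult:
  assumes "charted_mfd M" "smooth_near M p f" "smooth_near M p g"
  shows "smooth_near M p (\<lambda>x. f x * g x)"
proof -
  obtain W where W: "openin (mtop M) W" "p \<in> W" "smooth_fun M W f" "smooth_fun M W g"
    using smooth_near_binary[OF assms(2,3)] .
  show ?thesis by (rule smooth_nearI[OF W(1,2) smooth_fun_mult[OF assms(1) W(1,3,4)]])
qed

lemma tvec_not_smooth: "v \<in> tangent_space M p \<Longrightarrow> \<not> smooth_near M p f \<Longrightarrow> v f = 0"
  by (simp add: tangent_space_def)

lemma tvec_lincomb:
  "v \<in> tangent_space M p \<Longrightarrow> smooth_near M p f \<Longrightarrow> smooth_near M p g \<Longrightarrow>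
    v (\<lambda>x. a * f x + b * g x) = a * v f + b * v g"
  by (simp add: tangent_space_def)

lemma tvec_mult:
  "v \<in> tangent_space M p \<Longrightarrow> smooth_near M p f \<Longrightarrow> smooth_near M p g \<Longrightarrow>
    v (\<lambda>x. f x * g x) = f p * v g + g p * v f"
  by (simp add: tangent_space_def)

lemma tvec_add:
  "v \<in> tangent_space M p \<Longrightarrow> smooth_near M p f \<Longrightarrow> smooth_near M p g \<Longrightarrow> v (\<lambda>x. f x + g x) = v f + v g"
  using tvec_lincomb[of v M p f g 1 1] by simp

text \<open>The indicator function of a neighbourhood is idempotent and smooth near the point, so the
  Leibniz rule annihilates it; multiplying by it shows that only germs matter.\<close>

lemma tvec_germ:
  assumes M: "charted_mfd M" and v: "v \<in> tangent_space M p" and W: "openin (mtop M) W" "p \<in> W"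
    and fg: "\<forall>q\<in>W. f q = g q"
  shows "v f = v g"
proof (cases "smooth_near M p f")
  case True
  have g: "smooth_near M p g" by (rule smooth_near_cong[OF M W fg True])
  define \<kappa> where "\<kappa> q = (if q \<in> W then 1 else 0 :: real)" for q
  have "smooth_fun M W \<kappa>"
    by (rule smooth_fun_cong[OF M W(1) smooth_fun_const[OF M W(1), of 1]]) (simp add: \<kappa>_def)
  then have \<kappa>: "smooth_near M p \<kappa>" using smooth_nearI[OF W(1,2)] by simp
  have "(\<lambda>x. \<kappa> x * \<kappa> x) = \<kappa>" by (auto simp: \<kappa>_def)
  then have z: "v \<kappa> = 0" using tvec_mult[OF v \<kappa> \<kappa>] W by (simp add: \<kappa>_def)
  have e: "(\<lambda>x. f x * \<kappa> x) = (\<lambda>x. g x * \<kappa> x)" using fg by (auto simp: \<kappa>_def)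
  have "v f = v (\<lambda>x. f x * \<kappa> x)" using tvec_mult[OF v True \<kappa>] z W by (simp add: \<kappa>_def)
  also have "\<dots> = v g" unfolding e using tvec_mult[OF v g \<kappa>] z W by (simp add: \<kappa>_def)
  finally show ?thesis .
next
  case False
  then have "\<not> smooth_near M p g" using smooth_near_cong[OF M W, of g f] fg by auto
  with False show ?thesis using tvec_not_smooth[OF v] by simp
qed

lemma tvec_const:
  assumes "charted_mfd M" "v \<in> tangent_space M p" "p \<in> carr M"
  shows "v (\<lambda>_. c) = 0"
proof -
  note s = smooth_near_const[OF assms(1,3)]
  have "v (\<lambda>_. 1) = 0" using tvec_mult[OF assms(2) s[of 1] s[of 1]] by simp
  then show ?thesis using tvec_lincomb[OF assms(2) s[of 1] s[of 1], of c 0] by simp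
qed

lemma tvec_sum:
  assumes "charted_mfd M" "v \<in> tangent_space M p" "p \<in> carr M"
    and "finite B" "\<And>b. b \<in> B \<Longrightarrow> smooth_near M p (f b)"
  shows "smooth_near M p (\<lambda>x. \<Sum>b\<in>B. f b x) \<and> v (\<lambda>x. \<Sum>b\<in>B. f b x) = (\<Sum>b\<in>B. v (f b))"
  using assms(4,5)
proof (induction B)
  case empty
  then show ?case using tvec_const[OF assms(1-3), of 0] smooth_near_const[OF assms(1,3), of 0] by simp
next
  case (insert b B)
  then have "smooth_near M p (f b)" "smooth_near M p (\<lambda>x. \<Sum>b\<in>B. f b x)" by auto
  from smooth_near_lincomb[OF assms(1) this, of 1 1] tvec_add[OF assms(2) this] insert
  show ?case by simp
qed

text \<open>Hadamard's lemma writes \<open>h \<circ> F\<close> near \<open>p\<close> as a constant plus a sum of products whose first factors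
  vanish at \<open>p\<close>; the Leibniz rule then leaves only the values of the second factors, which are the
  partial derivatives of \<open>h\<close>.\<close>

lemma tvec_chain:
  assumes M: "charted_mfd M" and v: "v \<in> tangent_space M p" and W: "openin (mtop M) W" "p \<in> W"
    and B: "finite B" "copen B X" and h: "C_inf B X h"
    and F: "\<And>b. b \<in> B \<Longrightarrow> smooth_fun M W (\<lambda>q. F q b)" "\<And>q. q \<in> W \<Longrightarrow> F q \<in> X"
  shows "v (\<lambda>q. h (F q)) = (\<Sum>b\<in>B. pd b h (F p) * v (\<lambda>q. F q b))"
proof -
  have pc: "p \<in> carr M" using W openin_subset by blast
  obtain e q where e: "e > 0" "cube B (F p) e \<subseteq> X" and q: "\<And>b. b \<in> B \<Longrightarrow> C_inf B (cube B (F p) e) (q b)"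
    "\<And>b. b \<in> B \<Longrightarrow> q b (F p) = pd b h (F p)"
    "\<And>y. y \<in> cube B (F p) e \<Longrightarrow> h y = h (F p) + (\<Sum>b\<in>B. (y b - F p b) * q b y)"
    using hadamard[OF B h F(2)[OF W(2)]] by blast
  have Fc: "F x \<in> coord_space B" if "x \<in> W" for x using F(2)[OF that] copen_imp_coord_space[OF B(2)] by blast
  define W' where "W' = {x \<in> W. F x \<in> cube B (F p) e}"
  have W': "openin (mtop M) W'" unfolding W'_def
    by (rule smooth_fun_preimage_open[OF M W(1) copen_cube[OF B(1)] F(1) Fc])
  have pW': "p \<in> W'" using W(2) centre_in_cube[OF Fc[OF W(2)] e(1)] by (simp add: W'_def)
  define l where "l b x = 1 * F x b + (- F p b) * 1" for b x
  have Fs: "smooth_near M p (\<lambda>x. F x b)" if "b \<in> B" for b using smooth_nearI[OF W F(1)[OF that]] .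
  have ls: "smooth_near M p (l b)" if "b \<in> B" for b
    unfolding l_def by (rule smooth_near_lincomb[OF M Fs[OF that] smooth_near_const[OF M pc]])
  have vl: "v (l b) = v (\<lambda>x. F x b)" if "b \<in> B" for b
    unfolding l_def using tvec_lincomb[OF v Fs[OF that] smooth_near_const[OF M pc, of 1], of 1 "- F p b"]
      tvec_const[OF M v pc] by simp
  have qs: "smooth_near M p (\<lambda>x. q b (F x))" if "b \<in> B" for b
  proof (rule smooth_nearI[OF W' pW'], rule smooth_fun_compose[OF M W' B(1) copen_cube[OF B(1)] q(1)[OF that]])
    show "smooth_fun M W' (\<lambda>q. F q b)" if "b \<in> B" for b
      by (rule smooth_fun_subset[OF F(1)[OF that]]) (auto simp: W'_def)
  qed (auto simp: W'_def)
  have lqs: "smooth_near M p (\<lambda>x. l b x * q b (F x))" if "b \<in> B" for b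
    by (rule smooth_near_mult[OF M ls[OF that] qs[OF that]])
  have S: "smooth_near M p (\<lambda>x. \<Sum>b\<in>B. l b x * q b (F x)) \<and>
      v (\<lambda>x. \<Sum>b\<in>B. l b x * q b (F x)) = (\<Sum>b\<in>B. v (\<lambda>x. l b x * q b (F x)))"
    by (rule tvec_sum[OF M v pc B(1)]) (rule lqs)
  have "v (\<lambda>q. h (F q)) = v (\<lambda>x. h (F p) + (\<Sum>b\<in>B. l b x * q b (F x)))"
    by (rule tvec_germ[OF M v W' pW']) (use q(3) in \<open>auto simp: W'_def l_def\<close>)
  also have "\<dots> = v (\<lambda>x. \<Sum>b\<in>B. l b x * q b (F x))"
    using tvec_add[OF v smooth_near_const[OF M pc, of "h (F p)"] S[THEN conjunct1]] tvec_const[OF M v pc] by simp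
  also have "\<dots> = (\<Sum>b\<in>B. v (\<lambda>x. l b x * q b (F x)))" using S by blast
  also have "\<dots> = (\<Sum>b\<in>B. pd b h (F p) * v (\<lambda>q. F q b))"
    by (rule sum.cong) (use tvec_mult[OF v ls qs] vl q(2) in \<open>auto simp: l_def\<close>)
  finally show ?thesis .
qed

lemma tvec_in_coords:
  assumes M: "charted_mfd M" and v: "v \<in> tangent_space M p" and c: "coords_on M W \<kappa> B" and p: "p \<in> W"
    and f: "smooth_near M p f"
  shows "v f = (\<Sum>b\<in>B. pd b (f \<circ> inv_into W \<kappa>) (\<kappa> p) * v (\<lambda>q. \<kappa> q b))"
proof -
  obtain W' where W': "openin (mtop M) W'" "p \<in> W'" "W' \<subseteq> W" "smooth_fun M W' f"
    using smooth_nearE_in[OF f coords_onD(2)[OF c] p] .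
  have "v f = v (\<lambda>q. (f \<circ> inv_into W \<kappa>) (\<kappa> q))"
    by (rule tvec_germ[OF M v W'(1,2)]) (use W'(3) inv_into_f_f[OF coords_onD(3)[OF c]] in auto)
  also have "\<dots> = (\<Sum>b\<in>B. pd b (f \<circ> inv_into W \<kappa>) (\<kappa> p) * v (\<lambda>q. \<kappa> q b))"
    by (rule tvec_chain[OF M v W'(1,2) coords_onD(1)[OF c] coords_onD(4)[OF c W'(1,3)] coords_onD(7)[OF c W'(1,3,4)]])
      (use smooth_fun_subset[OF coords_onD(6)[OF c] W'(3)] in auto)
  finally show ?thesis .
qed

lemma tvec_eqI:
  assumes M: "charted_mfd M" and v: "v \<in> tangent_space M p" "w \<in> tangent_space M p"
    and c: "coords_on M W \<kappa> B" and p: "p \<in> W" and eq: "\<And>b. b \<in> B \<Longrightarrow> v (\<lambda>q. \<kappa> q b) = w (\<lambda>q. \<kappa> q b)"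
  shows "v = w"
proof
  fix f show "v f = w f"
  proof (cases "smooth_near M p f")
    case True
    show ?thesis unfolding tvec_in_coords[OF M v(1) c p True] tvec_in_coords[OF M v(2) c p True]
      using eq by (auto intro: sum.cong)
  qed (use tvec_not_smooth v in metis)
qed

lemma tzero_in_tangent_space: "tzero \<in> tangent_space M p"
  by (simp add: tangent_space_def tzero_def)

lemma tangent_space_lincomb:
  assumes "v \<in> tangent_space M p" "w \<in> tangent_space M p"
  shows "(\<lambda>f. a * v f + b * w f) \<in> tangent_space M p"
  using assms unfolding tangent_space_def by (auto simp: algebra_simps)

definition coord_vec ::
    "('a, 'i) mfd \<Rightarrow> 'a set \<Rightarrow> ('a \<Rightarrow> 'b \<Rightarrow> real) \<Rightarrow> 'b set \<Rightarrow> 'a \<Rightarrow> ('b \<Rightarrow> real) \<Rightarrow> 'a tvec" where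
  "coord_vec M W \<kappa> B p d =
     (\<lambda>f. if smooth_near M p f then \<Sum>b\<in>B. pd b (f \<circ> inv_into W \<kappa>) (\<kappa> p) * d b else 0)"

lemma coord_vec_tangent:
  assumes M: "charted_mfd M" and c: "coords_on M W \<kappa> B" and p: "p \<in> W"
  shows "coord_vec M W \<kappa> B p d \<in> tangent_space M p"
proof -
  let ?v = "coord_vec M W \<kappa> B p d"
  let ?i = "inv_into W \<kappa>"
  have *: "\<forall>b\<in>B. has_pd b (f \<circ> ?i) (\<kappa> p) (pd b (f \<circ> ?i) (\<kappa> p))" if f: "smooth_near M p f" for f
  proof -
    obtain W' where W': "openin (mtop M) W'" "p \<in> W'" "W' \<subseteq> W" "smooth_fun M W' f"
      using smooth_nearE_in[OF f coords_onD(2)[OF c] p] .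
    show ?thesis using C_inf_has_pd[OF coords_onD(7)[OF c W'(1,3,4)]] W'(2) by blast
  qed
  have fp: "?i (\<kappa> p) = p" using inv_into_f_f[OF coords_onD(3)[OF c] p] .
  have "?v (\<lambda>x. a * f x + b * g x) = a * ?v f + b * ?v g" if f: "smooth_near M p f" and g: "smooth_near M p g" for f g a b
  proof -
    have "pd k ((\<lambda>x. a * f x + b * g x) \<circ> ?i) (\<kappa> p) = a * pd k (f \<circ> ?i) (\<kappa> p) + b * pd k (g \<circ> ?i) (\<kappa> p)" if "k \<in> B" for k
      using DERIV_add[OF DERIV_cmult[OF bspec[OF *[OF f] that], of a] DERIV_cmult[OF bspec[OF *[OF g] that], of b]]
      by (intro has_pd_imp_pd) (simp add: o_def)
    then show ?thesis using f g smooth_near_lincomb[OF M f g]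
      by (simp add: coord_vec_def sum_distrib_left flip: sum.distrib) (auto intro!: sum.cong simp: algebra_simps)
  qed
  moreover have "?v (\<lambda>x. f x * g x) = f p * ?v g + g p * ?v f" if f: "smooth_near M p f" and g: "smooth_near M p g" for f g
  proof -
    have "pd k ((\<lambda>x. f x * g x) \<circ> ?i) (\<kappa> p) = f p * pd k (g \<circ> ?i) (\<kappa> p) + g p * pd k (f \<circ> ?i) (\<kappa> p)" if "k \<in> B" for k
      using DERIV_mult[OF bspec[OF *[OF f] that] bspec[OF *[OF g] that]] fp
      by (intro has_pd_imp_pd) (simp add: o_def algebra_simps)
    then show ?thesis using f g smooth_near_mult[OF M f g]
      by (simp add: coord_vec_def sum_distrib_left flip: sum.distrib) (auto intro!: sum.cong simp: algebra_simps)
  qed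
  ultimately show ?thesis unfolding tangent_space_def by (simp add: coord_vec_def)
qed

lemma pd_coord:
  "pd b (\<lambda>y. y b') x = (if b = b' then 1 else 0)"
  by (rule has_pd_imp_pd) (cases "b = b'", auto)

lemma coord_vec_coord:
  assumes M: "charted_mfd M" and c: "coords_on M W \<kappa> B" and p: "p \<in> W" and b: "b \<in> B"
  shows "coord_vec M W \<kappa> B p d (\<lambda>q. \<kappa> q b) = d b"
proof -
  have "pd k ((\<lambda>q. \<kappa> q b) \<circ> inv_into W \<kappa>) (\<kappa> p) = (if k = b then 1 else 0)" if k: "k \<in> B" for k
  proof -
    have "pd k ((\<lambda>q. \<kappa> q b) \<circ> inv_into W \<kappa>) (\<kappa> p) = pd k (\<lambda>y. y b) (\<kappa> p)"
      by (rule pd_cong[OF coords_onD(1)[OF c] coords_onD(4)[OF c coords_onD(2)[OF c] order.refl] _ _ k])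
        (use p in \<open>auto simp: f_inv_into_f\<close>)
    then show ?thesis by (simp add: pd_coord)
  qed
  then have "(\<Sum>k\<in>B. pd k ((\<lambda>q. \<kappa> q b) \<circ> inv_into W \<kappa>) (\<kappa> p) * d k) = (\<Sum>k\<in>B. if k = b then d k else 0)"
    by (intro sum.cong) auto
  then show ?thesis
    using smooth_nearI[OF coords_onD(2)[OF c] p coords_onD(6)[OF c b]] b coords_onD(1)[OF c]
    by (simp add: coord_vec_def)
qed

subsection \<open>Exchanging coordinates\<close>

text \<open>In the coordinates \<open>\<kappa>\<close> this is \<open>replace_coordinate\<close>. Iterated, it replaces the inverse
  function theorem.\<close>

lemma exchange_coordinate:
  assumes M: "charted_mfd M" and c: "coords_on M W \<kappa> A" and p: "p \<in> W" and g: "smooth_near M p g"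
    and a: "a \<in> A" and nz: "pd a (g \<circ> inv_into W \<kappa>) (\<kappa> p) \<noteq> 0"
  obtains W' where "p \<in> W'" "W' \<subseteq> W" "coords_on M W' (\<lambda>q. (\<kappa> q)(a := g q)) A"
proof -
  note A = coords_onD(1)[OF c]
  obtain W0 where W0: "openin (mtop M) W0" "p \<in> W0" "W0 \<subseteq> W" "smooth_fun M W0 g"
    using smooth_nearE_in[OF g coords_onD(2)[OF c] p] .
  define G where "G = g \<circ> inv_into W \<kappa>"
  have inv: "inv_into W \<kappa> (\<kappa> q) = q" if "q \<in> W" for q by (rule inv_into_f_f[OF coords_onD(3)[OF c] that])
  have G\<kappa>: "G (\<kappa> q) = g q" if "q \<in> W" for q using inv[OF that] by (simp add: G_def)
  have CG: "C_inf A (\<kappa> ` W0) G" unfolding G_def by (rule coords_onD(7)[OF c W0(1,3,4)])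
  have nzG: "pd a G (\<kappa> p) \<noteq> 0" using nz by (simp add: G_def)
  obtain X h where X: "copen A X" "\<kappa> p \<in> X" "X \<subseteq> \<kappa> ` W0"
    and hG: "\<And>y. y \<in> X \<Longrightarrow> h (y(a := G y)) = y a"
    and op: "\<And>Z. copen A Z \<Longrightarrow> Z \<subseteq> X \<Longrightarrow> copen A ((\<lambda>y. y(a := G y)) ` Z)"
    and h: "C_inf A ((\<lambda>y. y(a := G y)) ` X) h"
    by (rule replace_coordinate[OF A coords_onD(4)[OF c W0(1,3)] CG a imageI[OF W0(2)] nzG])
      (rule that; blast)
  define W' where "W' = {q \<in> W0. \<kappa> q \<in> X}"
  have "W' = W0 \<inter> {q \<in> W. \<kappa> q \<in> X}" using W0(3) by (auto simp: W'_def)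
  then have W': "openin (mtop M) W'" using W0(1) coords_onD(5)[OF c X(1)] by auto
  have W'W: "W' \<subseteq> W" using W0(3) by (auto simp: W'_def)
  define \<kappa>' where "\<kappa>' q = (\<kappa> q)(a := g q)" for q
  have \<kappa>'G: "\<kappa>' q = (\<kappa> q)(a := G (\<kappa> q))" if "q \<in> W'" for q using G\<kappa> that W'W by (auto simp: \<kappa>'_def)
  have bk: "(\<kappa>' q)(a := h (\<kappa>' q)) = \<kappa> q" if "q \<in> W'" for q
    using hG[of "\<kappa> q"] that unfolding \<kappa>'G[OF that] by (simp add: W'_def)
  have inj: "inj_on \<kappa>' W'"
  proof (rule inj_onI)
    fix q q' assume q: "q \<in> W'" "q' \<in> W'" "\<kappa>' q = \<kappa>' q'"
    then have "\<kappa> q = \<kappa> q'" using bk by metis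
    then show "q = q'" using inj_onD[OF coords_onD(3)[OF c]] q W'W by blast
  qed
  have img: "\<kappa>' ` V = (\<lambda>y. y(a := G y)) ` (\<kappa> ` V)" if "V \<subseteq> W'" for V
    unfolding image_image by (rule image_cong) (use \<kappa>'G that in auto)
  have opm: "copen A (\<kappa>' ` V)" if "openin (mtop M) V" "V \<subseteq> W'" for V
    unfolding img[OF that(2)]
    by (rule op[OF coords_onD(4)[OF c that(1)]]) (use that W'W in \<open>auto simp: W'_def\<close>)
  have sm: "smooth_fun M W' (\<lambda>q. \<kappa>' q b)" if "b \<in> A" for b
  proof (cases "b = a")
    case True
    then show ?thesis using smooth_fun_subset[OF W0(4)] by (auto simp: \<kappa>'_def W'_def)
  next
    case False
    then show ?thesis using smooth_fun_subset[OF coords_onD(6)[OF c that] W'W] by (simp add: \<kappa>'_def)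
  qed
  have "openin (mtop M) {q \<in> W'. \<kappa>' q \<in> V}" if "copen A V" for V
    by (rule smooth_fun_preimage_open[OF M W' that sm])
      (use copen_imp_coord_space[OF opm[OF W' order.refl]] in auto)
  moreover have "C_inf A (\<kappa>' ` V) (f \<circ> inv_into W' \<kappa>')"
    if V: "openin (mtop M) V" "V \<subseteq> W'" and f: "smooth_fun M V f" for V f
  proof -
    have VW: "V \<subseteq> W" using V W'W by blast
    have cop: "copen A (\<kappa>' ` V)" by (rule opm[OF V])
    have "C_inf A (\<kappa>' ` V) (\<lambda>z. (f \<circ> inv_into W \<kappa>) (z(a := h z)))"
    proof (rule C_inf_compose[OF A coords_onD(4)[OF c V(1) VW] A cop _ coords_onD(7)[OF c V(1) VW f]])
      show "\<forall>z\<in>\<kappa>' ` V. z(a := h z) \<in> \<kappa> ` V" using bk V by auto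
      show "C_inf A (\<kappa>' ` V) (\<lambda>z. (z(a := h z)) i)" for i
      proof (cases "i = a")
        case True
        have "C_inf A (\<kappa>' ` V) h"
          by (rule C_inf_subset[OF _ h]) (use img[OF V(2)] V in \<open>auto simp: W'_def\<close>)
        then show ?thesis using True by simp
      qed (simp add: C_inf_coord[OF A cop])
    qed
    then show ?thesis
    proof (rule C_inf_cong[OF A cop, rotated], intro ballI)
      fix z assume "z \<in> \<kappa>' ` V"
      then obtain q where q: "q \<in> V" "z = \<kappa>' q" by blast
      then have "q \<in> W'" "q \<in> W" using V VW by auto
      then show "(f \<circ> inv_into W \<kappa>) (z(a := h z)) = (f \<circ> inv_into W' \<kappa>') z"
        using q(2) bk inv inv_into_f_f[OF inj] by simp
    qed
  qed
  ultimately have "coords_on M W' \<kappa>' A"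
    unfolding coords_on_def using A W' inj opm sm by blast
  then show ?thesis using that[of W'] W0(2) X(2) W'W unfolding \<kappa>'_def W'_def by blast
qed

text \<open>If the differentials of the \<open>f b\<close> span the cotangent space, then the old coordinates can be
  exchanged one by one: the coordinate vector of an old coordinate still present is annihilated by
  the coordinates already exchanged, and some \<open>f b\<close> does not annihilate it.\<close>

lemma exchange_coordinates:
  assumes M: "charted_mfd M" and c: "coords_on M W0 \<phi> A" and p: "p \<in> W0"
    and f: "\<And>b. b \<in> B \<Longrightarrow> smooth_near M p (f b)"
    and sp: "\<And>v. v \<in> tangent_space M p \<Longrightarrow> (\<And>b. b \<in> B \<Longrightarrow> v (f b) = 0) \<Longrightarrow> v = tzero"
  obtains W \<kappa> \<beta> where "p \<in> W" "coords_on M W \<kappa> A" "inj_on \<beta> A" "\<beta> ` A \<subseteq> B"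
    "\<And>q a. q \<in> W \<Longrightarrow> a \<in> A \<Longrightarrow> \<kappa> q a = f (\<beta> a) q"
proof -
  have "\<exists>W \<kappa> \<beta>. p \<in> W \<and> coords_on M W \<kappa> A \<and> inj_on \<beta> L \<and> \<beta> ` L \<subseteq> B \<and> (\<forall>q\<in>W. \<forall>a\<in>L. \<kappa> q a = f (\<beta> a) q)"
    if "finite L" "L \<subseteq> A" for L
    using that
  proof (induction L)
    case empty
    then show ?case using c p by auto
  next
    case (insert a L)
    then obtain W \<kappa> \<beta> where I: "p \<in> W" "coords_on M W \<kappa> A" "inj_on \<beta> L" "\<beta> ` L \<subseteq> B" "\<forall>q\<in>W. \<forall>a\<in>L. \<kappa> q a = f (\<beta> a) q"
      by auto
    have a: "a \<in> A" using insert by auto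
    define v where "v = coord_vec M W \<kappa> A p (\<lambda>b. if b = a then 1 else 0)"
    have v: "v \<in> tangent_space M p" unfolding v_def by (rule coord_vec_tangent[OF M I(2,1)])
    have "v (\<lambda>q. \<kappa> q a) = 1" unfolding v_def using coord_vec_coord[OF M I(2,1) a] by simp
    then have "v \<noteq> tzero" by (auto simp: tzero_def)
    then obtain b where b: "b \<in> B" "v (f b) \<noteq> 0" using sp[OF v] by blast
    have "pd a (f b \<circ> inv_into W \<kappa>) (\<kappa> p) \<noteq> 0"
    proof -
      have "v (f b) = (\<Sum>k\<in>A. pd k (f b \<circ> inv_into W \<kappa>) (\<kappa> p) * (if k = a then 1 else 0))"
        using f[OF b(1)] by (simp add: v_def coord_vec_def)
      also have "\<dots> = (\<Sum>k\<in>A. if k = a then pd k (f b \<circ> inv_into W \<kappa>) (\<kappa> p) else 0)"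
        by (rule sum.cong) auto
      finally show ?thesis using b(2) a coords_onD(1)[OF I(2)] by simp
    qed
    from exchange_coordinate[OF M I(2,1) f[OF b(1)] a this]
    obtain W' where W': "p \<in> W'" "W' \<subseteq> W" "coords_on M W' (\<lambda>q. (\<kappa> q)(a := f b q)) A" .
    have bL: "b \<notin> \<beta> ` L"
    proof
      assume "b \<in> \<beta> ` L"
      then obtain a' where a': "a' \<in> L" "b = \<beta> a'" by blast
      have "v (f b) = v (\<lambda>q. \<kappa> q a')"
        by (rule tvec_germ[OF M v coords_onD(2)[OF I(2)] I(1)]) (use I(5) a' in auto)
      also have "\<dots> = 0" unfolding v_def using coord_vec_coord[OF M I(2,1), of a'] a' insert by auto
      finally show False using b by simp
    qed
    have img: "(\<beta>(a := b)) ` L = \<beta> ` L" using insert.hyps by (intro image_cong) auto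
    have "inj_on (\<beta>(a := b)) L"
      by (rule inj_onI) (use inj_onD[OF I(3)] insert.hyps(2) in \<open>auto split: if_splits\<close>)
    then have "inj_on (\<beta>(a := b)) (insert a L)"
      using bL img insert.hyps(2) by (simp add: inj_on_insert del: fun_upd_apply) simp
    moreover have "\<forall>q\<in>W'. \<forall>a'\<in>insert a L. ((\<kappa> q)(a := f b q)) a' = f ((\<beta>(a := b)) a') q"
      using I(5) W'(2) insert.hyps by auto
    moreover have "(\<beta>(a := b)) ` insert a L \<subseteq> B" using img I(4) b(1) by (simp del: fun_upd_apply) simp
    ultimately show ?case using W'(1,3) by blast
  qed
  from this[OF coords_onD(1)[OF c] order.refl] show ?thesis using that by metis
qed

lemma relabel_coordinates:
  assumes M: "charted_mfd M" and c: "coords_on M W \<kappa> A" and \<beta>: "bij_betw \<beta> A B"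
    and f: "\<And>q a. q \<in> W \<Longrightarrow> a \<in> A \<Longrightarrow> \<kappa> q a = f (\<beta> a) q"
  shows "coords_on M W (\<lambda>q b. if b \<in> B then f b q else 0) B"
proof -
  define \<kappa>' where "\<kappa>' q b = (if b \<in> B then f b q else 0)" for q b
  define \<rho> where "\<rho> y a = (if a \<in> A then y (\<beta> a) else 0 :: real)" for y a
  define \<rho>' where "\<rho>' y b = (if b \<in> B then y (inv_into A \<beta> b) else 0 :: real)" for y b
  note A = coords_onD(1)[OF c]
  have B: "finite B" using \<beta> A bij_betw_finite by blast
  have \<beta>B: "\<beta> a \<in> B" if "a \<in> A" for a using \<beta> that by (auto simp: bij_betw_def)
  have inv: "inv_into A \<beta> b \<in> A" "\<beta> (inv_into A \<beta> b) = b" if "b \<in> B" for b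
    using \<beta> that by (auto simp: bij_betw_def inv_into_into f_inv_into_f)
  have inv2: "inv_into A \<beta> (\<beta> a) = a" if "a \<in> A" for a using \<beta> that by (simp add: bij_betw_def)
  have \<rho>\<kappa>: "\<rho> (\<kappa>' q) = \<kappa> q" if "q \<in> W" for q
    by (rule coord_space_eqI[of _ A])
      (use that f \<beta>B coords_on_in_coord_space[OF c that] in \<open>auto simp: \<rho>_def \<kappa>'_def coord_space_def\<close>)
  have \<rho>'\<kappa>: "\<kappa>' q = \<rho>' (\<kappa> q)" if "q \<in> W" for q
    using that f inv by (auto simp: \<rho>'_def \<kappa>'_def)
  have inj: "inj_on \<kappa>' W"
    by (rule inj_onI) (metis \<rho>\<kappa> inj_onD[OF coords_onD(3)[OF c]])
  have op: "copen B (\<kappa>' ` V)" if V: "openin (mtop M) V" "V \<subseteq> W" for V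
  proof (rule copenI[OF B])
    show "\<kappa>' ` V \<subseteq> coord_space B" by (auto simp: \<kappa>'_def coord_space_def)
    fix y assume "y \<in> \<kappa>' ` V"
    then obtain q where q: "q \<in> V" "y = \<kappa>' q" by blast
    obtain e where e: "e > 0" "cube A (\<kappa> q) e \<subseteq> \<kappa> ` V"
      using copen_contains_cube[OF A coords_onD(4)[OF c V] imageI[OF q(1)]] .
    have "cube B y e \<subseteq> \<kappa>' ` V"
    proof
      fix z assume z: "z \<in> cube B y e"
      have "\<rho> z \<in> cube A (\<kappa> q) e"
        using z q V f \<beta>B by (auto simp: cube_def \<rho>_def coord_space_def \<kappa>'_def subset_iff)
      then obtain q' where q': "q' \<in> V" "\<rho> z = \<kappa> q'" using e(2) by blast
      have "z = \<rho>' (\<rho> z)" using z inv by (fastforce simp: \<rho>_def \<rho>'_def cube_def coord_space_def)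
      moreover have "q' \<in> W" using q'(1) V(2) by blast
      ultimately have "z = \<kappa>' q'" using q'(2) \<rho>'\<kappa>[of q'] by simp
      then show "z \<in> \<kappa>' ` V" using q'(1) by (rule image_eqI)
    qed
    then show "\<exists>e>0. cube B y e \<subseteq> \<kappa>' ` V" using e(1) by blast
  qed
  have sm: "smooth_fun M W (\<lambda>q. \<kappa>' q b)" if b: "b \<in> B" for b
    by (rule smooth_fun_cong[OF M coords_onD(2)[OF c] coords_onD(6)[OF c inv(1)[OF b]]])
      (use \<rho>'\<kappa> b in \<open>auto simp: \<rho>'_def\<close>)
  have "openin (mtop M) {q \<in> W. \<kappa>' q \<in> X}" if "copen B X" for X
    by (rule smooth_fun_preimage_open[OF M coords_onD(2)[OF c] that sm]) (auto simp: \<kappa>'_def coord_space_def)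
  moreover have "C_inf B (\<kappa>' ` V) (g \<circ> inv_into W \<kappa>')"
    if V: "openin (mtop M) V" "V \<subseteq> W" and g: "smooth_fun M V g" for V g
  proof -
    have "C_inf B (\<kappa>' ` V) (\<lambda>z. (g \<circ> inv_into W \<kappa>) (\<rho> z))"
    proof (rule C_inf_compose[OF A coords_onD(4)[OF c V] B op[OF V] _ coords_onD(7)[OF c V g]])
      show "\<forall>z\<in>\<kappa>' ` V. \<rho> z \<in> \<kappa> ` V" using \<rho>\<kappa> V by auto
      show "C_inf B (\<kappa>' ` V) (\<lambda>z. \<rho> z i)" for i
        using C_inf_coord[OF B op[OF V]] C_inf_const[OF B op[OF V]] by (cases "i \<in> A") (simp_all add: \<rho>_def)
    qed
    then show ?thesis
      by (rule C_inf_cong[OF B op[OF V], rotated])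
        (use V \<rho>\<kappa> inv_into_f_f[OF inj] inv_into_f_f[OF coords_onD(3)[OF c]] in \<open>auto simp: subset_iff\<close>)
  qed
  ultimately have "coords_on M W \<kappa>' B"
    unfolding coords_on_def using B coords_onD(2)[OF c] inj op sm by blast
  then show ?thesis unfolding \<kappa>'_def .
qed

subsection \<open>Submanifolds\<close>

lemma smooth_map_on_pullback:
  assumes M: "charted_mfd M" and N: "charted_mfd N" and W: "openin (mtop M) W" and F: "smooth_map_on M W N F"
    and V: "openin (mtop N) V" and g: "smooth_fun N V g"
  shows "openin (mtop M) {p \<in> W. F p \<in> V} \<and> smooth_fun M {p \<in> W. F p \<in> V} (\<lambda>p. g (F p))"
proof -
  have cont: "continuous_map (subtopology (mtop M) W) (mtop N) F" using F by (simp add: smooth_map_on_def)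
  have ts: "topspace (subtopology (mtop M) W) = W" using openin_subset[OF W] by auto
  have op: "openin (mtop M) {p \<in> W. F p \<in> Z}" if "openin (mtop N) Z" for Z
  proof -
    have "openin (subtopology (mtop M) W) {p \<in> W. F p \<in> Z}"
      using cont that unfolding continuous_map_def ts by auto
    then show ?thesis using W openin_trans_full by blast
  qed
  have "smooth_fun M {p \<in> W. F p \<in> V} (\<lambda>p. g (F p))"
  proof (rule smooth_fun_local[OF M op[OF V]])
    fix p assume p: "p \<in> {p \<in> W. F p \<in> V}"
    have "F p \<in> carr N" using p openin_subset[OF V] by blast
    then obtain U \<psi> where U: "(U, \<psi>) \<in> atlas N" "F p \<in> U" and c: "coords_on N U \<psi> (idx N)"
      by (rule charted_mfd_cover[OF N])
    let ?Z = "U \<inter> V"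
    have Z: "openin (mtop N) ?Z" using V coords_onD(2)[OF c] by blast
    let ?T = "{p \<in> W. F p \<in> ?Z}"
    have "smooth_fun M ?T (\<lambda>p. (g \<circ> inv_into U \<psi>) (\<psi> (F p)))"
    proof (rule smooth_fun_compose[OF M op[OF Z] coords_onD(1)[OF c] coords_onD(4)[OF c Z] coords_onD(7)[OF c Z]])
      show "smooth_fun N ?Z g" by (rule smooth_fun_subset[OF g]) blast
      show "smooth_fun M ?T (\<lambda>q. \<psi> (F q) b)" if "b \<in> idx N" for b
        by (rule smooth_fun_subset[of M "{p \<in> W. F p \<in> U}"])
          (use F U(1) that in \<open>auto simp: smooth_map_on_def\<close>)
    qed auto
    then have "smooth_fun M ?T (\<lambda>p. g (F p))"
      by (rule smooth_fun_cong[OF M op[OF Z]]) (use inv_into_f_f[OF coords_onD(3)[OF c]] in auto)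
    then show "\<exists>W'. openin (mtop M) W' \<and> p \<in> W' \<and> smooth_fun M W' (\<lambda>p. g (F p))"
      using op[OF Z] p U(2) by blast
  qed
  then show ?thesis using op[OF V] by blast
qed

lemma submanifold_restrict:
  assumes S: "embedded_submanifold S M" and M: "charted_mfd M" and W: "openin (mtop M) W" and f: "smooth_fun M W f"
  shows "openin (mtop S) (W \<inter> carr S)" "smooth_fun S (W \<inter> carr S) f"
proof -
  have "charted_mfd S" using S smooth_manifold_charted by (auto simp: embedded_submanifold_def)
  moreover have "smooth_map_on S (carr S) M (\<lambda>x. x)" using S by (simp add: embedded_submanifold_def)
  moreover have "{p \<in> carr S. p \<in> W} = W \<inter> carr S" by blast
  ultimately show "openin (mtop S) (W \<inter> carr S)" "smooth_fun S (W \<inter> carr S) f"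
    using smooth_map_on_pullback[of S M "carr S" "\<lambda>x. x" W f] M W f by auto
qed

lemma submanifold_smooth_near:
  assumes S: "embedded_submanifold S M" and M: "charted_mfd M" and p: "p \<in> carr S" and f: "smooth_near M p f"
  shows "smooth_near S p f"
proof -
  obtain W where W: "openin (mtop M) W" "p \<in> W" "smooth_fun M W f" using f by (rule smooth_nearE)
  show ?thesis
    by (rule smooth_nearI[of S "W \<inter> carr S"]) (use submanifold_restrict[OF S M W(1,3)] W p in auto)
qed

lemma inclusion_tangent_map:
  "tangent_map M (\<lambda>x. x) p v = (\<lambda>g. if smooth_near M p g then v g else 0)"
  unfolding tangent_map_def o_def by simp

lemma inclusion_tangent:
  assumes S: "embedded_submanifold S M" and M: "charted_mfd M" and p: "p \<in> carr S" and v: "v \<in> tangent_space S p"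
  shows "tangent_map M (\<lambda>x. x) p v \<in> tangent_space M p"
  using v submanifold_smooth_near[OF S M p] smooth_near_lincomb[OF M] smooth_near_mult[OF M]
  unfolding inclusion_tangent_map tangent_space_def by simp

lemma sub_tangent_space_lincomb:
  assumes "v \<in> sub_tangent_space S M p" "w \<in> sub_tangent_space S M p"
  shows "(\<lambda>f. a * v f + b * w f) \<in> sub_tangent_space S M p"
proof -
  obtain v' w' where v': "v' \<in> tangent_space S p" "v = tangent_map M (\<lambda>x. x) p v'"
    and w': "w' \<in> tangent_space S p" "w = tangent_map M (\<lambda>x. x) p w'"
    using assms unfolding sub_tangent_space_def by blast
  have "(\<lambda>f. a * v f + b * w f) = tangent_map M (\<lambda>x. x) p (\<lambda>f. a * v' f + b * w' f)"
    unfolding v'(2) w'(2) inclusion_tangent_map by auto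
  then show ?thesis unfolding sub_tangent_space_def using tangent_space_lincomb[OF v'(1) w'(1)] by blast
qed

lemma sub_tangent_space_subspace: "tsubspace (sub_tangent_space S M p)"
proof -
  have "tangent_map M (\<lambda>x. x) p tzero = tzero" by (auto simp: inclusion_tangent_map tzero_def)
  then have "tzero \<in> sub_tangent_space S M p"
    unfolding sub_tangent_space_def using tzero_in_tangent_space by (metis imageI)
  then show ?thesis unfolding tsubspace_def by (intro conjI ballI allI sub_tangent_space_lincomb)
qed

section \<open>Iterated partial derivatives\<close>

abbreviation add_index :: "(nat \<Rightarrow> nat) \<Rightarrow> nat \<Rightarrow> nat \<Rightarrow> nat" where
  "add_index I i \<equiv> I(i := Suc (I i))"

lemma copen_coord_space: "copen A (coord_space A)"
  by simp

lemma funpow_pd_cong: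
  assumes "copen {..<n::nat} X" "k < n" "\<forall>x\<in>X. f x = g x" "x \<in> X"
  shows "(pd k ^^ a) f x = (pd k ^^ a) g x"
  using assms(4)
proof (induction a arbitrary: x)
  case (Suc a)
  show ?case unfolding funpow.simps o_def
    by (rule pd_cong[OF _ assms(1) _ Suc.prems]) (use Suc.IH assms(2) in auto)
qed (use assms in auto)

lemma C_inf_funpow_pd: "C_inf A X f \<Longrightarrow> k \<in> A \<Longrightarrow> C_inf A X ((pd k ^^ a) f)"
  by (induction a) (auto intro: C_inf_pd)

lemma mpd_cong:
  assumes "copen {..<n::nat} X"
  shows "k \<le> n \<Longrightarrow> \<forall>x\<in>X. f x = g x \<Longrightarrow> x \<in> X \<Longrightarrow> mpd k I f x = mpd k I g x"
proof (induction k arbitrary: f g)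
  case (Suc k)
  have "\<forall>x\<in>X. (pd k ^^ I k) f x = (pd k ^^ I k) g x"
    using funpow_pd_cong[OF assms, of k f g] Suc.prems by auto
  then show ?case using Suc.IH[of "(pd k ^^ I k) f" "(pd k ^^ I k) g"] Suc.prems by simp
qed auto

lemma C_inf_mpd: "k \<le> n \<Longrightarrow> C_inf {..<n} X f \<Longrightarrow> C_inf {..<n} X (mpd k I f)"
proof (induction k arbitrary: f)
  case (Suc k)
  then show ?case unfolding mpd.simps by (intro Suc.IH C_inf_funpow_pd) auto
qed simp

lemma mpd_index_cong: "(\<And>i. i < k \<Longrightarrow> I i = J i) \<Longrightarrow> mpd k I f = mpd k J f"
  by (induction k arbitrary: f) auto

lemma mpd_zero: "mpd k (\<lambda>_. 0) f = f"
  by (induction k arbitrary: f) auto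

lemma pd_funpow_commute:
  assumes X: "copen {..<n::nat} X" and f: "C_inf {..<n} X f" and ik: "i < n" "k < n"
  shows "x \<in> X \<Longrightarrow> pd i ((pd k ^^ a) f) x = (pd k ^^ a) (pd i f) x"
proof (induction a arbitrary: x)
  case (Suc a)
  have "pd i ((pd k ^^ Suc a) f) x = pd i (pd k ((pd k ^^ a) f)) x" by simp
  also have "\<dots> = pd k (pd i ((pd k ^^ a) f)) x"
    by (rule pd_commute[OF _ X C_infD[OF C_inf_funpow_pd[OF f]] _ _ Suc.prems]) (use ik in auto)
  also have "\<dots> = pd k ((pd k ^^ a) (pd i f)) x"
    by (rule pd_cong[OF _ X _ Suc.prems]) (use Suc.IH ik in auto)
  finally show ?case by simp
qed simp

lemma pd_mpd_commute:
  assumes X: "copen {..<n::nat} X" and i: "i < n"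
  shows "k \<le> n \<Longrightarrow> C_inf {..<n} X f \<Longrightarrow> x \<in> X \<Longrightarrow> pd i (mpd k I f) x = mpd k I (pd i f) x"
proof (induction k arbitrary: f)
  case (Suc k)
  have "pd i (mpd (Suc k) I f) x = mpd k I (pd i ((pd k ^^ I k) f)) x"
    using Suc.IH[OF _ C_inf_funpow_pd[OF Suc.prems(2)]] Suc.prems by simp
  also have "\<dots> = mpd k I ((pd k ^^ I k) (pd i f)) x"
    by (rule mpd_cong[OF X _ _ Suc.prems(3)])
      (use pd_funpow_commute[OF X Suc.prems(2) i] Suc.prems(1) in auto)
  finally show ?case by simp
qed simp

text \<open>The iterated derivative \<^const>\<open>mpd\<close> takes the variables in a fixed order, so a further derivative
  has to be moved to its place.\<close>

lemma mpd_pd: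
  assumes X: "copen {..<n::nat} X"
  shows "k \<le> n \<Longrightarrow> i < k \<Longrightarrow> C_inf {..<n} X f \<Longrightarrow> x \<in> X \<Longrightarrow> mpd k I (pd i f) x = mpd k (add_index I i) f x"
proof (induction k arbitrary: f)
  case (Suc k)
  show ?case
  proof (cases "i = k")
    case True
    have "mpd k I ((pd k ^^ Suc (I k)) f) = mpd k (add_index I k) ((pd k ^^ Suc (I k)) f)"
      by (rule mpd_index_cong) auto
    then show ?thesis unfolding True mpd.simps fun_upd_same funpow.simps o_def funpow_swap1 by (rule fun_cong)
  next
    case False
    have "mpd (Suc k) I (pd i f) x = mpd k I (pd i ((pd k ^^ I k) f)) x"
      using mpd_cong[OF X, of k "(pd k ^^ I k) (pd i f)" "pd i ((pd k ^^ I k) f)" x I]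
        pd_funpow_commute[OF X Suc.prems(3), of i k] Suc.prems by simp
    also have "\<dots> = mpd k (add_index I i) ((pd k ^^ I k) f) x"
      by (rule Suc.IH) (use False Suc.prems in \<open>auto intro: C_inf_funpow_pd\<close>)
    finally show ?thesis using False by (simp del: fun_upd_apply add: fun_upd_other)
  qed
qed simp

lemma pd_mpd:
  assumes "copen {..<n::nat} X" "i < n" "C_inf {..<n} X f" "x \<in> X"
  shows "pd i (mpd n I f) x = mpd n (add_index I i) f x"
  using pd_mpd_commute[OF assms(1,2) order.refl assms(3,4)] mpd_pd[OF assms(1) order.refl assms(2-4)] by simp

subsection \<open>Multi-indices\<close>

lemma finite_multi_indices: "finite (multi_indices n r)"
proof (rule finite_subset)
  show "multi_indices n r \<subseteq> {f. \<forall>x. (x \<in> {..<n} \<longrightarrow> f x \<in> {..r}) \<and> (x \<notin> {..<n} \<longrightarrow> f x = 0)}"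
  proof (intro subsetI CollectI allI conjI impI)
    fix I x assume I: "I \<in> multi_indices n r" and x: "x \<in> {..<n}"
    have "I x \<le> (\<Sum>i<n. I i)" using x by (intro member_le_sum) auto
    then show "I x \<in> {..r}" using I by (auto simp: multi_indices_def)
  qed (auto simp: multi_indices_def)
  show "finite {f. \<forall>x. (x \<in> {..<n} \<longrightarrow> f x \<in> {..r}) \<and> (x \<notin> {..<n} \<longrightarrow> f x = (0::nat))}"
    by (rule finite_set_of_finite_funs) auto
qed

lemma sum_add_index: "i < n \<Longrightarrow> (\<Sum>j<n. add_index I i j) = Suc (\<Sum>j<n. I j)"
proof -
  assume i: "i < n"
  have "(\<Sum>j<n. add_index I i j) = (\<Sum>j<n. I j + (if j = i then 1 else 0))"
    by (rule sum.cong) auto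
  then show ?thesis using i by (simp add: sum.distrib)
qed

lemma add_index_multi_indices: "I \<in> multi_indices n r \<Longrightarrow> i < n \<Longrightarrow> add_index I i \<in> multi_indices n (Suc r)"
  using sum_add_index[of i n I] by (auto simp: multi_indices_def)

lemma multi_indices_mono: "r \<le> s \<Longrightarrow> multi_indices n r \<subseteq> multi_indices n s"
  by (auto simp: multi_indices_def)

lemma zero_multi_index: "(\<lambda>_. 0) \<in> multi_indices n r"
  by (simp add: multi_indices_def)

lemma multi_index_zero: "\<forall>i\<ge>n::nat. I i = 0 \<Longrightarrow> (\<Sum>i<n. I i) = 0 \<Longrightarrow> I = (\<lambda>_. (0::nat))"
proof
  fix i assume *: "\<forall>i\<ge>n. I i = 0" "(\<Sum>i<n. I i) = 0"
  show "I i = 0"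
  proof (cases "i < n")
    case True
    then show ?thesis using *(2) by simp
  qed (use *(1) in simp)
qed

lemma multi_index_SucE:
  assumes "\<forall>i\<ge>n. I i = 0" "(\<Sum>i<n. I i) = Suc k"
  obtains i J where "i < n" "\<forall>i\<ge>n. J i = 0" "(\<Sum>i<n. J i) = k" "I = add_index J i"
proof -
  have "\<exists>i<n. I i \<noteq> 0"
  proof (rule ccontr)
    assume "\<not> (\<exists>i<n. I i \<noteq> 0)"
    then have "(\<Sum>i<n. I i) = 0" by simp
    then show False using assms(2) by simp
  qed
  then obtain i where i: "i < n" "I i \<noteq> 0" by blast
  define J where "J = I(i := I i - 1)"
  have I: "I = add_index J i" using i by (auto simp: J_def)
  have "(\<Sum>i<n. J i) = k" using sum_add_index[OF i(1), of J] assms(2) I by simp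
  then show ?thesis using that[OF i(1) _ _ I] assms(1) i by (auto simp: J_def)
qed

subsection \<open>Taylor monomials\<close>

definition taylor_monomial :: "nat \<Rightarrow> (nat \<Rightarrow> real) \<Rightarrow> (nat \<Rightarrow> nat) \<Rightarrow> (nat \<Rightarrow> real) \<Rightarrow> real" where
  "taylor_monomial n x I y = (\<Prod>i<n. (y i - x i) ^ I i / fact (I i))"

lemma C_inf_taylor_monomial:
  assumes A: "finite A" "copen A X"
  shows "C_inf A X (taylor_monomial n x I)"
proof -
  have pw: "C_inf A X (\<lambda>y. (y i + (- x i)) ^ a)" for i a
    by (induction a)
      (simp_all add: C_inf_const[OF A] C_inf_mult[OF A] C_inf_add[OF A C_inf_coord[OF A] C_inf_const[OF A], of i "- x i", simplified])
  have "C_inf A X (\<lambda>y. \<Prod>i<n. inverse (fact (I i)) * (y i + (- x i)) ^ I i)"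
  proof (induction n)
    case (Suc n)
    have "C_inf A X (\<lambda>y. (\<Prod>i<n. inverse (fact (I i)) * (y i + (- x i)) ^ I i) * (inverse (fact (I n)) * (y n + (- x n)) ^ I n))"
      by (rule C_inf_mult[OF A Suc C_inf_mult[OF A C_inf_const[OF A] pw]])
    then show ?case by simp
  qed (simp add: C_inf_const[OF A])
  moreover have "(\<lambda>y. \<Prod>i<n. inverse (fact (I i)) * (y i + (- x i)) ^ I i) = taylor_monomial n x I"
    by (auto simp: taylor_monomial_def divide_inverse mult.commute)
  ultimately show ?thesis by simp
qed

lemma pd_taylor_monomial:
  assumes k: "k < n"
  shows "pd k (taylor_monomial n x I) =
    (\<lambda>y. if I k = 0 then 0 else taylor_monomial n x (I(k := I k - 1)) y)"
proof
  fix y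
  define R where "R = (\<Prod>i\<in>{..<n} - {k}. (y i - x i) ^ I i / fact (I i))"
  have split: "taylor_monomial n x J (y(k := t)) = (t - x k) ^ J k / fact (J k) * R"
    if "\<And>i. i \<noteq> k \<Longrightarrow> J i = I i" for J t
  proof -
    have "taylor_monomial n x J (y(k := t)) = ((y(k := t)) k - x k) ^ J k / fact (J k) *
        (\<Prod>i\<in>{..<n} - {k}. ((y(k := t)) i - x i) ^ J i / fact (J i))"
      unfolding taylor_monomial_def by (rule prod.remove) (use k in auto)
    also have "(\<Prod>i\<in>{..<n} - {k}. ((y(k := t)) i - x i) ^ J i / fact (J i)) = R"
      unfolding R_def by (rule prod.cong) (use that in auto)
    finally show ?thesis unfolding fun_upd_same .
  qed
  show "pd k (taylor_monomial n x I) y = (if I k = 0 then 0 else taylor_monomial n x (I(k := I k - 1)) y)"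
  proof (cases "I k")
    case 0
    have "has_pd k (taylor_monomial n x I) y 0"
      by (subst split) (use 0 in auto)
    then show ?thesis using 0 has_pd_imp_pd by simp
  next
    case (Suc a)
    have *: "real (Suc a) / fact (Suc a) = 1 / fact a"
      by (simp add: divide_simps)
    have "((\<lambda>t. t - x k) has_real_derivative 1) (at (y k))" by (auto intro!: derivative_eq_intros)
    then have "((\<lambda>t. (t - x k) ^ Suc a) has_real_derivative real (Suc a) * (y k - x k) ^ a) (at (y k))"
      by (rule DERIV_cong[OF DERIV_power_Suc]) simp
    then have "((\<lambda>t. (t - x k) ^ Suc a * (R / fact (Suc a))) has_real_derivative
        real (Suc a) * (y k - x k) ^ a * (R / fact (Suc a))) (at (y k))"
      by (rule DERIV_cmult_right)
    moreover have "real (Suc a) * (y k - x k) ^ a * (R / fact (Suc a)) = (y k - x k) ^ a / fact a * R"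
      using * by (simp add: field_simps del: of_nat_Suc fact_Suc)
    moreover have "(\<lambda>t. (t - x k) ^ Suc a * (R / fact (Suc a))) = (\<lambda>t. taylor_monomial n x I (y(k := t)))"
      using split[of I] Suc by (auto simp: field_simps)
    moreover have "(y k - x k) ^ a / fact a * R = taylor_monomial n x (I(k := I k - 1)) y"
      using split[of "I(k := I k - 1)" "y k"] Suc by simp
    ultimately have "has_pd k (taylor_monomial n x I) y (taylor_monomial n x (I(k := I k - 1)) y)" by metis
    then show ?thesis using Suc has_pd_imp_pd by simp
  qed
qed

lemma pd_zero_fun: "pd k (\<lambda>_. 0) = (\<lambda>_. 0)"
  by (auto simp: pd_def)

lemma funpow_pd_taylor_monomial:
  assumes k: "k < n"
  shows "(pd k ^^ a) (taylor_monomial n x I) =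
    (if a \<le> I k then taylor_monomial n x (I(k := I k - a)) else (\<lambda>_. 0))"
proof (induction a)
  case (Suc a)
  show ?case
  proof (cases "a \<le> I k")
    case True
    then have "(pd k ^^ Suc a) (taylor_monomial n x I) = pd k (taylor_monomial n x (I(k := I k - a)))"
      using Suc by simp
    then show ?thesis unfolding pd_taylor_monomial[OF k] using True
      by (auto simp: fun_eq_iff diff_Suc Suc_diff_le split: nat.splits)
  next
    case False
    then show ?thesis using Suc by (simp add: pd_zero_fun)
  qed
qed auto

lemma mpd_zero_fun: "mpd k J (\<lambda>_. 0) = (\<lambda>_. 0)"
proof (induction k)
  case (Suc k)
  have "(pd k ^^ a) (\<lambda>_. 0) = (\<lambda>_. 0)" for a by (induction a) (auto simp: pd_zero_fun)
  then show ?case using Suc by simp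
qed simp

lemma mpd_taylor_monomial:
  "k \<le> n \<Longrightarrow> mpd k J (taylor_monomial n x I) =
    (if \<forall>i<k. J i \<le> I i then taylor_monomial n x (\<lambda>i. if i < k then I i - J i else I i) else (\<lambda>_. 0))"
proof (induction k arbitrary: I)
  case (Suc k)
  have k: "k < n" using Suc by simp
  show ?case
  proof (cases "J k \<le> I k")
    case True
    have "mpd (Suc k) J (taylor_monomial n x I) = mpd k J (taylor_monomial n x (I(k := I k - J k)))"
      using True funpow_pd_taylor_monomial[OF k] by simp
    also have "\<dots> = (if \<forall>i<k. J i \<le> (I(k := I k - J k)) i
        then taylor_monomial n x (\<lambda>i. if i < k then (I(k := I k - J k)) i - J i else (I(k := I k - J k)) i) else (\<lambda>_. 0))"
      using Suc by simp
    also have "(\<lambda>i. if i < k then (I(k := I k - J k)) i - J i else (I(k := I k - J k)) i)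
        = (\<lambda>i. if i < Suc k then I i - J i else I i)" by (auto simp: less_Suc_eq)
    also have "(\<forall>i<k. J i \<le> (I(k := I k - J k)) i) \<longleftrightarrow> (\<forall>i<Suc k. J i \<le> I i)"
      using True by (auto simp: less_Suc_eq)
    finally show ?thesis .
  next
    case False
    then have *: "(\<forall>i<Suc k. J i \<le> I i) = False" by auto
    have "mpd (Suc k) J (taylor_monomial n x I) = (\<lambda>_. 0)"
      using False funpow_pd_taylor_monomial[OF k, of "J k" x I] mpd_zero_fun[of k J] by simp
    then show ?thesis unfolding * by simp
  qed
qed simp

lemma taylor_monomial_centre: "taylor_monomial n x I x = (if \<forall>i<n. I i = 0 then 1 else 0)"
proof (cases "\<forall>i<n. I i = 0")
  case False
  then obtain i where "i < n" "I i \<noteq> 0" by blast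
  then have "(x i - x i) ^ I i / fact (I i) = 0" by simp
  then show ?thesis using \<open>i < n\<close> False unfolding taylor_monomial_def
    by (auto intro!: bexI[of _ i])
qed (simp add: taylor_monomial_def)

lemma mpd_taylor_monomial_centre:
  assumes "\<forall>i\<ge>n. I i = 0" "\<forall>i\<ge>n. J i = 0"
  shows "mpd n J (taylor_monomial n x I) x = (if I = J then 1 else 0)"
proof -
  have "(I = J) \<longleftrightarrow> (\<forall>i<n. I i = J i)" using assms by (metis ext linorder_not_less)
  then show ?thesis using mpd_taylor_monomial[of n n J x I]
    by (auto simp: taylor_monomial_centre dest: order.antisym)
qed

lemma pd_sum_scaled:
  assumes "finite A" "copen A X" "\<And>b. b \<in> B \<Longrightarrow> C_inf A X (f b)" "x \<in> X" "i \<in> A"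
  shows "pd i (\<lambda>y. \<Sum>b\<in>B. c b * f b y) x = (\<Sum>b\<in>B. c b * pd i (f b) x)"
  by (rule has_pd_imp_pd, rule DERIV_sum, rule DERIV_cmult, rule C_inf_has_pd[OF assms(3) assms(4,5)])

lemma mpd_sum_scaled:
  assumes X: "copen {..<n::nat} X"
  shows "k \<le> n \<Longrightarrow> (\<And>b. b \<in> B \<Longrightarrow> C_inf {..<n} X (f b)) \<Longrightarrow> x \<in> X \<Longrightarrow>
    mpd k J (\<lambda>y. \<Sum>b\<in>B. c b * f b y) x = (\<Sum>b\<in>B. c b * mpd k J (f b) x)"
proof (induction k arbitrary: f)
  case (Suc k)
  have *: "(pd k ^^ a) (\<lambda>y. \<Sum>b\<in>B. c b * f b y) x = (\<Sum>b\<in>B. c b * (pd k ^^ a) (f b) x)" if "x \<in> X" for a x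
    using that
  proof (induction a arbitrary: x)
    case (Suc a)
    have "(pd k ^^ Suc a) (\<lambda>y. \<Sum>b\<in>B. c b * f b y) x = pd k (\<lambda>y. \<Sum>b\<in>B. c b * (pd k ^^ a) (f b) y) x"
      unfolding funpow.simps o_def
      by (rule pd_cong[OF _ X _ Suc.prems]) (use Suc.IH \<open>Suc k \<le> n\<close> in auto)
    also have "\<dots> = (\<Sum>b\<in>B. c b * pd k ((pd k ^^ a) (f b)) x)"
      by (rule pd_sum_scaled[OF _ X _ Suc.prems])
        (use \<open>Suc k \<le> n\<close> \<open>\<And>b. b \<in> B \<Longrightarrow> C_inf {..<n} X (f b)\<close> in \<open>auto intro: C_inf_funpow_pd\<close>)
    finally show ?case by simp
  qed simp
  have "mpd (Suc k) J (\<lambda>y. \<Sum>b\<in>B. c b * f b y) x = mpd k J (\<lambda>y. \<Sum>b\<in>B. c b * (pd k ^^ J k) (f b) y) x"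
    unfolding mpd.simps by (rule mpd_cong[OF X _ _ Suc.prems(3)]) (use * Suc.prems in auto)
  also have "\<dots> = (\<Sum>b\<in>B. c b * mpd k J ((pd k ^^ J k) (f b)) x)"
    by (rule Suc.IH) (use Suc.prems in \<open>auto intro: C_inf_funpow_pd\<close>)
  finally show ?case by simp
qed simp

lemma taylor_polynomial_derivatives:
  assumes J: "J \<in> multi_indices n r" and x: "x \<in> coord_space {..<n}"
  shows "mpd n J (\<lambda>y. \<Sum>I\<in>multi_indices n r. c I * taylor_monomial n x I y) x = c J"
proof -
  have "mpd n J (\<lambda>y. \<Sum>I\<in>multi_indices n r. c I * taylor_monomial n x I y) x
      = (\<Sum>I\<in>multi_indices n r. c I * mpd n J (taylor_monomial n x I) x)"
    by (rule mpd_sum_scaled[OF copen_coord_space order.refl C_inf_taylor_monomial x]) auto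
  also have "\<dots> = (\<Sum>I\<in>multi_indices n r. if I = J then c I else 0)"
    by (rule sum.cong) (use J mpd_taylor_monomial_centre in \<open>auto simp: multi_indices_def\<close>)
  finally show ?thesis using J finite_multi_indices by simp
qed

section \<open>Coordinates of jets\<close>

definition jet_vec ::
    "('e, 'q) fibration \<Rightarrow> ('e, 'q) fchart \<Rightarrow> nat \<Rightarrow> ('q \<Rightarrow> 'e) \<Rightarrow> 'q \<Rightarrow> jet_coord \<Rightarrow> real" where
  "jet_vec F c r \<sigma> x k = (if k \<notin> jet_idx F r then 0 else
     (case k of Base i \<Rightarrow> snd (snd c) x i | Deriv \<alpha> I \<Rightarrow> section_deriv F c \<alpha> I \<sigma> x))"

text \<open>The coordinates of the base point of a jet.\<close>

definition base_part :: "('e, 'q) fibration \<Rightarrow> (jet_coord \<Rightarrow> real) \<Rightarrow> nat \<Rightarrow> real" where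
  "base_part F z i = (if i < bdim F then z (Base i) else 0)"

text \<open>The coordinates, in a fibred chart of the total space, of the value of a section at the base
  point; the derivatives of order zero are the fibre coordinates.\<close>

definition total_part :: "('e, 'q) fibration \<Rightarrow> (jet_coord \<Rightarrow> real) \<Rightarrow> nat \<Rightarrow> real" where
  "total_part F z i = (if i < bdim F then z (Base i)
     else if i < bdim F + fdim F then z (Deriv (i - bdim F) (\<lambda>_. 0)) else 0)"

definition truncate_jet :: "('e, 'q) fibration \<Rightarrow> nat \<Rightarrow> (jet_coord \<Rightarrow> real) \<Rightarrow> jet_coord \<Rightarrow> real" where
  "truncate_jet F k z = (\<lambda>a. if a \<in> jet_idx F k then z a else 0)"

text \<open>The total derivative \<open>D\<^sub>l G\<close> of a function \<open>G\<close> of jets of order \<open>k\<close>; it is a function of jets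
  of order \<open>k + 1\<close>.\<close>

definition total_deriv ::
    "('e, 'q) fibration \<Rightarrow> nat \<Rightarrow> nat \<Rightarrow> ((jet_coord \<Rightarrow> real) \<Rightarrow> real) \<Rightarrow> (jet_coord \<Rightarrow> real) \<Rightarrow> real" where
  "total_deriv F k l G z = pd (Base l) G (truncate_jet F k z) +
     (\<Sum>(\<alpha>, I)\<in>{..<fdim F} \<times> multi_indices (bdim F) k.
        z (Deriv \<alpha> (add_index I l)) * pd (Deriv \<alpha> I) G (truncate_jet F k z))"

lemma Base_in_jet_idx: "Base i \<in> jet_idx F r \<longleftrightarrow> i < bdim F"
  by (auto simp: jet_idx_def)

lemma Deriv_in_jet_idx: "Deriv \<alpha> I \<in> jet_idx F r \<longleftrightarrow> \<alpha> < fdim F \<and> I \<in> multi_indices (bdim F) r"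
  by (auto simp: jet_idx_def)

lemma jet_idx_eq: "jet_idx F r = Base ` {..<bdim F} \<union>
    (\<lambda>(\<alpha>, I). Deriv \<alpha> I) ` ({..<fdim F} \<times> multi_indices (bdim F) r)"
  by (auto simp: jet_idx_def)

lemma finite_jet_idx: "finite (jet_idx F r)"
  unfolding jet_idx_eq using finite_multi_indices by auto

lemma sum_jet_idx: "(\<Sum>k\<in>jet_idx F r. f k) = (\<Sum>i<bdim F. f (Base i)) +
    (\<Sum>(\<alpha>, I)\<in>{..<fdim F} \<times> multi_indices (bdim F) r. f (Deriv \<alpha> I))"
proof -
  have "(\<Sum>k\<in>jet_idx F r. f k) = (\<Sum>k\<in>Base ` {..<bdim F}. f k) +
      (\<Sum>k\<in>(\<lambda>(\<alpha>, I). Deriv \<alpha> I) ` ({..<fdim F} \<times> multi_indices (bdim F) r). f k)"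
    unfolding jet_idx_eq by (rule sum.union_disjoint) (use finite_multi_indices in auto)
  also have "(\<Sum>k\<in>Base ` {..<bdim F}. f k) = (\<Sum>i<bdim F. f (Base i))"
    by (subst sum.reindex) (auto simp: inj_on_def)
  also have "(\<Sum>k\<in>(\<lambda>(\<alpha>, I). Deriv \<alpha> I) ` ({..<fdim F} \<times> multi_indices (bdim F) r). f k)
      = (\<Sum>(\<alpha>, I)\<in>{..<fdim F} \<times> multi_indices (bdim F) r. f (Deriv \<alpha> I))"
    by (subst sum.reindex) (auto simp: inj_on_def o_def split_beta)
  finally show ?thesis .
qed

lemma jet_idx_mono: "r \<le> s \<Longrightarrow> jet_idx F r \<subseteq> jet_idx F s"
  unfolding jet_idx_eq using multi_indices_mono by blast

lemma jet_vec_coord_space: "jet_vec F c r \<sigma> x \<in> coord_space (jet_idx F r)"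
  by (simp add: jet_vec_def coord_space_def)

lemma truncate_jet_vec: "k \<le> r \<Longrightarrow> truncate_jet F k (jet_vec F c r \<sigma> x) = jet_vec F c k \<sigma> x"
  using jet_idx_mono[of k r F] by (auto simp: truncate_jet_def jet_vec_def fun_eq_iff)

lemma truncate_coord_space: "truncate_jet F k z \<in> coord_space (jet_idx F k)"
  by (simp add: truncate_jet_def coord_space_def)

lemma total_part_truncate: "total_part F (truncate_jet F k z) = total_part F z"
  by (rule ext) (auto simp: total_part_def truncate_jet_def Base_in_jet_idx Deriv_in_jet_idx zero_multi_index)

lemma C_inf_truncate: "copen A X \<Longrightarrow> finite A \<Longrightarrow> C_inf A X (\<lambda>z. truncate_jet F k z a)"
  by (cases "a \<in> jet_idx F k") (auto simp: truncate_jet_def intro: C_inf_coord C_inf_const)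

lemma copen_preimage:
  fixes g :: "('i \<Rightarrow> real) \<Rightarrow> 'j \<Rightarrow> real"
  assumes "copen A Y" "copen B X"
    and "\<And>b. b \<in> B \<Longrightarrow> continuous_on Y (\<lambda>y. g y b)" "\<And>y. y \<in> Y \<Longrightarrow> g y \<in> coord_space B"
  shows "copen A {y \<in> Y. g y \<in> X}"
proof -
  obtain T where T: "open T" "X = coord_space B \<inter> T" using assms(2) unfolding openin_open by blast
  have "openin (top_of_set Y) (Y \<inter> g -` T)"
    by (rule continuous_openin_preimage_gen[OF continuous_on_into_coord_space[OF assms(3,4)] T(1)])
  moreover have "{y \<in> Y. g y \<in> X} = Y \<inter> g -` T" using T(2) assms(4) by auto
  ultimately show ?thesis using assms(1) openin_trans by metis
qed

locale fibred =
  fixes F :: "('e, 'q) fibration"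
  assumes F: "fibred_manifold F"
begin

abbreviation "n \<equiv> bdim F"
abbreviation "m \<equiv> fdim F"
abbreviation "E \<equiv> total F"
abbreviation "Q \<equiv> base F"

lemma E: "smooth_manifold E" "charted_mfd E" "idx E = {..<mdim E}"
  and Q: "smooth_manifold Q" "charted_mfd Q" "idx Q = {..<n}"
  using F smooth_manifold_charted unfolding fibred_manifold_def by blast+

lemma fchartD:
  assumes c: "((V, \<psi>), (U, \<phi>)) \<in> fcharts F"
  shows "coords_on E V \<psi> {..<mdim E}" "coords_on Q U \<phi> {..<n}" "\<And>e. e \<in> V \<Longrightarrow> prj F e \<in> U" "U = prj F ` V"
    "\<And>e i. e \<in> V \<Longrightarrow> i < n \<Longrightarrow> \<psi> e i = \<phi> (prj F e) i"
  using c charts_coords_on[OF E(1), of V \<psi>] charts_coords_on[OF Q(1), of U \<phi>] E(3) Q(3)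
  by (auto simp: fcharts_def)

text \<open>The fibre dimension is a truncated difference. If the total space had fewer coordinates than the
  base, then some base coordinate would vanish on a nonempty open set of the base.\<close>

lemma fchart_dim:
  assumes c: "((V, \<psi>), (U, \<phi>)) \<in> fcharts F" and e: "e \<in> V"
  shows "n + m = mdim E"
proof -
  have "n \<le> mdim E"
  proof (rule ccontr)
    define k where "k = mdim E"
    assume "\<not> n \<le> mdim E"
    then have k: "k < n" by (simp add: k_def)
    have zero: "\<phi> x k = 0" if xU: "x \<in> U" for x
    proof -
      obtain e where e: "e \<in> V" "x = prj F e" using xU fchartD(4)[OF c] by blast
      have "\<psi> e k = 0" using coords_on_in_coord_space[OF fchartD(1)[OF c] e(1)] by (auto simp: coord_space_def k_def)
      then show ?thesis using fchartD(5)[OF c e(1) k] e(2) by simp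
    qed
    note cU = fchartD(2)[OF c]
    have x: "prj F e \<in> U" by (rule fchartD(3)[OF c e])
    obtain d where d: "d > 0" "cube {..<n} (\<phi> (prj F e)) d \<subseteq> \<phi> ` U"
      using copen_contains_cube[OF coords_onD(1)[OF cU] coords_onD(4)[OF cU coords_onD(2)[OF cU] order.refl] imageI[OF x]] .
    have "(\<phi> (prj F e))(k := d / 2) \<in> cube {..<n} (\<phi> (prj F e)) d"
      using coords_on_in_coord_space[OF cU x] k d(1) zero[OF x] by (auto simp: cube_def coord_space_def)
    then obtain x' where "x' \<in> U" "(\<phi> (prj F e))(k := d / 2) = \<phi> x'" using d(2) by blast
    then have "\<phi> x' k = d / 2" by (metis fun_upd_same)
    then show False using zero[OF \<open>x' \<in> U\<close>] d(1) by simp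
  qed
  then show ?thesis by (simp add: fdim_def)
qed

subsection \<open>Sections in charts\<close>

lemma local_sectionD:
  assumes "local_section F U0 \<sigma>"
  shows "openin (mtop Q) U0" "smooth_map_on Q U0 E \<sigma>" "\<And>x. x \<in> U0 \<Longrightarrow> prj F (\<sigma> x) = x"
  using assms by (auto simp: local_section_def)

text \<open>A single neighbourhood of \<open>x\<close> is needed that works in two fibred charts at once, whence the
  statement for all charts around the open set \<open>G\<close>.\<close>

lemma section_nhd:
  assumes s: "section_near F x \<sigma>" and G: "openin (mtop E) G" "\<sigma> x \<in> G"
  obtains N where "openin (mtop Q) N" "x \<in> N" "\<And>x'. x' \<in> N \<Longrightarrow> section_near F x' \<sigma>"
    "\<And>x'. x' \<in> N \<Longrightarrow> \<sigma> x' \<in> G" "\<And>x'. x' \<in> N \<Longrightarrow> prj F (\<sigma> x') = x'"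
    "\<And>V \<psi> U \<phi>. ((V, \<psi>), (U, \<phi>)) \<in> fcharts F \<Longrightarrow> G \<subseteq> V \<Longrightarrow> N \<subseteq> U"
    "\<And>V \<psi> U \<phi> k. ((V, \<psi>), (U, \<phi>)) \<in> fcharts F \<Longrightarrow> G \<subseteq> V \<Longrightarrow> k < mdim E \<Longrightarrow>
      C_inf {..<n} (\<phi> ` N) (\<lambda>y. \<psi> (\<sigma> (inv_into U \<phi> y)) k)"
proof -
  obtain U0 where U0: "x \<in> U0" "local_section F U0 \<sigma>" using s by (auto simp: section_near_def)
  note ls = local_sectionD[OF U0(2)]
  define N where "N = {x \<in> U0. \<sigma> x \<in> G}"
  have N: "openin (mtop Q) N"
    using smooth_map_on_pullback[OF Q(2) E(2) ls(1,2) G(1) smooth_fun_const[OF E(2) G(1), of 0]] by (simp add: N_def)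
  have NU: "N \<subseteq> U" if "((V, \<psi>), (U, \<phi>)) \<in> fcharts F" "G \<subseteq> V" for V \<psi> U \<phi>
  proof
    fix x assume "x \<in> N"
    then show "x \<in> U" using fchartD(3)[OF that(1), of "\<sigma> x"] that(2) ls(3) by (auto simp: N_def)
  qed
  have "C_inf {..<n} (\<phi> ` N) (\<lambda>y. \<psi> (\<sigma> (inv_into U \<phi> y)) k)"
    if c: "((V, \<psi>), (U, \<phi>)) \<in> fcharts F" and "G \<subseteq> V" and k: "k < mdim E" for V \<psi> U \<phi> k
  proof -
    have "smooth_fun E V (\<lambda>e. \<psi> e k)" by (rule coords_onD(6)[OF fchartD(1)[OF c]]) (use k in simp)
    then have "smooth_fun E G (\<lambda>e. \<psi> e k)" using smooth_fun_subset \<open>G \<subseteq> V\<close> by blast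
    then have "smooth_fun Q N (\<lambda>x. \<psi> (\<sigma> x) k)"
      using smooth_map_on_pullback[OF Q(2) E(2) ls(1,2) G(1), of "\<lambda>e. \<psi> e k"] by (simp add: N_def)
    from coords_onD(7)[OF fchartD(2)[OF c] N NU[OF c \<open>G \<subseteq> V\<close>] this] show ?thesis by (simp add: o_def)
  qed
  then show ?thesis
    by (intro that[OF N _ _ _ _ NU]) (use U0 G ls(3) in \<open>auto simp: N_def section_near_def\<close>)
qed

lemma smooth_map_on_coordsI:
  assumes N: "openin (mtop Q) N" and c: "coords_on E V \<psi> B" and \<sigma>: "\<And>x. x \<in> N \<Longrightarrow> \<sigma> x \<in> V"
    and sm: "\<And>b. b \<in> B \<Longrightarrow> smooth_fun Q N (\<lambda>x. \<psi> (\<sigma> x) b)"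
  shows "smooth_map_on Q N E \<sigma>"
proof -
  have op: "openin (mtop Q) {x \<in> N. \<sigma> x \<in> Z}" if Z: "openin (mtop E) Z" for Z
  proof -
    have ZV: "openin (mtop E) (V \<inter> Z)" using coords_onD(2)[OF c] Z by blast
    have "openin (mtop Q) {x \<in> N. \<psi> (\<sigma> x) \<in> \<psi> ` (V \<inter> Z)}"
      by (rule smooth_fun_preimage_open[OF Q(2) N coords_onD(4)[OF c ZV] sm])
        (use coords_on_in_coord_space[OF c \<sigma>] in auto)
    moreover have "{x \<in> N. \<psi> (\<sigma> x) \<in> \<psi> ` (V \<inter> Z)} = {x \<in> N. \<sigma> x \<in> Z}"
      using \<sigma> by (auto dest: inj_onD[OF coords_onD(3)[OF c]])
    ultimately show ?thesis by simp
  qed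
  have ts: "topspace (subtopology (mtop Q) N) = N" using openin_subset[OF N] by auto
  have "continuous_map (subtopology (mtop Q) N) (mtop E) \<sigma>"
    unfolding continuous_map_def ts
  proof (intro conjI allI impI)
    show "\<sigma> \<in> N \<rightarrow> carr E" using \<sigma> openin_subset[OF coords_onD(2)[OF c]] by blast
    fix Z assume "openin (mtop E) Z"
    then show "openin (subtopology (mtop Q) N) {x \<in> N. \<sigma> x \<in> Z}"
      using op N by (subst openin_open_subtopology) auto
  qed
  moreover have "smooth_fun Q {x \<in> N. \<sigma> x \<in> V'} (\<lambda>x. \<psi>' (\<sigma> x) j)"
    if V': "(V', \<psi>') \<in> atlas E" and j: "j \<in> idx E" for V' \<psi>' j
  proof -
    have c': "coords_on E V' \<psi>' (idx E)" by (rule charted_mfd_atlas[OF E(2) V'])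
    have VV: "openin (mtop E) (V \<inter> V')" using coords_onD(2)[OF c] coords_onD(2)[OF c'] by blast
    have s: "smooth_fun E (V \<inter> V') (\<lambda>e. \<psi>' e j)" by (rule smooth_fun_subset[OF coords_onD(6)[OF c' j]]) blast
    have "smooth_fun Q {x \<in> N. \<sigma> x \<in> V'} (\<lambda>x. ((\<lambda>e. \<psi>' e j) \<circ> inv_into V \<psi>) (\<psi> (\<sigma> x)))"
      by (rule smooth_fun_compose[OF Q(2) op[OF coords_onD(2)[OF c']] coords_onD(1)[OF c]
          coords_onD(4)[OF c VV] coords_onD(7)[OF c VV _ s]])
        (use \<sigma> smooth_fun_subset[OF sm] in auto)
    then show ?thesis
      by (rule smooth_fun_cong[OF Q(2) op[OF coords_onD(2)[OF c']]])
        (use \<sigma> inv_into_f_f[OF coords_onD(3)[OF c]] in auto)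
  qed
  ultimately show ?thesis unfolding smooth_map_on_def by blast
qed

text \<open>A map into the total space that is the graph of smooth functions \<open>s\<close> in a fibred chart is a
  section, because the first \<open>n\<close> coordinates of that chart come from the base.\<close>

lemma section_of_functions:
  assumes c: "((V, \<psi>), (U, \<phi>)) \<in> fcharts F" and X: "copen {..<n} X" "X \<subseteq> \<phi> ` U"
    and s: "\<And>\<alpha>. \<alpha> < m \<Longrightarrow> C_inf {..<n} X (s \<alpha>)"
    and w: "\<And>y. w y = (\<lambda>i. if i < n then y i else if i < n + m then s (i - n) y else 0)"
    and wV: "\<And>y. y \<in> X \<Longrightarrow> w y \<in> \<psi> ` V"
    and N: "N = {x \<in> U. \<phi> x \<in> X}" and \<sigma>: "\<And>x. \<sigma> x = inv_into V \<psi> (w (\<phi> x))"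
  shows "local_section F N \<sigma>" "\<And>x. x \<in> N \<Longrightarrow> \<sigma> x \<in> V \<and> \<psi> (\<sigma> x) = w (\<phi> x)"
proof -
  note cV = fchartD(1)[OF c] and cU = fchartD(2)[OF c]
  show \<sigma>V: "\<sigma> x \<in> V \<and> \<psi> (\<sigma> x) = w (\<phi> x)" if "x \<in> N" for x
    using wV[of "\<phi> x"] that by (auto simp: N \<sigma> inv_into_into f_inv_into_f)
  have No: "openin (mtop Q) N" unfolding N by (rule coords_onD(5)[OF cU X(1)])
  have NU: "N \<subseteq> U" using N by blast
  have "smooth_map_on Q N E \<sigma>"
  proof (rule smooth_map_on_coordsI[OF No cV])
    show "\<sigma> x \<in> V" if "x \<in> N" for x using \<sigma>V[OF that] by blast
    fix b
    have wb: "C_inf {..<n} X (\<lambda>y. w y b)"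
      unfolding w using s X(1) by (cases "b < n"; cases "b < n + m") (auto intro: C_inf_coord C_inf_const)
    have "smooth_fun Q N (\<lambda>x. w (\<phi> x) b)"
      by (rule smooth_fun_compose[OF Q(2) No finite_lessThan X(1) wb])
        (use smooth_fun_subset[OF coords_onD(6)[OF cU] NU] in \<open>auto simp: N\<close>)
    then show "smooth_fun Q N (\<lambda>x. \<psi> (\<sigma> x) b)"
      by (rule smooth_fun_cong[OF Q(2) No]) (use \<sigma>V in auto)
  qed
  moreover have "prj F (\<sigma> x) = x" if x: "x \<in> N" for x
  proof (rule inj_onD[OF coords_onD(3)[OF cU]])
    show "prj F (\<sigma> x) \<in> U" using fchartD(3)[OF c] \<sigma>V[OF x] by blast
    show "x \<in> U" using x NU by blast
    show "\<phi> (prj F (\<sigma> x)) = \<phi> x"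
    proof (rule coord_space_eqI[OF coords_on_in_coord_space[OF cU] coords_on_in_coord_space[OF cU]])
      fix i assume "i \<in> {..<n}"
      then show "\<phi> (prj F (\<sigma> x)) i = \<phi> x i"
        using fchartD(5)[OF c, of "\<sigma> x" i] \<sigma>V[OF x] by (simp add: w)
    qed fact+
  qed
  ultimately show "local_section F N \<sigma>" using No by (simp add: local_section_def)
qed

lemma total_part_jet_vec:
  assumes c: "((V, \<psi>), (U, \<phi>)) \<in> fcharts F" and s: "section_near F x \<sigma>" "\<sigma> x \<in> V"
  shows "total_part F (jet_vec F ((V, \<psi>), (U, \<phi>)) r \<sigma> x) = \<psi> (\<sigma> x)" "prj F (\<sigma> x) = x" "x \<in> U"
proof -
  show p: "prj F (\<sigma> x) = x" using s(1) by (auto simp: section_near_def local_section_def)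
  show xU: "x \<in> U" using fchartD(3)[OF c s(2)] p by simp
  have dim: "n + m = mdim E" by (rule fchart_dim[OF c s(2)])
  show "total_part F (jet_vec F ((V, \<psi>), (U, \<phi>)) r \<sigma> x) = \<psi> (\<sigma> x)"
  proof
    fix i
    consider "i < n" | "n \<le> i" "i < n + m" | "n + m \<le> i" by linarith
    then show "total_part F (jet_vec F ((V, \<psi>), (U, \<phi>)) r \<sigma> x) i = \<psi> (\<sigma> x) i"
    proof cases
      case 1
      then show ?thesis using fchartD(5)[OF c s(2)] p by (simp add: total_part_def jet_vec_def Base_in_jet_idx)
    next
      case 2
      then have "i - n < m" "n + (i - n) = i" by auto
      then show ?thesis using 2 inv_into_f_f[OF coords_onD(3)[OF fchartD(2)[OF c]] xU]
        by (simp add: total_part_def jet_vec_def Deriv_in_jet_idx zero_multi_index section_deriv_def mpd_zero)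
    next
      case 3
      then have "i \<notin> {..<mdim E}" using dim by auto
      then show ?thesis using 3 coords_on_in_coord_space[OF fchartD(1)[OF c] s(2)]
        by (simp add: total_part_def coord_space_def)
    qed
  qed
qed

lemma base_part_jet_vec:
  assumes c: "((V, \<psi>), (U, \<phi>)) \<in> fcharts F" and x: "x \<in> U"
  shows "base_part F (jet_vec F ((V, \<psi>), (U, \<phi>)) r \<sigma> x) = \<phi> x"
  using coords_on_in_coord_space[OF fchartD(2)[OF c] x]
  by (auto simp: base_part_def jet_vec_def Base_in_jet_idx coord_space_def)

lemma base_part_of_total:
  assumes c: "((V, \<psi>), (U, \<phi>)) \<in> fcharts F" and e: "e \<in> V" "total_part F z = \<psi> e"
  shows "base_part F z = \<phi> (prj F e)"
proof
  fix i show "base_part F z i = \<phi> (prj F e) i"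
  proof (cases "i < n")
    case True
    have "total_part F z i = \<phi> (prj F e) i" unfolding e(2) by (rule fchartD(5)[OF c e(1) True])
    then show ?thesis using True by (simp add: total_part_def base_part_def)
  next
    case False
    then show ?thesis using coords_on_in_coord_space[OF fchartD(2)[OF c] fchartD(3)[OF c e(1)]]
      by (simp add: base_part_def coord_space_def)
  qed
qed

subsection \<open>Differentiation along sections\<close>

lemma jet_vec_component:
  assumes c: "((V, \<psi>), (U, \<phi>)) \<in> fcharts F" and N: "openin (mtop Q) N" "N \<subseteq> U"
    and s: "\<And>\<alpha>. \<alpha> < m \<Longrightarrow> C_inf {..<n} (\<phi> ` N) (\<lambda>y. \<psi> (\<sigma> (inv_into U \<phi> y)) (n + \<alpha>))"
    and a: "a \<in> jet_idx F k"
  shows "C_inf {..<n} (\<phi> ` N) (\<lambda>y. jet_vec F ((V, \<psi>), (U, \<phi>)) k \<sigma> (inv_into U \<phi> y) a)"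
    "\<And>l x. x \<in> N \<Longrightarrow> l < n \<Longrightarrow> pd l (\<lambda>y. jet_vec F ((V, \<psi>), (U, \<phi>)) k \<sigma> (inv_into U \<phi> y) a) (\<phi> x) =
      (case a of Base i \<Rightarrow> if l = i then 1 else 0
       | Deriv \<alpha> I \<Rightarrow> jet_vec F ((V, \<psi>), (U, \<phi>)) (Suc k) \<sigma> x (Deriv \<alpha> (add_index I l)))"
proof -
  let ?c = "((V, \<psi>), (U, \<phi>))"
  note cU = fchartD(2)[OF c]
  have cop: "copen {..<n} (\<phi> ` N)" by (rule coords_onD(4)[OF cU N])
  have inv: "\<phi> (inv_into U \<phi> y) = y" if "y \<in> \<phi> ` N" for y using that N(2) by (auto simp: f_inv_into_f)
  have "C_inf {..<n} (\<phi> ` N) (\<lambda>y. jet_vec F ?c k \<sigma> (inv_into U \<phi> y) a) \<and>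
    (\<forall>x l. x \<in> N \<longrightarrow> l < n \<longrightarrow> pd l (\<lambda>y. jet_vec F ?c k \<sigma> (inv_into U \<phi> y) a) (\<phi> x) =
      (case a of Base i \<Rightarrow> if l = i then 1 else 0
       | Deriv \<alpha> I \<Rightarrow> jet_vec F ?c (Suc k) \<sigma> x (Deriv \<alpha> (add_index I l))))"
  proof (cases a)
    case (Base i)
    then have i: "i < n" using a Base_in_jet_idx by metis
    have eq: "\<forall>y\<in>\<phi> ` N. y i = jet_vec F ?c k \<sigma> (inv_into U \<phi> y) a"
      using inv a Base by (simp add: jet_vec_def)
    have "pd l (\<lambda>y. jet_vec F ?c k \<sigma> (inv_into U \<phi> y) a) (\<phi> x) = (if l = i then 1 else 0)"
      if "x \<in> N" "l < n" for x l
      using pd_cong[OF _ cop eq, of "\<phi> x" l] that by (simp add: pd_coord)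
    then show ?thesis using C_inf_cong[OF _ cop eq C_inf_coord[OF _ cop]] Base by simp
  next
    case (Deriv \<alpha> I)
    then have \<alpha>: "\<alpha> < m" and I: "I \<in> multi_indices n k" using a Deriv_in_jet_idx by metis+
    define f where "f = (\<lambda>y. \<psi> (\<sigma> (inv_into U \<phi> y)) (n + \<alpha>))"
    have f: "C_inf {..<n} (\<phi> ` N) f" unfolding f_def by (rule s[OF \<alpha>])
    have eq: "\<forall>y\<in>\<phi> ` N. mpd n I f y = jet_vec F ?c k \<sigma> (inv_into U \<phi> y) a"
      using inv a Deriv by (simp add: jet_vec_def section_deriv_def f_def)
    have "pd l (\<lambda>y. jet_vec F ?c k \<sigma> (inv_into U \<phi> y) a) (\<phi> x) = jet_vec F ?c (Suc k) \<sigma> x (Deriv \<alpha> (add_index I l))"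
      if x: "x \<in> N" and l: "l < n" for x l
    proof -
      have "pd l (\<lambda>y. jet_vec F ?c k \<sigma> (inv_into U \<phi> y) a) (\<phi> x) = pd l (mpd n I f) (\<phi> x)"
        using pd_cong[OF _ cop eq, of "\<phi> x" l] x l by simp
      also have "\<dots> = mpd n (add_index I l) f (\<phi> x)" by (rule pd_mpd[OF cop l f]) (use x in blast)
      finally show ?thesis using \<alpha> add_index_multi_indices[OF I l]
        by (simp add: jet_vec_def Deriv_in_jet_idx section_deriv_def f_def)
    qed
    then show ?thesis using C_inf_cong[OF _ cop eq C_inf_mpd[OF order.refl f]] Deriv by simp
  qed
  then show "C_inf {..<n} (\<phi> ` N) (\<lambda>y. jet_vec F ?c k \<sigma> (inv_into U \<phi> y) a)"
    "\<And>l x. x \<in> N \<Longrightarrow> l < n \<Longrightarrow> pd l (\<lambda>y. jet_vec F ?c k \<sigma> (inv_into U \<phi> y) a) (\<phi> x) =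
      (case a of Base i \<Rightarrow> if l = i then 1 else 0
       | Deriv \<alpha> I \<Rightarrow> jet_vec F ?c (Suc k) \<sigma> x (Deriv \<alpha> (add_index I l)))"
    by blast+
qed

text \<open>The total derivative is characterised by the fact that it computes the derivatives of functions
  of the jet of a section: by the chain rule, since differentiating \<open>\<partial>\<^sub>I s\<close> in direction \<open>l\<close> gives
  the derivative with index \<open>I + e\<^sub>l\<close>.\<close>

lemma pd_along_section:
  assumes c: "((V, \<psi>), (U, \<phi>)) \<in> fcharts F" and N: "openin (mtop Q) N" "N \<subseteq> U"
    and s: "\<And>\<alpha>. \<alpha> < m \<Longrightarrow> C_inf {..<n} (\<phi> ` N) (\<lambda>y. \<psi> (\<sigma> (inv_into U \<phi> y)) (n + \<alpha>))"
    and Z: "copen (jet_idx F k) Z" and G: "C_inf (jet_idx F k) Z G"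
    and jZ: "\<And>x. x \<in> N \<Longrightarrow> jet_vec F ((V, \<psi>), (U, \<phi>)) k \<sigma> x \<in> Z"
  shows "C_inf {..<n} (\<phi> ` N) (\<lambda>y. G (jet_vec F ((V, \<psi>), (U, \<phi>)) k \<sigma> (inv_into U \<phi> y)))"
    "\<And>l x. x \<in> N \<Longrightarrow> l < n \<Longrightarrow> pd l (\<lambda>y. G (jet_vec F ((V, \<psi>), (U, \<phi>)) k \<sigma> (inv_into U \<phi> y))) (\<phi> x) =
      total_deriv F k l G (jet_vec F ((V, \<psi>), (U, \<phi>)) (Suc k) \<sigma> x)"
proof -
  let ?c = "((V, \<psi>), (U, \<phi>))"
  let ?g = "\<lambda>y. jet_vec F ?c k \<sigma> (inv_into U \<phi> y)"
  note cU = fchartD(2)[OF c]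
  have cop: "copen {..<n} (\<phi> ` N)" by (rule coords_onD(4)[OF cU N])
  have inv: "inv_into U \<phi> (\<phi> x) = x" if "x \<in> N" for x
    using that N(2) by (auto intro: inv_into_f_f[OF coords_onD(3)[OF cU]])
  have gZ: "\<forall>y\<in>\<phi> ` N. ?g y \<in> Z" using jZ inv by auto
  note comp = jet_vec_component[OF c N s]
  show "C_inf {..<n} (\<phi> ` N) (\<lambda>y. G (?g y))"
    by (rule C_inf_compose[OF finite_jet_idx Z _ cop gZ G comp(1)]) auto
  show "pd l (\<lambda>y. G (?g y)) (\<phi> x) = total_deriv F k l G (jet_vec F ?c (Suc k) \<sigma> x)"
    if x: "x \<in> N" and l: "l < n" for l x
  proof -
    have tr: "truncate_jet F k (jet_vec F ?c (Suc k) \<sigma> x) = jet_vec F ?c k \<sigma> x"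
      by (rule truncate_jet_vec) simp
    have "pd l (\<lambda>y. G (?g y)) (\<phi> x) = (\<Sum>a\<in>jet_idx F k. pd a G (?g (\<phi> x)) * pd l (\<lambda>y. ?g y a) (\<phi> x))"
      by (rule pd_compose[OF finite_jet_idx Z _ cop gZ G comp(1)]) (use x l in auto)
    also have "\<dots> = (\<Sum>a\<in>jet_idx F k. pd a G (jet_vec F ?c k \<sigma> x) *
       (case a of Base i \<Rightarrow> if l = i then 1 else 0
       | Deriv \<alpha> I \<Rightarrow> jet_vec F ?c (Suc k) \<sigma> x (Deriv \<alpha> (add_index I l))))"
      by (rule sum.cong) (use comp(2) x l inv in auto)
    also have "\<dots> = (\<Sum>i<n. pd (Base i) G (jet_vec F ?c k \<sigma> x) * (if l = i then 1 else 0)) +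
       (\<Sum>(\<alpha>, I)\<in>{..<m} \<times> multi_indices n k. pd (Deriv \<alpha> I) G (jet_vec F ?c k \<sigma> x) *
         jet_vec F ?c (Suc k) \<sigma> x (Deriv \<alpha> (add_index I l)))"
      unfolding sum_jet_idx by simp
    also have "(\<Sum>i<n. pd (Base i) G (jet_vec F ?c k \<sigma> x) * (if l = i then 1 else 0)) =
       (\<Sum>i<n. if i = l then pd (Base i) G (jet_vec F ?c k \<sigma> x) else 0)"
      by (rule sum.cong) auto
    finally show ?thesis using l by (simp add: total_deriv_def tr mult.commute del: fun_upd_apply)
  qed
qed

subsection \<open>Change of chart\<close>

text \<open>The jet coordinates, in the first of two charts, of the jets whose target lies in both of them.\<close>

definition "overlap_jets V V' \<psi> k = {z \<in> coord_space (jet_idx F k). total_part F z \<in> \<psi> ` (V \<inter> V')}"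

lemma copen_overlap_jets:
  assumes c: "((V, \<psi>), (U, \<phi>)) \<in> fcharts F" and V': "openin (mtop E) V'"
  shows "copen (jet_idx F k) (overlap_jets V V' \<psi> k)"
proof (cases "V = {}")
  case False
  then obtain e where e: "e \<in> V" by blast
  have "openin (mtop E) (V \<inter> V')" using V' coords_onD(2)[OF fchartD(1)[OF c]] by blast
  then have "copen {..<mdim E} (\<psi> ` (V \<inter> V'))" by (rule coords_onD(4)[OF fchartD(1)[OF c]]) blast
  then show ?thesis unfolding overlap_jets_def
  proof (rule copen_preimage[OF copen_coord_space])
    show "total_part F y \<in> coord_space {..<mdim E}" for y
      using fchart_dim[OF c e] by (auto simp: total_part_def coord_space_def)
    have "continuous_on (coord_space (jet_idx F k)) (\<lambda>y. y a)" for a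
      by (rule continuous_on_subset[OF continuous_on_product_coordinates]) simp
    then show "continuous_on (coord_space (jet_idx F k)) (\<lambda>y. total_part F y b)" for b
      unfolding total_part_def by (cases "b < n"; cases "b < n + m") simp_all
  qed
qed (simp add: overlap_jets_def)

lemma base_transition:
  assumes c: "((V, \<psi>), (U, \<phi>)) \<in> fcharts F" and c': "((V', \<psi>'), (U', \<phi>')) \<in> fcharts F" and i: "i < n"
  shows "C_inf {..<n} (\<phi> ` (U \<inter> U')) (\<lambda>y. \<phi>' (inv_into U \<phi> y) i)"
proof -
  note cU = fchartD(2)[OF c] and cU' = fchartD(2)[OF c']
  have "smooth_fun Q (U \<inter> U') (\<lambda>x. \<phi>' x i)"
    by (rule smooth_fun_subset[OF coords_onD(6)[OF cU']]) (use i in auto)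
  moreover have "openin (mtop Q) (U \<inter> U')" using coords_onD(2)[OF cU] coords_onD(2)[OF cU'] by blast
  ultimately show ?thesis using coords_onD(7)[OF cU, of "U \<inter> U'"] by (simp add: o_def)
qed

text \<open>The derivative \<open>u'\<^sub>I\<close> of a section in the chart \<open>c'\<close> is a smooth function \<open>G\<^sub>I\<close> of its derivatives of order
  at most \<open>|I|\<close> in the chart \<open>c\<close>. For \<open>|I| = 0\<close> this is the transition map of the total space.
  For the induction, \<open>\<partial>\<^sub>i\<close> in the chart \<open>c'\<close> is \<open>\<Sum>\<^sub>l (\<partial>x\<^sup>l/\<partial>x'\<^sup>i) \<partial>\<^sub>l\<close>, and along a section \<open>\<partial>\<^sub>l\<close> acts on
  \<open>G\<^sub>I\<close> as the total derivative \<open>D\<^sub>l\<close>. Everything about the manifold structure of the jet bundle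
  rests on this lemma.\<close>

lemma jet_transition:
  assumes c: "((V, \<psi>), (U, \<phi>)) \<in> fcharts F" and c': "((V', \<psi>'), (U', \<phi>')) \<in> fcharts F" and \<alpha>: "\<alpha> < m"
  shows "\<forall>i\<ge>n. I i = 0 \<Longrightarrow> (\<Sum>i<n. I i) = k \<Longrightarrow>
    \<exists>G. C_inf (jet_idx F k) (overlap_jets V V' \<psi> k) G \<and>
      (\<forall>x \<sigma>. section_near F x \<sigma> \<longrightarrow> \<sigma> x \<in> V \<longrightarrow> \<sigma> x \<in> V' \<longrightarrow>
        section_deriv F ((V', \<psi>'), (U', \<phi>')) \<alpha> I \<sigma> x = G (jet_vec F ((V, \<psi>), (U, \<phi>)) k \<sigma> x))"
proof (induction k arbitrary: I)
  case 0
  then have I: "I = (\<lambda>_. 0)" by (rule multi_index_zero)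
  let ?c = "((V, \<psi>), (U, \<phi>))"
  note cV = fchartD(1)[OF c] and cV' = fchartD(1)[OF c']
  define G where "G z = \<psi>' (inv_into V \<psi> (total_part F z)) (n + \<alpha>)" for z
  have VV: "openin (mtop E) (V \<inter> V')" using coords_onD(2)[OF cV] coords_onD(2)[OF cV'] by blast
  have "C_inf (jet_idx F 0) (overlap_jets V V' \<psi> 0) G"
  proof (cases "V \<inter> V' = {}")
    case True
    then have "overlap_jets V V' \<psi> 0 = {}" by (auto simp: overlap_jets_def)
    then show ?thesis by (auto intro!: C_inf_local)
  next
    case False
    then obtain e where "e \<in> V" by blast
    then have dim: "n + m = mdim E" by (rule fchart_dim[OF c])
    have "smooth_fun E (V \<inter> V') (\<lambda>e. \<psi>' e (n + \<alpha>))"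
      by (rule smooth_fun_subset[OF coords_onD(6)[OF cV']]) (use dim \<alpha> in auto)
    from coords_onD(7)[OF cV VV _ this]
    have CI: "C_inf {..<mdim E} (\<psi> ` (V \<inter> V')) (\<lambda>y. \<psi>' (inv_into V \<psi> y) (n + \<alpha>))" by (simp add: o_def)
    show ?thesis unfolding G_def
    proof (rule C_inf_compose[OF finite_lessThan coords_onD(4)[OF cV VV Int_lower1] finite_jet_idx
        copen_overlap_jets[OF c coords_onD(2)[OF cV']] _ CI])
      show "C_inf (jet_idx F 0) (overlap_jets V V' \<psi> 0) (\<lambda>y. total_part F y i)" for i
        unfolding total_part_def
        using C_inf_coord[OF finite_jet_idx copen_overlap_jets[OF c coords_onD(2)[OF cV']]]
          C_inf_const[OF finite_jet_idx copen_overlap_jets[OF c coords_onD(2)[OF cV']]]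
        by (cases "i < n"; cases "i < n + m") auto
    qed (auto simp: overlap_jets_def)
  qed
  moreover have "section_deriv F ((V', \<psi>'), (U', \<phi>')) \<alpha> I \<sigma> x = G (jet_vec F ?c 0 \<sigma> x)"
    if s: "section_near F x \<sigma>" "\<sigma> x \<in> V" "\<sigma> x \<in> V'" for x \<sigma>
    using total_part_jet_vec(1)[OF c s(1,2), of 0] total_part_jet_vec(2)[OF c s(1,2)] total_part_jet_vec(3)[OF c' s(1,3)]
      inv_into_f_f[OF coords_onD(3)[OF cV] s(2)] inv_into_f_f[OF coords_onD(3)[OF fchartD(2)[OF c']]]
    by (simp add: G_def section_deriv_def I mpd_zero)
  ultimately show ?case by blast
next
  case (Suc k)
  let ?c = "((V, \<psi>), (U, \<phi>))" and ?c' = "((V', \<psi>'), (U', \<phi>'))"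
  note cV = fchartD(1)[OF c] and cV' = fchartD(1)[OF c'] and cU = fchartD(2)[OF c] and cU' = fchartD(2)[OF c']
  obtain i J where i: "i < n" and J: "\<forall>i\<ge>n. J i = 0" "(\<Sum>i<n. J i) = k" "I = add_index J i"
    using multi_index_SucE[OF Suc.prems] .
  obtain G where G: "C_inf (jet_idx F k) (overlap_jets V V' \<psi> k) G"
    "\<And>x \<sigma>. section_near F x \<sigma> \<Longrightarrow> \<sigma> x \<in> V \<Longrightarrow> \<sigma> x \<in> V' \<Longrightarrow>
        section_deriv F ?c' \<alpha> J \<sigma> x = G (jet_vec F ?c k \<sigma> x)"
    using Suc.IH[OF J(1,2)] by blast
  let ?Z = "overlap_jets V V' \<psi>"
  note copZ = copen_overlap_jets[OF c coords_onD(2)[OF cV']]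
  define e where "e l = (\<lambda>y. \<phi> (inv_into U' \<phi>' y) l)" for l
  have e: "C_inf {..<n} (\<phi>' ` (U' \<inter> U)) (e l)" if "l < n" for l
    unfolding e_def by (rule base_transition[OF c' c that])
  have UU: "openin (mtop Q) (U \<inter> U')" using coords_onD(2)[OF cU] coords_onD(2)[OF cU'] by blast
  \<comment> \<open>The Jacobian entry \<open>\<partial>x\<^sup>l/\<partial>x'\<^sup>i\<close> as a function on jet coordinates.\<close>
  define a where "a l z = pd i (e l) (\<phi>' (inv_into U \<phi> (base_part F z)))" for l z
  have bZ: "base_part F z \<in> \<phi> ` (U \<inter> U')" if "z \<in> ?Z k'" for z k'
  proof -
    obtain e where e: "e \<in> V" "e \<in> V'" "total_part F z = \<psi> e" using \<open>z \<in> ?Z k'\<close> by (auto simp: overlap_jets_def)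
    show ?thesis using base_part_of_total[OF c e(1,3)] fchartD(3)[OF c e(1)] fchartD(3)[OF c' e(2)] by auto
  qed
  have a: "C_inf (jet_idx F (Suc k)) (?Z (Suc k)) (a l)" if l: "l < n" for l
  proof -
    have cop': "copen {..<n} (\<phi>' ` (U' \<inter> U))" using coords_onD(4)[OF cU', of "U' \<inter> U"] UU by (simp add: inf_commute)
    have pe: "C_inf {..<n} (\<phi>' ` (U' \<inter> U)) (pd i (e l))" by (rule C_inf_pd[OF e[OF l]]) (use i in simp)
    have CI: "C_inf {..<n} (\<phi> ` (U \<inter> U')) (\<lambda>y. pd i (e l) (\<phi>' (inv_into U \<phi> y)))"
    proof (rule C_inf_compose[OF finite_lessThan cop' finite_lessThan coords_onD(4)[OF cU UU Int_lower1] _ pe])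
      show "\<forall>y\<in>\<phi> ` (U \<inter> U'). \<phi>' (inv_into U \<phi> y) \<in> \<phi>' ` (U' \<inter> U)"
        using inv_into_f_f[OF coords_onD(3)[OF cU]] by auto
    qed (use base_transition[OF c c'] in auto)
    show ?thesis unfolding a_def
    proof (rule C_inf_compose[OF finite_lessThan coords_onD(4)[OF cU UU Int_lower1] finite_jet_idx copZ _ CI])
      show "C_inf (jet_idx F (Suc k)) (?Z (Suc k)) (\<lambda>y. base_part F y j)" for j
        unfolding base_part_def using C_inf_coord[OF finite_jet_idx copZ] C_inf_const[OF finite_jet_idx copZ]
        by (cases "j < n") auto
    qed (use bZ in auto)
  qed
  have pdG: "C_inf (jet_idx F (Suc k)) (?Z (Suc k)) (\<lambda>z. pd b G (truncate_jet F k z))" if "b \<in> jet_idx F k" for b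
    by (rule C_inf_compose[OF finite_jet_idx copZ finite_jet_idx copZ _ C_inf_pd[OF G(1) that]
        C_inf_truncate[OF copZ finite_jet_idx]])
      (auto simp: overlap_jets_def truncate_coord_space total_part_truncate)
  have D: "C_inf (jet_idx F (Suc k)) (?Z (Suc k)) (total_deriv F k l G)" if l: "l < n" for l
    unfolding total_deriv_def split_beta
    by (intro C_inf_add[OF finite_jet_idx copZ] C_inf_sum[OF finite_jet_idx copZ] C_inf_mult[OF finite_jet_idx copZ]
        C_inf_coord[OF finite_jet_idx copZ] pdG) (use l in \<open>auto simp: Base_in_jet_idx Deriv_in_jet_idx\<close>)
  define H where "H z = (\<Sum>l<n. total_deriv F k l G z * a l z)" for z
  have "C_inf (jet_idx F (Suc k)) (?Z (Suc k)) H"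
    unfolding H_def by (intro C_inf_sum[OF finite_jet_idx copZ] C_inf_mult[OF finite_jet_idx copZ] D a) auto
  moreover have "section_deriv F ?c' \<alpha> I \<sigma> x = H (jet_vec F ?c (Suc k) \<sigma> x)"
    if s: "section_near F x \<sigma>" "\<sigma> x \<in> V" "\<sigma> x \<in> V'" for x \<sigma>
  proof -
    have VV: "openin (mtop E) (V \<inter> V')" using coords_onD(2)[OF cV] coords_onD(2)[OF cV'] by blast
    have sVV: "\<sigma> x \<in> V \<inter> V'" using s by blast
    obtain N where N: "openin (mtop Q) N" "x \<in> N" "\<And>x'. x' \<in> N \<Longrightarrow> section_near F x' \<sigma>"
      "\<And>x'. x' \<in> N \<Longrightarrow> \<sigma> x' \<in> V \<inter> V'" "\<And>x'. x' \<in> N \<Longrightarrow> prj F (\<sigma> x') = x'"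
      "\<And>V'' \<psi> U \<phi>. ((V'', \<psi>), (U, \<phi>)) \<in> fcharts F \<Longrightarrow> V \<inter> V' \<subseteq> V'' \<Longrightarrow> N \<subseteq> U"
      "\<And>V'' \<psi> U \<phi> k. ((V'', \<psi>), (U, \<phi>)) \<in> fcharts F \<Longrightarrow> V \<inter> V' \<subseteq> V'' \<Longrightarrow> k < mdim E \<Longrightarrow>
        C_inf {..<n} (\<phi> ` N) (\<lambda>y. \<psi> (\<sigma> (inv_into U \<phi> y)) k)"
      using section_nhd[OF s(1) VV sVV] by blast
    have dim: "n + m = mdim E" by (rule fchart_dim[OF c s(2)])
    have NU: "N \<subseteq> U" "N \<subseteq> U'" using N(6)[OF c] N(6)[OF c'] by auto
    have inv: "inv_into U \<phi> (\<phi> x') = x'" "inv_into U' \<phi>' (\<phi>' x') = x'" if "x' \<in> N" for x'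
      using that NU inv_into_f_f[OF coords_onD(3)[OF cU]] inv_into_f_f[OF coords_onD(3)[OF cU']] by auto
    have smc: "C_inf {..<n} (\<phi> ` N) (\<lambda>y. \<psi> (\<sigma> (inv_into U \<phi> y)) (n + \<beta>))" if "\<beta> < m" for \<beta>
      by (rule N(7)[OF c]) (use dim that in auto)
    have smc': "C_inf {..<n} (\<phi>' ` N) (\<lambda>y. \<psi>' (\<sigma> (inv_into U' \<phi>' y)) (n + \<alpha>))"
      by (rule N(7)[OF c']) (use dim \<alpha> in auto)
    have jZ: "jet_vec F ?c k' \<sigma> x' \<in> ?Z k'" if "x' \<in> N" for x' k'
      using total_part_jet_vec(1)[OF c N(3)[OF that], of k'] N(4)[OF that]
      by (auto simp: overlap_jets_def jet_vec_coord_space)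
    have copN: "copen {..<n} (\<phi> ` N)" "copen {..<n} (\<phi>' ` N)"
      using coords_onD(4)[OF cU N(1) NU(1)] coords_onD(4)[OF cU' N(1) NU(2)] by blast+
    define K where "K = (\<lambda>y. G (jet_vec F ?c k \<sigma> (inv_into U \<phi> y)))"
    define t where "t = (\<lambda>y'. \<phi> (inv_into U' \<phi>' y'))"
    have along1: "C_inf {..<n} (\<phi> ` N) K"
      unfolding K_def by (rule pd_along_section(1)[OF c N(1) NU(1) smc copZ G(1) jZ])
    have along2: "pd l K (\<phi> x) = total_deriv F k l G (jet_vec F ?c (Suc k) \<sigma> x)" if "l < n" for l
      unfolding K_def by (rule pd_along_section(2)[OF c N(1) NU(1) smc copZ G(1) jZ N(2) that])
    have tl: "C_inf {..<n} (\<phi>' ` N) (\<lambda>y. t y l)" if "l \<in> {..<n}" for l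
      by (rule C_inf_subset[of _ "\<phi>' ` (U' \<inter> U)"]) (use e that NU in \<open>auto simp: e_def t_def\<close>)
    have "section_deriv F ?c' \<alpha> I \<sigma> x = pd i (mpd n J (\<lambda>y. \<psi>' (\<sigma> (inv_into U' \<phi>' y)) (n + \<alpha>))) (\<phi>' x)"
      unfolding section_deriv_def J(3) using pd_mpd[OF copN(2) i smc'] N(2) by simp
    also have "\<dots> = pd i (\<lambda>y'. K (t y')) (\<phi>' x)"
    proof (rule pd_cong[OF _ copN(2)])
      show "\<forall>y\<in>\<phi>' ` N. mpd n J (\<lambda>y. \<psi>' (\<sigma> (inv_into U' \<phi>' y)) (n + \<alpha>)) y = K (t y)"
      proof
        fix y assume "y \<in> \<phi>' ` N"
        then obtain x' where x': "x' \<in> N" "y = \<phi>' x'" by blast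
        have "section_deriv F ?c' \<alpha> J \<sigma> x' = G (jet_vec F ?c k \<sigma> x')"
          using G(2) N(3,4) x'(1) by blast
        then show "mpd n J (\<lambda>y. \<psi>' (\<sigma> (inv_into U' \<phi>' y)) (n + \<alpha>)) y = K (t y)"
          using inv[OF x'(1)] by (simp add: x'(2) K_def t_def section_deriv_def)
      qed
    qed (use N(2) i in auto)
    also have "\<dots> = (\<Sum>l<n. pd l K (t (\<phi>' x)) * pd i (\<lambda>y. t y l) (\<phi>' x))"
      by (rule pd_compose[OF _ copN(1) _ copN(2) _ along1 tl])
        (use inv N(2) i in \<open>auto simp: t_def\<close>)
    also have "\<dots> = (\<Sum>l<n. total_deriv F k l G (jet_vec F ?c (Suc k) \<sigma> x) * a l (jet_vec F ?c (Suc k) \<sigma> x))"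
    proof (rule sum.cong)
      fix l assume "l \<in> {..<n}"
      then have "pd l K (\<phi> x) = total_deriv F k l G (jet_vec F ?c (Suc k) \<sigma> x)"
        using along2 by simp
      moreover have "t (\<phi>' x) = \<phi> x" using inv N(2) by (simp add: t_def)
      moreover have "base_part F (jet_vec F ?c (Suc k) \<sigma> x) = \<phi> x"
        by (rule base_part_jet_vec[OF c]) (use N(2) NU in blast)
      then have "a l (jet_vec F ?c (Suc k) \<sigma> x) = pd i (\<lambda>y. t y l) (\<phi>' x)"
        using inv N(2) by (simp add: a_def t_def e_def)
      ultimately show "pd l K (t (\<phi>' x)) * pd i (\<lambda>y. t y l) (\<phi>' x) =
          total_deriv F k l G (jet_vec F ?c (Suc k) \<sigma> x) * a l (jet_vec F ?c (Suc k) \<sigma> x)" by simp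
    qed simp
    finally show ?thesis by (simp add: H_def)
  qed
  ultimately show ?case by blast
qed

end

section \<open>The jet bundle as a manifold\<close>

lemma jet_eq_refl: "section_near F x \<sigma> \<Longrightarrow> jet_eq F r x \<sigma> \<sigma>"
  by (simp add: jet_eq_def)

lemma jet_eq_sym: "jet_eq F r x \<sigma> \<tau> \<Longrightarrow> jet_eq F r x \<tau> \<sigma>"
  by (auto simp: jet_eq_def)

lemma jet_eq_trans: "jet_eq F r x \<sigma> \<tau> \<Longrightarrow> jet_eq F r x \<tau> \<rho> \<Longrightarrow> jet_eq F r x \<sigma> \<rho>"
  by (auto simp: jet_eq_def)

lemma jet_eq_mono: "s \<le> r \<Longrightarrow> jet_eq F r x \<sigma> \<tau> \<Longrightarrow> jet_eq F s x \<sigma> \<tau>"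
  using multi_indices_mono[of s r "bdim F"] unfolding jet_eq_def by (meson subsetD)

lemma jet_of_eqD:
  assumes "jet_of F r \<sigma> x = jet_of F r \<tau> y" "section_near F x \<sigma>"
  shows "x = y" "jet_eq F r y \<tau> \<sigma>"
  using assms jet_eq_refl[OF assms(2), of r] unfolding jet_of_def by auto

lemma jet_of_eqI: "jet_eq F r x \<sigma> \<tau> \<Longrightarrow> jet_of F r \<sigma> x = jet_of F r \<tau> x"
  unfolding jet_of_def using jet_eq_sym jet_eq_trans by fast

lemma jet_coords_jet_of:
  assumes c: "c \<in> fcharts F" and s: "section_near F x \<sigma>" "\<sigma> x \<in> fst (fst c)"
  shows "jet_coords F r c (jet_of F r \<sigma> x) = jet_vec F c r \<sigma> x"
proof -
  define \<tau> where "\<tau> = (SOME \<tau>. \<tau> \<in> snd (jet_of F r \<sigma> x))"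
  have "\<exists>\<tau>. \<tau> \<in> snd (jet_of F r \<sigma> x)" using jet_eq_refl[OF s(1)] by (auto simp: jet_of_def)
  then have "\<tau> \<in> snd (jet_of F r \<sigma> x)" unfolding \<tau>_def by (rule someI_ex)
  then have \<tau>: "jet_eq F r x \<sigma> \<tau>" by (simp add: jet_of_def)
  show ?thesis
  proof
    fix k show "jet_coords F r c (jet_of F r \<sigma> x) k = jet_vec F c r \<sigma> x k"
    proof (cases "k \<in> jet_idx F r")
      case True
      show ?thesis
      proof (cases k)
        case (Deriv \<alpha> I)
        then have "section_deriv F c \<alpha> I \<sigma> x = section_deriv F c \<alpha> I \<tau> x"
          using \<tau> c s(2) True unfolding jet_eq_def by (simp add: Deriv_in_jet_idx)
        then show ?thesis using True Deriv by (simp add: jet_coords_def jet_vec_def \<tau>_def[symmetric]) (simp add: jet_of_def)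
      qed (use True in \<open>simp add: jet_coords_def jet_vec_def jet_of_def\<close>)
    qed (simp add: jet_coords_def jet_vec_def)
  qed
qed

lemma jet_domE:
  assumes "j \<in> jet_dom F r c"
  obtains \<sigma> x where "j = jet_of F r \<sigma> x" "section_near F x \<sigma>" "\<sigma> x \<in> fst (fst c)"
  using assms unfolding jet_dom_def by blast

lemma jet_domI: "section_near F x \<sigma> \<Longrightarrow> \<sigma> x \<in> fst (fst c) \<Longrightarrow> jet_of F r \<sigma> x \<in> jet_dom F r c"
  unfolding jet_dom_def by blast

lemma jet_dom_jet_ofD:
  assumes "jet_of F r \<sigma> x \<in> jet_dom F r c" "section_near F x \<sigma>"
  shows "\<sigma> x \<in> fst (fst c)"
proof -
  obtain \<tau> y where t: "jet_of F r \<sigma> x = jet_of F r \<tau> y" "section_near F y \<tau>" "\<tau> y \<in> fst (fst c)"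
    using assms(1) by (rule jet_domE)
  have "x = y" "jet_eq F r y \<tau> \<sigma>" using jet_of_eqD[OF t(1) assms(2)] by auto
  then show ?thesis using t(3) by (auto simp: jet_eq_def)
qed

context fibred
begin

abbreviation "J r \<equiv> jet_bundle F r"

text \<open>Equality of jets refers to all fibred charts around the target; by the transition functions one
  chart is enough.\<close>

lemma jet_eqI_chart:
  assumes c: "((V, \<psi>), (U, \<phi>)) \<in> fcharts F" and s: "section_near F x \<sigma>" "\<sigma> x \<in> V"
    and t: "section_near F x \<tau>" "\<tau> x \<in> V"
    and eq: "jet_vec F ((V, \<psi>), (U, \<phi>)) r \<sigma> x = jet_vec F ((V, \<psi>), (U, \<phi>)) r \<tau> x"
  shows "jet_eq F r x \<sigma> \<tau>"
proof -
  have "\<psi> (\<sigma> x) = \<psi> (\<tau> x)"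
    using total_part_jet_vec(1)[OF c s, of r] total_part_jet_vec(1)[OF c t, of r] eq by simp
  then have st: "\<sigma> x = \<tau> x" using inj_onD[OF coords_onD(3)[OF fchartD(1)[OF c]]] s t by blast
  have "section_deriv F c' \<alpha> I \<sigma> x = section_deriv F c' \<alpha> I \<tau> x"
    if c': "c' \<in> fcharts F" "\<sigma> x \<in> fst (fst c')" and \<alpha>: "\<alpha> < m" and I: "I \<in> multi_indices n r" for c' \<alpha> I
  proof -
    obtain V' \<psi>' U' \<phi>' where c'eq: "c' = ((V', \<psi>'), (U', \<phi>'))" by (metis prod.collapse)
    have I0: "\<forall>i\<ge>n. I i = 0" "(\<Sum>i<n. I i) \<le> r" using I by (auto simp: multi_indices_def)
    obtain G where G: "\<And>x \<sigma>. section_near F x \<sigma> \<Longrightarrow> \<sigma> x \<in> V \<Longrightarrow> \<sigma> x \<in> V' \<Longrightarrow>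
        section_deriv F ((V', \<psi>'), (U', \<phi>')) \<alpha> I \<sigma> x = G (jet_vec F ((V, \<psi>), (U, \<phi>)) (\<Sum>i<n. I i) \<sigma> x)"
      using jet_transition[OF c c'(1)[unfolded c'eq] \<alpha> I0(1) refl] by blast
    have "jet_vec F ((V, \<psi>), (U, \<phi>)) (\<Sum>i<n. I i) \<sigma> x = jet_vec F ((V, \<psi>), (U, \<phi>)) (\<Sum>i<n. I i) \<tau> x"
      using truncate_jet_vec[OF I0(2), of F "((V, \<psi>), (U, \<phi>))"] eq by metis
    then show ?thesis using G[OF s] G[OF t] c'(2) st by (simp add: c'eq)
  qed
  then show ?thesis using s t st by (simp add: jet_eq_def)
qed

lemma jet_coords_inj:
  assumes c: "c \<in> fcharts F"
  shows "inj_on (jet_coords F r c) (jet_dom F r c)"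
proof (rule inj_onI)
  obtain V \<psi> U \<phi> where ceq: "c = ((V, \<psi>), (U, \<phi>))" by (metis prod.collapse)
  note c = c[unfolded ceq]
  fix j j' assume "j \<in> jet_dom F r c" "j' \<in> jet_dom F r c" and eq: "jet_coords F r c j = jet_coords F r c j'"
  then obtain \<sigma> x \<tau> y where j: "j = jet_of F r \<sigma> x" "section_near F x \<sigma>" "\<sigma> x \<in> V"
    "j' = jet_of F r \<tau> y" "section_near F y \<tau>" "\<tau> y \<in> V"
    by (auto elim!: jet_domE simp: ceq)
  have e: "jet_vec F ((V, \<psi>), (U, \<phi>)) r \<sigma> x = jet_vec F ((V, \<psi>), (U, \<phi>)) r \<tau> y"
    using eq jet_coords_jet_of[OF c] j by (simp add: ceq)
  have xy: "x \<in> U" "y \<in> U" using total_part_jet_vec(3)[OF c] j by blast+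
  then have "\<phi> x = \<phi> y" using base_part_jet_vec[OF c] e by metis
  then have y: "y = x" using inj_onD[OF coords_onD(3)[OF fchartD(2)[OF c]]] xy by blast
  have "jet_eq F r x \<sigma> \<tau>" by (rule jet_eqI_chart[OF c j(2,3) j(5,6)[unfolded y] e[unfolded y]])
  then show "j = j'" unfolding j(1,4) y by (rule jet_of_eqI)
qed

text \<open>Every point of the coordinate domain is attained: a Taylor polynomial has prescribed derivatives.\<close>

lemma jet_vec_surj:
  assumes c: "((V, \<psi>), (U, \<phi>)) \<in> fcharts F" and z: "z \<in> coord_space (jet_idx F r)"
    and e: "e \<in> V" "total_part F z = \<psi> e"
  obtains \<sigma> x where "section_near F x \<sigma>" "\<sigma> x = e" "jet_vec F ((V, \<psi>), (U, \<phi>)) r \<sigma> x = z"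
proof -
  note cV = fchartD(1)[OF c] and cU = fchartD(2)[OF c]
  define x where "x = prj F e"
  have xU: "x \<in> U" unfolding x_def by (rule fchartD(3)[OF c e(1)])
  have dim: "n + m = mdim E" by (rule fchart_dim[OF c e(1)])
  have bz: "base_part F z = \<phi> x" unfolding x_def by (rule base_part_of_total[OF c e])
  have zb: "z (Base i) = \<phi> x i" if "i < n" for i
    using fun_cong[OF bz, of i] that by (simp add: base_part_def)
  have xc: "\<phi> x \<in> coord_space {..<n}" by (rule coords_on_in_coord_space[OF cU xU])
  define s where "s \<alpha> y = (\<Sum>I\<in>multi_indices n r. z (Deriv \<alpha> I) * taylor_monomial n (\<phi> x) I y)" for \<alpha> y
  have sm: "C_inf {..<n} X (s \<alpha>)" if "copen {..<n} X" for X \<alpha>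
    unfolding s_def
    by (intro C_inf_sum C_inf_mult C_inf_const C_inf_taylor_monomial that finite_lessThan)
  have sd: "mpd n I (s \<alpha>) (\<phi> x) = z (Deriv \<alpha> I)" if "I \<in> multi_indices n r" for I \<alpha>
    unfolding s_def by (rule taylor_polynomial_derivatives[OF that xc])
  define w where "w y = (\<lambda>i. if i < n then y i else if i < n + m then s (i - n) y else 0)" for y
  have wx: "w (\<phi> x) = \<psi> e"
  proof -
    have "s \<alpha> (\<phi> x) = z (Deriv \<alpha> (\<lambda>_. 0))" for \<alpha>
      using sd[OF zero_multi_index] by (simp add: mpd_zero)
    then have "w (\<phi> x) = total_part F z" using zb by (auto simp: w_def total_part_def)
    then show ?thesis using e(2) by simp
  qed
  have copU: "copen {..<n} (\<phi> ` U)" by (rule coords_onD(4)[OF cU coords_onD(2)[OF cU] order.refl])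
  have copV: "copen {..<mdim E} (\<psi> ` V)" by (rule coords_onD(4)[OF cV coords_onD(2)[OF cV] order.refl])
  define X where "X = {y \<in> \<phi> ` U. w y \<in> \<psi> ` V}"
  have X: "copen {..<n} X" unfolding X_def
  proof (rule copen_preimage[OF copU copV])
    show "w y \<in> coord_space {..<mdim E}" for y using dim by (auto simp: w_def coord_space_def)
    show "continuous_on (\<phi> ` U) (\<lambda>y. w y b)" for b
      unfolding w_def using C_inf_imp_continuous[OF sm[OF copU]] C_inf_imp_continuous[OF C_inf_coord[OF _ copU]]
      by (cases "b < n"; cases "b < n + m") auto
  qed
  define N where "N = {x \<in> U. \<phi> x \<in> X}"
  define \<sigma> where "\<sigma> x = inv_into V \<psi> (w (\<phi> x))" for x
  have wV: "w y \<in> \<psi> ` V" if "y \<in> X" for y using that by (auto simp: X_def)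
  have XU: "X \<subseteq> \<phi> ` U" by (auto simp: X_def)
  have sec: "local_section F N \<sigma>" "\<And>x. x \<in> N \<Longrightarrow> \<sigma> x \<in> V \<and> \<psi> (\<sigma> x) = w (\<phi> x)"
    by (rule section_of_functions[OF c X XU sm[OF X] w_def wV N_def \<sigma>_def]; assumption)+
  have xX: "\<phi> x \<in> X" using xU wx e(1) by (auto simp: X_def)
  then have xN: "x \<in> N" using xU by (simp add: N_def)
  have near: "section_near F x \<sigma>" using sec(1) xN by (auto simp: section_near_def)
  have "\<sigma> x = e" unfolding \<sigma>_def wx by (rule inv_into_f_f[OF coords_onD(3)[OF cV] e(1)])
  moreover have "jet_vec F ((V, \<psi>), (U, \<phi>)) r \<sigma> x = z"
  proof (rule coord_space_eqI[OF jet_vec_coord_space z])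
    fix a assume a: "a \<in> jet_idx F r"
    show "jet_vec F ((V, \<psi>), (U, \<phi>)) r \<sigma> x a = z a"
    proof (cases a)
      case (Base i)
      then have "i < n" using a Base_in_jet_idx by metis
      then show ?thesis using Base a zb by (simp add: jet_vec_def)
    next
      case (Deriv \<alpha> I)
      then have \<alpha>: "\<alpha> < m" "I \<in> multi_indices n r" using a Deriv_in_jet_idx by metis+
      have "\<psi> (\<sigma> (inv_into U \<phi> y)) (n + \<alpha>) = s \<alpha> y" if y: "y \<in> X" for y
      proof -
        have "y \<in> \<phi> ` U" using y by (simp add: X_def)
        then have i: "inv_into U \<phi> y \<in> U" "\<phi> (inv_into U \<phi> y) = y" by (auto simp: inv_into_into f_inv_into_f)
        then have "\<psi> (\<sigma> (inv_into U \<phi> y)) = w y" using sec(2)[of "inv_into U \<phi> y"] y by (simp add: N_def)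
        then show ?thesis using \<alpha> by (simp add: w_def)
      qed
      then have "mpd n I (\<lambda>y. \<psi> (\<sigma> (inv_into U \<phi> y)) (n + \<alpha>)) (\<phi> x) = mpd n I (s \<alpha>) (\<phi> x)"
        by (intro mpd_cong[OF X order.refl _ xX] ballI)
      then show ?thesis using Deriv a sd[OF \<alpha>(2)] by (simp add: jet_vec_def section_deriv_def)
    qed
  qed
  ultimately show ?thesis using that near by blast
qed

lemma jet_coords_image_overlap:
  assumes c: "((V, \<psi>), (U, \<phi>)) \<in> fcharts F" and c': "((V', \<psi>'), (U', \<phi>')) \<in> fcharts F"
  shows "jet_coords F r ((V, \<psi>), (U, \<phi>)) ` (jet_dom F r ((V, \<psi>), (U, \<phi>)) \<inter> jet_dom F r ((V', \<psi>'), (U', \<phi>')))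
    = overlap_jets V V' \<psi> r"
proof (intro equalityI subsetI)
  let ?c = "((V, \<psi>), (U, \<phi>))" and ?c' = "((V', \<psi>'), (U', \<phi>'))"
  fix z assume "z \<in> jet_coords F r ?c ` (jet_dom F r ?c \<inter> jet_dom F r ?c')"
  then obtain j where j: "j \<in> jet_dom F r ?c" "j \<in> jet_dom F r ?c'" "z = jet_coords F r ?c j" by blast
  obtain \<sigma> x where s: "j = jet_of F r \<sigma> x" "section_near F x \<sigma>" "\<sigma> x \<in> fst (fst ?c)"
    using j(1) by (rule jet_domE)
  have "\<sigma> x \<in> V'" using jet_dom_jet_ofD[of F r \<sigma> x ?c'] j(2) s by simp
  moreover have "z = jet_vec F ?c r \<sigma> x" using j(3) s jet_coords_jet_of[OF c s(2,3)] by simp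
  ultimately show "z \<in> overlap_jets V V' \<psi> r"
    using total_part_jet_vec(1)[OF c s(2), of r] s(3) by (auto simp: overlap_jets_def jet_vec_coord_space)
next
  let ?c = "((V, \<psi>), (U, \<phi>))" and ?c' = "((V', \<psi>'), (U', \<phi>'))"
  fix z assume "z \<in> overlap_jets V V' \<psi> r"
  then obtain e where e: "z \<in> coord_space (jet_idx F r)" "e \<in> V" "e \<in> V'" "total_part F z = \<psi> e"
    by (auto simp: overlap_jets_def)
  obtain \<sigma> x where s: "section_near F x \<sigma>" "\<sigma> x = e" "jet_vec F ?c r \<sigma> x = z"
    using jet_vec_surj[OF c e(1,2,4)] .
  have "jet_of F r \<sigma> x \<in> jet_dom F r ?c \<inter> jet_dom F r ?c'"
    using jet_domI[OF s(1), of ?c r] jet_domI[OF s(1), of ?c' r] s(2) e by simp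
  moreover have "jet_coords F r ?c (jet_of F r \<sigma> x) = z"
    using jet_coords_jet_of[OF c s(1), of r] s e by simp
  ultimately show "z \<in> jet_coords F r ?c ` (jet_dom F r ?c \<inter> jet_dom F r ?c')" by blast
qed

lemma jet_coords_transition:
  assumes c: "((V, \<psi>), (U, \<phi>)) \<in> fcharts F" and c': "((V', \<psi>'), (U', \<phi>')) \<in> fcharts F"
    and a: "a \<in> jet_idx F r"
  shows "\<exists>T. C_inf (jet_idx F r) (overlap_jets V V' \<psi> r) T \<and>
    (\<forall>j\<in>jet_dom F r ((V, \<psi>), (U, \<phi>)) \<inter> jet_dom F r ((V', \<psi>'), (U', \<phi>')).
      jet_coords F r ((V', \<psi>'), (U', \<phi>')) j a = T (jet_coords F r ((V, \<psi>), (U, \<phi>)) j))"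
proof -
  let ?c = "((V, \<psi>), (U, \<phi>))" and ?c' = "((V', \<psi>'), (U', \<phi>'))"
  note cU = fchartD(2)[OF c] and cU' = fchartD(2)[OF c'] and cV' = fchartD(1)[OF c']
  note copZ = copen_overlap_jets[OF c coords_onD(2)[OF cV']]
  have rep: "\<exists>\<sigma> x. j = jet_of F r \<sigma> x \<and> section_near F x \<sigma> \<and> \<sigma> x \<in> V \<and> \<sigma> x \<in> V' \<and>
      jet_coords F r ?c j = jet_vec F ?c r \<sigma> x \<and> jet_coords F r ?c' j = jet_vec F ?c' r \<sigma> x"
    if j: "j \<in> jet_dom F r ?c \<inter> jet_dom F r ?c'" for j
  proof -
    obtain \<sigma> x where s: "j = jet_of F r \<sigma> x" "section_near F x \<sigma>" "\<sigma> x \<in> fst (fst ?c)"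
      using j by (blast elim: jet_domE)
    have "\<sigma> x \<in> V'" using jet_dom_jet_ofD[of F r \<sigma> x ?c'] j s by simp
    then show ?thesis using s jet_coords_jet_of[OF c s(2,3)] jet_coords_jet_of[OF c' s(2)] by auto
  qed
  show ?thesis
  proof (cases a)
    case (Base i)
    then have i: "i < n" using a Base_in_jet_idx by metis
    have UU: "openin (mtop Q) (U \<inter> U')" using coords_onD(2)[OF cU] coords_onD(2)[OF cU'] by blast
    have "C_inf (jet_idx F r) (overlap_jets V V' \<psi> r) (\<lambda>z. \<phi>' (inv_into U \<phi> (base_part F z)) i)"
    proof (rule C_inf_compose[OF finite_lessThan coords_onD(4)[OF cU UU Int_lower1] finite_jet_idx copZ _ base_transition[OF c c' i]])
      show "\<forall>z\<in>overlap_jets V V' \<psi> r. base_part F z \<in> \<phi> ` (U \<inter> U')"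
      proof
        fix z assume "z \<in> overlap_jets V V' \<psi> r"
        then obtain e where e: "e \<in> V" "e \<in> V'" "total_part F z = \<psi> e" by (auto simp: overlap_jets_def)
        show "base_part F z \<in> \<phi> ` (U \<inter> U')"
          using base_part_of_total[OF c e(1,3)] fchartD(3)[OF c e(1)] fchartD(3)[OF c' e(2)] by auto
      qed
      show "C_inf (jet_idx F r) (overlap_jets V V' \<psi> r) (\<lambda>y. base_part F y k)" for k
        unfolding base_part_def using C_inf_coord[OF finite_jet_idx copZ] C_inf_const[OF finite_jet_idx copZ]
        by (cases "k < n") auto
    qed
    moreover have "jet_coords F r ?c' j a = \<phi>' (inv_into U \<phi> (base_part F (jet_coords F r ?c j))) i"
      if j: "j \<in> jet_dom F r ?c \<inter> jet_dom F r ?c'" for j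
    proof -
      obtain \<sigma> x where s: "section_near F x \<sigma>" "\<sigma> x \<in> V" "jet_coords F r ?c j = jet_vec F ?c r \<sigma> x"
        "jet_coords F r ?c' j = jet_vec F ?c' r \<sigma> x" using rep[OF j] by blast
      have "x \<in> U" by (rule total_part_jet_vec(3)[OF c s(1,2)])
      then show ?thesis using s(3,4) a Base base_part_jet_vec[OF c, of x] inv_into_f_f[OF coords_onD(3)[OF cU]]
        by (simp add: jet_vec_def)
    qed
    ultimately show ?thesis by (intro exI[of _ "\<lambda>z. \<phi>' (inv_into U \<phi> (base_part F z)) i"]) blast
  next
    case (Deriv \<alpha> I)
    then have \<alpha>: "\<alpha> < m" and I: "I \<in> multi_indices n r" using a Deriv_in_jet_idx by metis+
    define k where "k = (\<Sum>i<n. I i)"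
    have k: "k \<le> r" and I0: "\<forall>i\<ge>n. I i = 0" using I by (auto simp: multi_indices_def k_def)
    obtain G where G: "C_inf (jet_idx F k) (overlap_jets V V' \<psi> k) G" "\<And>x \<sigma>. section_near F x \<sigma> \<Longrightarrow> \<sigma> x \<in> V \<Longrightarrow> \<sigma> x \<in> V' \<Longrightarrow>
        section_deriv F ?c' \<alpha> I \<sigma> x = G (jet_vec F ?c k \<sigma> x)"
      using jet_transition[OF c c' \<alpha> I0 k_def[symmetric]] by blast
    have "C_inf (jet_idx F r) (overlap_jets V V' \<psi> r) (\<lambda>z. G (truncate_jet F k z))"
      by (rule C_inf_compose[OF finite_jet_idx copZ finite_jet_idx copZ _ G(1) C_inf_truncate[OF copZ finite_jet_idx]])
        (auto simp: overlap_jets_def truncate_coord_space total_part_truncate)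
    moreover have "jet_coords F r ?c' j a = G (truncate_jet F k (jet_coords F r ?c j))"
      if j: "j \<in> jet_dom F r ?c \<inter> jet_dom F r ?c'" for j
    proof -
      obtain \<sigma> x where s: "section_near F x \<sigma>" "\<sigma> x \<in> V" "\<sigma> x \<in> V'" "jet_coords F r ?c j = jet_vec F ?c r \<sigma> x"
        "jet_coords F r ?c' j = jet_vec F ?c' r \<sigma> x" using rep[OF j] by blast
      show ?thesis using s(4,5) a Deriv G(2)[OF s(1-3)] truncate_jet_vec[OF k, of F ?c \<sigma> x]
        by (simp add: jet_vec_def[of F ?c' r])
    qed
    ultimately show ?thesis by (intro exI[of _ "\<lambda>z. G (truncate_jet F k z)"]) blast
  qed
qed

lemma jet_coords_coord_space: "jet_coords F r c j \<in> coord_space (jet_idx F r)"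
  by (simp add: jet_coords_def coord_space_def)

lemma jet_basic_open:
  "c \<in> fcharts F \<Longrightarrow> copen (jet_idx F r) B \<Longrightarrow> openin (mtop (J r)) {j \<in> jet_dom F r c. jet_coords F r c j \<in> B}"
  unfolding jet_bundle_def mfd.simps by (rule topology_generated_by_Basis) blast

lemma jet_dom_open: "c \<in> fcharts F \<Longrightarrow> openin (mtop (J r)) (jet_dom F r c)"
  using jet_basic_open[OF _ copen_coord_space, of c r] jet_coords_coord_space by simp

text \<open>The topology is generated by preimages under all adapted charts. An adapted chart is
  injective, so images commute with intersections and it suffices to treat the generators; their images
  are open because the transition functions are continuous.\<close>

lemma jet_coords_open_map:
  assumes c: "c \<in> fcharts F" and W: "openin (mtop (J r)) W"
  shows "copen (jet_idx F r) (jet_coords F r c ` (jet_dom F r c \<inter> W))"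
proof -
  obtain V \<psi> U \<phi> where ceq: "c = ((V, \<psi>), (U, \<phi>))" by (metis prod.collapse)
  note c1 = c[unfolded ceq]
  note inj = jet_coords_inj[OF c, of r]
  let ?G = "{{j \<in> jet_dom F r c. jet_coords F r c j \<in> B} | c B.
          c \<in> fcharts F \<and> openin (top_of_set (coord_space (jet_idx F r))) B}"
  have "generate_topology_on ?G W"
    using W unfolding jet_bundle_def by (simp add: openin_topology_generated_by_iff)
  then show ?thesis
  proof (induction rule: generate_topology_on.induct)
    case Empty
    then show ?case by simp
  next
    case (Int A B)
    have "jet_coords F r c ` (jet_dom F r c \<inter> (A \<inter> B)) =
        jet_coords F r c ` (jet_dom F r c \<inter> A) \<inter> jet_coords F r c ` (jet_dom F r c \<inter> B)"
      using inj by (auto dest: inj_onD)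
    then show ?case using copen_Int[OF Int.IH] by simp
  next
    case (UN K)
    have "jet_coords F r c ` (jet_dom F r c \<inter> \<Union>K) = \<Union>((\<lambda>k. jet_coords F r c ` (jet_dom F r c \<inter> k)) ` K)" by blast
    then show ?case using UN.IH by (auto intro: openin_Union)
  next
    case (Basis s)
    then obtain c' B where B: "c' \<in> fcharts F" "copen (jet_idx F r) B" "s = {j \<in> jet_dom F r c'. jet_coords F r c' j \<in> B}" by blast
    obtain V' \<psi>' U' \<phi>' where c'eq: "c' = ((V', \<psi>'), (U', \<phi>'))" by (metis prod.collapse)
    note c1' = B(1)[unfolded c'eq]
    have "\<forall>a. \<exists>T. a \<in> jet_idx F r \<longrightarrow> C_inf (jet_idx F r) (overlap_jets V V' \<psi> r) T \<and>
        (\<forall>j\<in>jet_dom F r c \<inter> jet_dom F r c'. jet_coords F r c' j a = T (jet_coords F r c j))"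
      using jet_coords_transition[OF c1 c1'] unfolding ceq c'eq by blast
    from choice[OF this] obtain T where T: "\<And>a. a \<in> jet_idx F r \<Longrightarrow> C_inf (jet_idx F r) (overlap_jets V V' \<psi> r) (T a) \<and>
        (\<forall>j\<in>jet_dom F r c \<inter> jet_dom F r c'. jet_coords F r c' j a = T a (jet_coords F r c j))"
      by blast
    define T' where "T' z = (\<lambda>a. if a \<in> jet_idx F r then T a z else 0)" for z
    have T': "jet_coords F r c' j = T' (jet_coords F r c j)" if "j \<in> jet_dom F r c \<inter> jet_dom F r c'" for j
      by (rule coord_space_eqI[OF jet_coords_coord_space]) (use T that in \<open>auto simp: T'_def coord_space_def\<close>)
    have im: "jet_coords F r c ` (jet_dom F r c \<inter> jet_dom F r c') = overlap_jets V V' \<psi> r"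
      using jet_coords_image_overlap[OF c1 c1'] by (simp add: ceq c'eq)
    have "copen (jet_idx F r) {z \<in> overlap_jets V V' \<psi> r. T' z \<in> B}"
    proof (rule copen_preimage[OF copen_overlap_jets[OF c1 coords_onD(2)[OF fchartD(1)[OF c1']]] B(2)])
      show "continuous_on (overlap_jets V V' \<psi> r) (\<lambda>z. T' z a)" if "a \<in> jet_idx F r" for a
        using C_inf_imp_continuous T[OF that] that by (auto simp: T'_def)
    qed (simp add: T'_def coord_space_def)
    moreover have "jet_coords F r c ` (jet_dom F r c \<inter> s) = {z \<in> overlap_jets V V' \<psi> r. T' z \<in> B}"
      unfolding im[symmetric] B(3) using T' by auto
    ultimately show ?case by simp
  qed
qed

lemma jet_atlas: "atlas (J r) = {(jet_dom F r c, jet_coords F r c) | c. c \<in> fcharts F}" "idx (J r) = jet_idx F r"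
  by (simp_all add: jet_bundle_def)

lemma jet_coords_on:
  assumes c: "c \<in> fcharts F"
  shows "coords_on (J r) (jet_dom F r c) (jet_coords F r c) (jet_idx F r)"
proof -
  obtain V \<psi> U \<phi> where ceq: "c = ((V, \<psi>), (U, \<phi>))" by (metis prod.collapse)
  note c1 = c[unfolded ceq]
  have f1: "copen (jet_idx F r) (jet_coords F r c ` W')" if "openin (mtop (J r)) W'" "W' \<subseteq> jet_dom F r c" for W'
    using jet_coords_open_map[OF c that(1)] that(2) by (simp add: Int_absorb1)
  have f2: "smooth_fun (J r) (jet_dom F r c) (\<lambda>p. jet_coords F r c p a)" if a: "a \<in> jet_idx F r" for a
  proof (rule smooth_funI)
    fix D \<kappa> assume "(D, \<kappa>) \<in> atlas (J r)"
    then obtain c' where c': "c' \<in> fcharts F" "D = jet_dom F r c'" "\<kappa> = jet_coords F r c'" unfolding jet_atlas by blast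
    obtain V' \<psi>' U' \<phi>' where c'eq: "c' = ((V', \<psi>'), (U', \<phi>'))" by (metis prod.collapse)
    note c1' = c'(1)[unfolded c'eq]
    obtain T where T: "C_inf (jet_idx F r) (overlap_jets V' V \<psi>' r) T"
       "\<forall>j\<in>jet_dom F r c' \<inter> jet_dom F r c. jet_coords F r c j a = T (jet_coords F r c' j)"
      using jet_coords_transition[OF c1' c1 a] unfolding ceq c'eq by blast
    have im: "\<kappa> ` (D \<inter> jet_dom F r c) = overlap_jets V' V \<psi>' r"
      using jet_coords_image_overlap[OF c1' c1] c'(2,3) by (simp add: ceq c'eq)
    show "C_inf (idx (J r)) (\<kappa> ` (D \<inter> jet_dom F r c)) (\<lambda>y. jet_coords F r c (inv_into D \<kappa> y) a)"
      unfolding jet_atlas(2)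
    proof (rule C_inf_cong[OF finite_jet_idx _ _ T(1)[folded im]])
      show "copen (jet_idx F r) (\<kappa> ` (D \<inter> jet_dom F r c))"
        unfolding im by (rule copen_overlap_jets[OF c1' coords_onD(2)[OF fchartD(1)[OF c1]]])
      show "\<forall>y\<in>\<kappa> ` (D \<inter> jet_dom F r c). T y = jet_coords F r c (inv_into D \<kappa> y) a"
        using T(2) inv_into_f_f[OF jet_coords_inj[OF c'(1)]] c'(2,3) by auto
    qed
  qed
  have f3: "C_inf (jet_idx F r) (jet_coords F r c ` W') (f \<circ> inv_into (jet_dom F r c) (jet_coords F r c))"
    if "W' \<subseteq> jet_dom F r c" "smooth_fun (J r) W' f" for W' f
  proof -
    have "(jet_dom F r c, jet_coords F r c) \<in> atlas (J r)" using c unfolding jet_atlas by blast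
    from smooth_funD[OF that(2) this] that(1) show ?thesis by (simp add: Int_absorb1 jet_atlas o_def)
  qed
  show ?thesis
    unfolding coords_on_def
    by (intro conjI allI impI ballI finite_jet_idx jet_dom_open[OF c] jet_coords_inj[OF c] jet_basic_open[OF c] f1 f2 f3)
qed

lemma jet_carrierE:
  assumes "j \<in> carr (J r)"
  obtains c where "c \<in> fcharts F" "j \<in> jet_dom F r c"
  using assms unfolding jet_bundle_def by auto

lemma jet_bundle_charted: "charted_mfd (J r)"
proof -
  have "(\<Union>c\<in>atlas (J r). fst c) = carr (J r)"
  proof (intro equalityI subsetI)
    fix j assume "j \<in> (\<Union>c\<in>atlas (J r). fst c)"
    then obtain c where "c \<in> fcharts F" "j \<in> jet_dom F r c" unfolding jet_atlas by auto
    then show "j \<in> carr (J r)" using openin_subset[OF jet_dom_open] by blast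
  next
    fix j assume "j \<in> carr (J r)"
    then obtain c where "c \<in> fcharts F" "j \<in> jet_dom F r c" by (rule jet_carrierE)
    then show "j \<in> (\<Union>c\<in>atlas (J r). fst c)" unfolding jet_atlas
      by (intro UN_I[of "(jet_dom F r c, jet_coords F r c)"]) (blast, simp)
  qed
  then show ?thesis unfolding charted_mfd_def using jet_coords_on by (auto simp: jet_atlas)
qed

end

section \<open>Lie brackets and the Levi tensor\<close>

lemma local_section_smooth_near:
  assumes M: "charted_mfd M" and X: "local_section_of M D W X" and p: "p \<in> W" and f: "smooth_near M p f"
  shows "smooth_near M p (\<lambda>q. X q f)"
proof -
  have W: "openin (mtop M) W" using X by (simp add: local_section_of_def)
  obtain W' where W': "openin (mtop M) W'" "p \<in> W'" "W' \<subseteq> W" "smooth_fun M W' f"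
    using smooth_nearE_in[OF f W p] .
  then have "smooth_fun M W' (\<lambda>q. X q f)" using X by (simp add: local_section_of_def)
  then show ?thesis using smooth_nearI[OF W'(1,2)] by simp
qed

text \<open>The Leibniz rule holds because the mixed products \<open>X f \<cdot> Y g\<close> cancel in the commutator. The
  rules for \<open>Y q\<close> at points \<open>q\<close> near \<open>p\<close> hold on a neighbourhood, and \<open>X p\<close> only sees germs.\<close>

lemma lie_bracket_tangent:
  assumes M: "charted_mfd M" and X: "local_section_of M D W X" and Y: "local_section_of M D W' Y"
    and p: "p \<in> W" "p \<in> W'"
  shows "lie_bracket M X Y p \<in> tangent_space M p"
proof -
  have Xp: "X q \<in> tangent_space M q" if "q \<in> W" for q using X that by (simp add: local_section_of_def)
  have Yp: "Y q \<in> tangent_space M q" if "q \<in> W'" for q using Y that by (simp add: local_section_of_def)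
  have op: "openin (mtop M) W" "openin (mtop M) W'" using X Y by (auto simp: local_section_of_def)
  note sX = local_section_smooth_near[OF M X p(1)] and sY = local_section_smooth_near[OF M Y p(2)]
  let ?L = "lie_bracket M X Y p"
  have nbhd: "\<exists>W0. openin (mtop M) W0 \<and> p \<in> W0 \<and> W0 \<subseteq> W \<and> W0 \<subseteq> W' \<and>
      (\<forall>q\<in>W0. smooth_near M q f \<and> smooth_near M q g)"
    if f: "smooth_near M p f" and g: "smooth_near M p g" for f g
  proof -
    obtain W1 where W1: "openin (mtop M) W1" "p \<in> W1" "smooth_fun M W1 f" "smooth_fun M W1 g"
      using smooth_near_binary[OF f g] .
    have "openin (mtop M) (W1 \<inter> (W \<inter> W'))" using W1(1) op by blast
    then show ?thesis using W1 p smooth_nearI[OF W1(1)] by (intro exI[of _ "W1 \<inter> (W \<inter> W')"]) blast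
  qed
  have "?L (\<lambda>x. a * f x + b * g x) = a * ?L f + b * ?L g"
    if f: "smooth_near M p f" and g: "smooth_near M p g" for f g a b
  proof -
    obtain W0 where W0: "openin (mtop M) W0" "p \<in> W0" "W0 \<subseteq> W" "W0 \<subseteq> W'"
      "\<forall>q\<in>W0. smooth_near M q f \<and> smooth_near M q g" using nbhd[OF f g] by blast
    have "X p (\<lambda>q. Y q (\<lambda>x. a * f x + b * g x)) = X p (\<lambda>q. a * Y q f + b * Y q g)"
      by (rule tvec_germ[OF M Xp[OF p(1)] W0(1,2)]) (use W0 tvec_lincomb[OF Yp] in blast)
    moreover have "Y p (\<lambda>q. X q (\<lambda>x. a * f x + b * g x)) = Y p (\<lambda>q. a * X q f + b * X q g)"
      by (rule tvec_germ[OF M Yp[OF p(2)] W0(1,2)]) (use W0 tvec_lincomb[OF Xp] in blast)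
    ultimately show ?thesis
      using f g smooth_near_lincomb[OF M f g] tvec_lincomb[OF Xp[OF p(1)] sY[OF f] sY[OF g]]
        tvec_lincomb[OF Yp[OF p(2)] sX[OF f] sX[OF g]]
      by (simp add: lie_bracket_def algebra_simps)
  qed
  moreover have "?L (\<lambda>x. f x * g x) = f p * ?L g + g p * ?L f"
    if f: "smooth_near M p f" and g: "smooth_near M p g" for f g
  proof -
    obtain W0 where W0: "openin (mtop M) W0" "p \<in> W0" "W0 \<subseteq> W" "W0 \<subseteq> W'"
      "\<forall>q\<in>W0. smooth_near M q f \<and> smooth_near M q g" using nbhd[OF f g] by blast
    have "X p (\<lambda>q. Y q (\<lambda>x. f x * g x)) = X p (\<lambda>q. f q * Y q g + g q * Y q f)"
      by (rule tvec_germ[OF M Xp[OF p(1)] W0(1,2)]) (use W0 tvec_mult[OF Yp] in blast)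
    moreover have "Y p (\<lambda>q. X q (\<lambda>x. f x * g x)) = Y p (\<lambda>q. f q * X q g + g q * X q f)"
      by (rule tvec_germ[OF M Yp[OF p(2)] W0(1,2)]) (use W0 tvec_mult[OF Xp] in blast)
    ultimately show ?thesis
      using f g smooth_near_mult[OF M f g]
        tvec_add[OF Xp[OF p(1)] smooth_near_mult[OF M f sY[OF g]] smooth_near_mult[OF M g sY[OF f]]]
        tvec_add[OF Yp[OF p(2)] smooth_near_mult[OF M f sX[OF g]] smooth_near_mult[OF M g sX[OF f]]]
        tvec_mult[OF Xp[OF p(1)] f sY[OF g]] tvec_mult[OF Xp[OF p(1)] g sY[OF f]]
        tvec_mult[OF Yp[OF p(2)] f sX[OF g]] tvec_mult[OF Yp[OF p(2)] g sX[OF f]]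
      by (simp add: lie_bracket_def algebra_simps)
  qed
  ultimately show ?thesis unfolding tangent_space_def by (simp add: lie_bracket_def)
qed

lemma coord_vec_field:
  assumes M: "charted_mfd M" and c: "coords_on M W \<kappa> B"
    and d: "\<And>b. b \<in> B \<Longrightarrow> smooth_fun M W (\<lambda>q. d q b)"
    and D: "\<And>q. q \<in> W \<Longrightarrow> coord_vec M W \<kappa> B q (d q) \<in> D q"
  shows "local_section_of M D W (\<lambda>q. coord_vec M W \<kappa> B q (d q))"
proof -
  have "smooth_fun M W' (\<lambda>q. coord_vec M W \<kappa> B q (d q) f)"
    if W': "openin (mtop M) W'" "W' \<subseteq> W" and f: "smooth_fun M W' f" for W' f
  proof -
    have cop: "copen B (\<kappa> ` W')" by (rule coords_onD(4)[OF c W'])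
    have "smooth_fun M W' (\<lambda>q. \<Sum>b\<in>B. pd b (f \<circ> inv_into W \<kappa>) (\<kappa> q) * d q b)"
    proof (rule smooth_fun_sum[OF M W'(1)], rule smooth_fun_mult[OF M W'(1)])
      fix b assume b: "b \<in> B"
      show "smooth_fun M W' (\<lambda>q. d q b)" by (rule smooth_fun_subset[OF d[OF b] W'(2)])
      show "smooth_fun M W' (\<lambda>q. pd b (f \<circ> inv_into W \<kappa>) (\<kappa> q))"
        by (rule smooth_fun_compose[OF M W'(1) coords_onD(1)[OF c] cop C_inf_pd[OF coords_onD(7)[OF c W' f] b]])
          (use smooth_fun_subset[OF coords_onD(6)[OF c] W'(2)] in auto)
    qed
    then show ?thesis
      by (rule smooth_fun_cong[OF M W'(1)]) (use smooth_nearI[OF W'(1) _ f] in \<open>auto simp: coord_vec_def\<close>)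
  qed
  then show ?thesis unfolding local_section_of_def
    using coords_onD(2)[OF c] coord_vec_tangent[OF M c] D by blast
qed

section \<open>The Cartan distribution\<close>

context fibred
begin

lemma jet_domE_overlap:
  assumes c: "((V, \<psi>), (U, \<phi>)) \<in> fcharts F" and c': "((V', \<psi>'), (U', \<phi>')) \<in> fcharts F"
    and p: "p \<in> jet_dom F r ((V, \<psi>), (U, \<phi>))" "p \<in> jet_dom F r ((V', \<psi>'), (U', \<phi>'))"
  obtains \<sigma> x where "p = jet_of F r \<sigma> x" "section_near F x \<sigma>" "\<sigma> x \<in> V" "\<sigma> x \<in> V'"
    "jet_coords F r ((V, \<psi>), (U, \<phi>)) p = jet_vec F ((V, \<psi>), (U, \<phi>)) r \<sigma> x"
    "jet_coords F r ((V', \<psi>'), (U', \<phi>')) p = jet_vec F ((V', \<psi>'), (U', \<phi>')) r \<sigma> x"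
proof -
  obtain \<sigma> x where s: "p = jet_of F r \<sigma> x" "section_near F x \<sigma>" "\<sigma> x \<in> fst (fst ((V, \<psi>), (U, \<phi>)))"
    using p(1) by (rule jet_domE)
  have "\<sigma> x \<in> fst (fst ((V', \<psi>'), (U', \<phi>')))" using jet_dom_jet_ofD[OF _ s(2)] p(2) s(1) by blast
  then show ?thesis using that[OF s(1,2)] s jet_coords_jet_of[OF c s(2), of r] jet_coords_jet_of[OF c' s(2), of r] by simp
qed

text \<open>The contact forms of a second chart are combinations of those of the first one: if
  \<open>u'\<^sub>I = G (x, u)\<close> on the overlap, then differentiating this identity along a section gives
  \<open>D\<^sub>l G = \<Sum>\<^sub>i u'\<^bsub>I + e\<^sub>i\<^esub> \<partial>x'\<^sup>i / \<partial>x\<^sup>l\<close>. On the kernel of the first contact forms, \<open>v (G)\<close> equals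
  \<open>\<Sum>\<^sub>l D\<^sub>l G v (x\<^sup>l)\<close>, and the identity turns this into \<open>\<Sum>\<^sub>i u'\<^bsub>I + e\<^sub>i\<^esub> v (x'\<^sup>i)\<close>.\<close>

lemma contact_form_change_of_chart:
  assumes c: "((V, \<psi>), (U, \<phi>)) \<in> fcharts F" and c': "((V', \<psi>'), (U', \<phi>')) \<in> fcharts F"
    and p: "p \<in> jet_dom F r ((V, \<psi>), (U, \<phi>))" "p \<in> jet_dom F r ((V', \<psi>'), (U', \<phi>'))"
    and r: "r \<ge> 1" and v: "v \<in> tangent_space (J r) p"
    and con: "\<And>\<alpha> I. \<alpha> < m \<Longrightarrow> I \<in> multi_indices n (r - 1) \<Longrightarrow> contact_form F r ((V, \<psi>), (U, \<phi>)) \<alpha> I p v = 0"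
    and \<alpha>: "\<alpha> < m" and I: "I \<in> multi_indices n (r - 1)"
  shows "contact_form F r ((V', \<psi>'), (U', \<phi>')) \<alpha> I p v = 0"
proof -
  let ?c = "((V, \<psi>), (U, \<phi>))" and ?c' = "((V', \<psi>'), (U', \<phi>'))"
  note cU = fchartD(2)[OF c] and cU' = fchartD(2)[OF c'] and cV = fchartD(1)[OF c] and cV' = fchartD(1)[OF c']
  note copZ = copen_overlap_jets[OF c coords_onD(2)[OF cV']]
  note charted = jet_bundle_charted[of r]
  obtain \<sigma> x where s: "p = jet_of F r \<sigma> x" "section_near F x \<sigma>" "\<sigma> x \<in> V" "\<sigma> x \<in> V'"
    "jet_coords F r ?c p = jet_vec F ?c r \<sigma> x" "jet_coords F r ?c' p = jet_vec F ?c' r \<sigma> x"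
    using jet_domE_overlap[OF c c' p] .
  define k where "k = (\<Sum>i<n. I i)"
  have I0: "\<forall>i\<ge>n. I i = 0" and k1: "k \<le> r - 1" using I by (auto simp: multi_indices_def k_def)
  have k: "k \<le> r" "Suc k \<le> r" using k1 r by auto
  obtain G where G: "C_inf (jet_idx F k) (overlap_jets V V' \<psi> k) G" "\<And>x \<sigma>. section_near F x \<sigma> \<Longrightarrow> \<sigma> x \<in> V \<Longrightarrow> \<sigma> x \<in> V' \<Longrightarrow>
      section_deriv F ?c' \<alpha> I \<sigma> x = G (jet_vec F ?c k \<sigma> x)"
    using jet_transition[OF c c' \<alpha> I0 k_def[symmetric]] by blast
  define W where "W = jet_dom F r ?c \<inter> jet_dom F r ?c'"
  have W: "openin (mtop (J r)) W" "p \<in> W" using jet_dom_open[OF c, of r] jet_dom_open[OF c', of r] p by (auto simp: W_def)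
  define u where "u = (\<lambda>a. v (\<lambda>j. jet_coords F r ?c j a))"
  have smc: "smooth_fun (J r) W (\<lambda>j. jet_coords F r ?c j a)" if "a \<in> jet_idx F r" for a
    by (rule smooth_fun_subset[OF coords_onD(6)[OF jet_coords_on[OF c] that]]) (simp add: W_def)
  have Ir: "I \<in> multi_indices n r" using I multi_indices_mono[of "r - 1" r n] by auto
  \<comment> \<open>The hypothesis on \<open>v\<close>, solved for the components of \<open>v\<close> in the derivative coordinates.\<close>
  have con': "u (Deriv \<beta> K) = (\<Sum>l<n. jet_coords F r ?c p (Deriv \<beta> (add_index K l)) * u (Base l))"
    if "\<beta> < m" "K \<in> multi_indices n k" for \<beta> K
  proof -
    have "K \<in> multi_indices n (r - 1)" using that(2) multi_indices_mono[OF k1, of n] by blast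
    then show ?thesis using con[OF that(1), of K] by (simp add: contact_form_def u_def)
  qed
  have "v (\<lambda>j. jet_coords F r ?c' j (Deriv \<alpha> I)) = v (\<lambda>j. G (truncate_jet F k (jet_coords F r ?c j)))"
  proof (rule tvec_germ[OF charted v W], intro ballI)
    fix j assume "j \<in> W"
    then obtain \<tau> y where t: "section_near F y \<tau>" "\<tau> y \<in> V" "\<tau> y \<in> V'" "jet_coords F r ?c j = jet_vec F ?c r \<tau> y"
      "jet_coords F r ?c' j = jet_vec F ?c' r \<tau> y" using jet_domE_overlap[OF c c'] unfolding W_def by blast
    then show "jet_coords F r ?c' j (Deriv \<alpha> I) = G (truncate_jet F k (jet_coords F r ?c j))"
      using G(2)[OF t(1-3)] truncate_jet_vec[OF k(1), of F ?c \<tau> y] \<alpha> Ir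
      by (simp add: jet_vec_def[of F ?c' r] Deriv_in_jet_idx)
  qed
  also have "\<dots> = (\<Sum>a\<in>jet_idx F k. pd a G (truncate_jet F k (jet_coords F r ?c p)) * v (\<lambda>j. truncate_jet F k (jet_coords F r ?c j) a))"
  proof (rule tvec_chain[OF charted v W finite_jet_idx copZ G(1)])
    show "smooth_fun (J r) W (\<lambda>q. truncate_jet F k (jet_coords F r ?c q) b)" if "b \<in> jet_idx F k" for b
      using smc jet_idx_mono[OF k(1), of F] that by (auto simp: truncate_jet_def)
    fix j assume "j \<in> W"
    then obtain \<tau> y where t: "section_near F y \<tau>" "\<tau> y \<in> V" "\<tau> y \<in> V'" "jet_coords F r ?c j = jet_vec F ?c r \<tau> y"
      using jet_domE_overlap[OF c c'] unfolding W_def by blast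
    then show "truncate_jet F k (jet_coords F r ?c j) \<in> overlap_jets V V' \<psi> k"
      using total_part_jet_vec(1)[OF c t(1,2), of r]
      by (auto simp: overlap_jets_def truncate_coord_space total_part_truncate)
  qed
  also have "\<dots> = (\<Sum>a\<in>jet_idx F k. pd a G (truncate_jet F k (jet_coords F r ?c p)) * u a)"
    by (rule sum.cong) (auto simp: truncate_jet_def u_def)
  also have "\<dots> = (\<Sum>l<n. pd (Base l) G (truncate_jet F k (jet_coords F r ?c p)) * u (Base l)) +
     (\<Sum>(\<beta>, K)\<in>{..<m} \<times> multi_indices n k. pd (Deriv \<beta> K) G (truncate_jet F k (jet_coords F r ?c p)) *
        (\<Sum>l<n. jet_coords F r ?c p (Deriv \<beta> (add_index K l)) * u (Base l)))"
    unfolding sum_jet_idx by (intro arg_cong2[of _ _ _ _ "(+)"] refl sum.cong) (auto simp: con')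
  also have "\<dots> = (\<Sum>l<n. total_deriv F k l G (jet_coords F r ?c p) * u (Base l))"
    unfolding total_deriv_def split_beta sum_distrib_left sum_distrib_right distrib_right sum.distrib
    by (subst (2) sum.swap) (simp add: mult_ac)
  finally have lhs: "v (\<lambda>j. jet_coords F r ?c' j (Deriv \<alpha> I)) =
      (\<Sum>l<n. total_deriv F k l G (jet_coords F r ?c p) * u (Base l))" .
  have VV: "openin (mtop E) (V \<inter> V')" using coords_onD(2)[OF cV] coords_onD(2)[OF cV'] by blast
  have sVV: "\<sigma> x \<in> V \<inter> V'" using s by blast
  obtain N where N: "openin (mtop Q) N" "x \<in> N" "\<And>x'. x' \<in> N \<Longrightarrow> section_near F x' \<sigma>"
    "\<And>x'. x' \<in> N \<Longrightarrow> \<sigma> x' \<in> V \<inter> V'" "\<And>x'. x' \<in> N \<Longrightarrow> prj F (\<sigma> x') = x'"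
    "\<And>V'' \<psi> U \<phi>. ((V'', \<psi>), (U, \<phi>)) \<in> fcharts F \<Longrightarrow> V \<inter> V' \<subseteq> V'' \<Longrightarrow> N \<subseteq> U"
    "\<And>V'' \<psi> U \<phi> k. ((V'', \<psi>), (U, \<phi>)) \<in> fcharts F \<Longrightarrow> V \<inter> V' \<subseteq> V'' \<Longrightarrow> k < mdim E \<Longrightarrow>
      C_inf {..<n} (\<phi> ` N) (\<lambda>y. \<psi> (\<sigma> (inv_into U \<phi> y)) k)"
    using section_nhd[OF s(2) VV sVV] by blast
  have dim: "n + m = mdim E" by (rule fchart_dim[OF c s(3)])
  have NU: "N \<subseteq> U" "N \<subseteq> U'" using N(6)[OF c] N(6)[OF c'] by auto
  have inv: "inv_into U \<phi> (\<phi> x') = x'" "inv_into U' \<phi>' (\<phi>' x') = x'" if "x' \<in> N" for x'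
    using that NU inv_into_f_f[OF coords_onD(3)[OF cU]] inv_into_f_f[OF coords_onD(3)[OF cU']] by auto
  have sm: "C_inf {..<n} (\<phi> ` N) (\<lambda>y. \<psi> (\<sigma> (inv_into U \<phi> y)) (n + \<beta>))" if "\<beta> < m" for \<beta>
    by (rule N(7)[OF c]) (use dim that in auto)
  define f' where "f' = (\<lambda>y. \<psi>' (\<sigma> (inv_into U' \<phi>' y)) (n + \<alpha>))"
  have f': "C_inf {..<n} (\<phi>' ` N) f'" unfolding f'_def by (rule N(7)[OF c']) (use dim \<alpha> in auto)
  have jZ: "jet_vec F ?c k \<sigma> x' \<in> overlap_jets V V' \<psi> k" if "x' \<in> N" for x'
    using total_part_jet_vec(1)[OF c N(3)[OF that], of k] N(4)[OF that]
    by (auto simp: overlap_jets_def jet_vec_coord_space)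
  have along: "pd l (\<lambda>y. G (jet_vec F ?c k \<sigma> (inv_into U \<phi> y))) (\<phi> x) =
      total_deriv F k l G (jet_vec F ?c (Suc k) \<sigma> x)" if "l < n" for l
    by (rule pd_along_section(2)[OF c N(1) NU(1) sm copZ G(1) jZ N(2) that])
  have copN: "copen {..<n} (\<phi> ` N)" "copen {..<n} (\<phi>' ` N)"
    using coords_onD(4)[OF cU N(1) NU(1)] coords_onD(4)[OF cU' N(1) NU(2)] by blast+
  define t where "t = (\<lambda>y. \<phi>' (inv_into U \<phi> y))"
  have tc: "C_inf {..<n} (\<phi> ` N) (\<lambda>y. t y i)" if "i \<in> {..<n}" for i
    unfolding t_def by (rule C_inf_subset[OF _ base_transition[OF c c']]) (use that NU in auto)
  have D: "total_deriv F k l G (jet_coords F r ?c p) =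
      (\<Sum>i<n. jet_coords F r ?c' p (Deriv \<alpha> (add_index I i)) * pd l (\<lambda>y. t y i) (\<phi> x))" if l: "l < n" for l
  proof -
    have "total_deriv F k l G (jet_coords F r ?c p) = total_deriv F k l G (jet_vec F ?c (Suc k) \<sigma> x)"
    proof -
      have *: "jet_vec F ?c r \<sigma> x (Deriv \<beta> (add_index K l)) = jet_vec F ?c (Suc k) \<sigma> x (Deriv \<beta> (add_index K l))"
        if "\<beta> < m" "K \<in> multi_indices n k" for \<beta> K
        using add_index_multi_indices[OF that(2) l] multi_indices_mono[OF k(2), of n] that(1)
        by (auto simp: jet_vec_def Deriv_in_jet_idx)
      have "truncate_jet F k (jet_vec F ?c (Suc k) \<sigma> x) = jet_vec F ?c k \<sigma> x" by (rule truncate_jet_vec) simp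
      then show ?thesis
        unfolding s(5) total_deriv_def truncate_jet_vec[OF k(1)]
        using * by (auto intro!: sum.cong)
    qed
    also have "\<dots> = pd l (\<lambda>y. G (jet_vec F ?c k \<sigma> (inv_into U \<phi> y))) (\<phi> x)" by (rule along[OF l, symmetric])
    also have "\<dots> = pd l (\<lambda>y. mpd n I f' (t y)) (\<phi> x)"
    proof (rule pd_cong[OF _ copN(1)])
      show "\<forall>y\<in>\<phi> ` N. G (jet_vec F ?c k \<sigma> (inv_into U \<phi> y)) = mpd n I f' (t y)"
      proof
        fix y assume "y \<in> \<phi> ` N"
        then obtain x' where x': "x' \<in> N" "y = \<phi> x'" by blast
        have "section_deriv F ?c' \<alpha> I \<sigma> x' = G (jet_vec F ?c k \<sigma> x')" using G(2) N(3,4) x'(1) by blast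
        then show "G (jet_vec F ?c k \<sigma> (inv_into U \<phi> y)) = mpd n I f' (t y)"
          using inv[OF x'(1)] by (simp add: x'(2) t_def f'_def section_deriv_def)
      qed
    qed (use N(2) l in auto)
    also have "\<dots> = (\<Sum>i<n. pd i (mpd n I f') (t (\<phi> x)) * pd l (\<lambda>y. t y i) (\<phi> x))"
      by (rule pd_compose[OF _ copN(2) _ copN(1) _ C_inf_mpd[OF order.refl f'] tc])
        (use inv N(2) l in \<open>auto simp: t_def\<close>)
    also have "\<dots> = (\<Sum>i<n. jet_coords F r ?c' p (Deriv \<alpha> (add_index I i)) * pd l (\<lambda>y. t y i) (\<phi> x))"
    proof (rule sum.cong)
      fix i assume "i \<in> {..<n}"
      then have i: "i < n" by simp
      have tx: "t (\<phi> x) = \<phi>' x" using inv N(2) by (simp add: t_def)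
      have "add_index I i \<in> multi_indices n r" using add_index_multi_indices[OF I i] r by simp
      then have "jet_coords F r ?c' p (Deriv \<alpha> (add_index I i)) = mpd n (add_index I i) f' (\<phi>' x)"
        using \<alpha> by (simp add: s(6) jet_vec_def Deriv_in_jet_idx section_deriv_def f'_def)
      moreover have "pd i (mpd n I f') (\<phi>' x) = mpd n (add_index I i) f' (\<phi>' x)"
        by (rule pd_mpd[OF copN(2) i f']) (use N(2) in blast)
      ultimately show "pd i (mpd n I f') (t (\<phi> x)) * pd l (\<lambda>y. t y i) (\<phi> x) =
        jet_coords F r ?c' p (Deriv \<alpha> (add_index I i)) * pd l (\<lambda>y. t y i) (\<phi> x)" by (simp add: tx)
    qed simp
    finally show ?thesis .
  qed
  have base: "v (\<lambda>j. jet_coords F r ?c' j (Base i)) = (\<Sum>l<n. pd l (\<lambda>y. t y i) (\<phi> x) * u (Base l))" if i: "i < n" for i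
  proof -
    have UU: "openin (mtop Q) (U \<inter> U')" using coords_onD(2)[OF cU] coords_onD(2)[OF cU'] by blast
    have tUU: "C_inf {..<n} (\<phi> ` (U \<inter> U')) (\<lambda>y. t y i)" unfolding t_def by (rule base_transition[OF c c' i])
    have bp: "base_part F (jet_coords F r ?c j) \<in> \<phi> ` (U \<inter> U') \<and>
        jet_coords F r ?c' j (Base i) = t (base_part F (jet_coords F r ?c j)) i" if "j \<in> W" for j
    proof -
      obtain \<tau> y where ty: "section_near F y \<tau>" "\<tau> y \<in> V" "\<tau> y \<in> V'" "jet_coords F r ?c j = jet_vec F ?c r \<tau> y"
        "jet_coords F r ?c' j = jet_vec F ?c' r \<tau> y"
        using jet_domE_overlap[OF c c'] \<open>j \<in> W\<close> unfolding W_def by blast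
      have y: "y \<in> U" "y \<in> U'" using total_part_jet_vec(3)[OF c ty(1,2)] total_part_jet_vec(3)[OF c' ty(1,3)] by auto
      have "base_part F (jet_coords F r ?c j) = \<phi> y" unfolding ty(4) by (rule base_part_jet_vec[OF c y(1)])
      then show ?thesis using y i inv_into_f_f[OF coords_onD(3)[OF cU] y(1)] ty(5)
        by (simp add: t_def jet_vec_def Base_in_jet_idx)
    qed
    have "v (\<lambda>j. jet_coords F r ?c' j (Base i)) = v (\<lambda>j. t (base_part F (jet_coords F r ?c j)) i)"
      by (rule tvec_germ[OF charted v W]) (use bp in blast)
    also have "\<dots> = (\<Sum>l<n. pd l (\<lambda>y. t y i) (base_part F (jet_coords F r ?c p)) * v (\<lambda>j. base_part F (jet_coords F r ?c j) l))"
    proof (rule tvec_chain[OF charted v W finite_lessThan coords_onD(4)[OF cU UU Int_lower1] tUU])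
      show "smooth_fun (J r) W (\<lambda>q. base_part F (jet_coords F r ?c q) b)" if "b \<in> {..<n}" for b
        using smc[of "Base b"] that by (simp add: base_part_def Base_in_jet_idx)
    qed (use bp in auto)
    also have "\<dots> = (\<Sum>l<n. pd l (\<lambda>y. t y i) (\<phi> x) * u (Base l))"
      unfolding s(5) base_part_jet_vec[OF c total_part_jet_vec(3)[OF c s(2,3)]]
      by (rule sum.cong) (auto simp: base_part_def u_def)
    finally show ?thesis .
  qed
  have "(\<Sum>i<n. jet_coords F r ?c' p (Deriv \<alpha> (add_index I i)) * v (\<lambda>j. jet_coords F r ?c' j (Base i)))
      = (\<Sum>i<n. \<Sum>l<n. jet_coords F r ?c' p (Deriv \<alpha> (add_index I i)) * pd l (\<lambda>y. t y i) (\<phi> x) * u (Base l))"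
    by (rule sum.cong) (simp_all add: base sum_distrib_left mult.assoc)
  also have "\<dots> = (\<Sum>l<n. \<Sum>i<n. jet_coords F r ?c' p (Deriv \<alpha> (add_index I i)) * pd l (\<lambda>y. t y i) (\<phi> x) * u (Base l))"
    by (rule sum.swap)
  also have "\<dots> = (\<Sum>l<n. total_deriv F k l G (jet_coords F r ?c p) * u (Base l))"
    by (rule sum.cong) (simp_all add: D sum_distrib_right)
  finally show ?thesis using lhs by (simp add: contact_form_def)
qed

lemma cartan_iff:
  assumes c: "c \<in> fcharts F" "p \<in> jet_dom F r c" and r: "r \<ge> 1" and v: "v \<in> tangent_space (J r) p"
  shows "v \<in> cartan_distribution F r p \<longleftrightarrow>
    (\<forall>\<alpha><m. \<forall>I\<in>multi_indices n (r - 1). contact_form F r c \<alpha> I p v = 0)"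
proof
  assume con: "\<forall>\<alpha><m. \<forall>I\<in>multi_indices n (r - 1). contact_form F r c \<alpha> I p v = 0"
  obtain V \<psi> U \<phi> where ceq: "c = ((V, \<psi>), (U, \<phi>))" by (metis prod.collapse)
  have "contact_form F r c' \<alpha> I p v = 0"
    if c': "c' \<in> fcharts F" "p \<in> jet_dom F r c'" and \<alpha>: "\<alpha> < m" "I \<in> multi_indices n (r - 1)" for c' \<alpha> I
  proof -
    obtain V' \<psi>' U' \<phi>' where c'eq: "c' = ((V', \<psi>'), (U', \<phi>'))" by (metis prod.collapse)
    show ?thesis unfolding c'eq
      by (rule contact_form_change_of_chart[OF c(1)[unfolded ceq] c'(1)[unfolded c'eq] c(2)[unfolded ceq]
          c'(2)[unfolded c'eq] r v _ \<alpha>]) (use con in \<open>auto simp: ceq\<close>)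
  qed
  then show "v \<in> cartan_distribution F r p" using v by (simp add: cartan_distribution_def)
qed (use c in \<open>auto simp: cartan_distribution_def\<close>)

lemma cartan_lincomb:
  assumes "v \<in> cartan_distribution F r p" "w \<in> cartan_distribution F r p"
  shows "(\<lambda>f. a * v f + b * w f) \<in> cartan_distribution F r p"
proof -
  have "contact_form F r c \<alpha> I p (\<lambda>f. a * v f + b * w f) = a * contact_form F r c \<alpha> I p v + b * contact_form F r c \<alpha> I p w" for c \<alpha> I
    by (simp add: contact_form_def algebra_simps sum.distrib sum_distrib_left)
  moreover have "(\<lambda>f. a * v f + b * w f) \<in> tangent_space (J r) p"
    by (rule tangent_space_lincomb) (use assms in \<open>simp_all add: cartan_distribution_def\<close>)
  ultimately show ?thesis using assms unfolding cartan_distribution_def by simp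
qed

lemma jet_proj_jet_of:
  assumes "s \<le> r" "section_near F x \<sigma>"
  shows "jet_proj F s (jet_of F r \<sigma> x) = jet_of F s \<sigma> x"
proof -
  have "{\<tau>. \<exists>\<rho>\<in>{\<tau>. jet_eq F r x \<sigma> \<tau>}. jet_eq F s x \<rho> \<tau>} = {\<tau>. jet_eq F s x \<sigma> \<tau>}"
  proof (intro equalityI subsetI)
    fix \<tau> assume "\<tau> \<in> {\<tau>. \<exists>\<rho>\<in>{\<tau>. jet_eq F r x \<sigma> \<tau>}. jet_eq F s x \<rho> \<tau>}"
    then obtain \<rho> where "jet_eq F r x \<sigma> \<rho>" "jet_eq F s x \<rho> \<tau>" by blast
    then show "\<tau> \<in> {\<tau>. jet_eq F s x \<sigma> \<tau>}" using jet_eq_trans[OF jet_eq_mono[OF assms(1)]] by simp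
  qed (use jet_eq_refl[OF assms(2)] in blast)
  then show ?thesis by (simp add: jet_proj_def jet_of_def)
qed

lemma jet_proj_coords:
  assumes c: "c \<in> fcharts F" and p: "p \<in> jet_dom F r c" and s: "s \<le> r"
  shows "jet_proj F s p \<in> jet_dom F s c"
    "jet_coords F s c (jet_proj F s p) = truncate_jet F s (jet_coords F r c p)"
proof -
  obtain \<sigma> x where j: "p = jet_of F r \<sigma> x" "section_near F x \<sigma>" "\<sigma> x \<in> fst (fst c)" using p by (rule jet_domE)
  show "jet_proj F s p \<in> jet_dom F s c" unfolding j(1) jet_proj_jet_of[OF s j(2)] by (rule jet_domI[OF j(2,3)])
  show "jet_coords F s c (jet_proj F s p) = truncate_jet F s (jet_coords F r c p)"
    unfolding j(1) jet_proj_jet_of[OF s j(2)] jet_coords_jet_of[OF c j(2,3)] truncate_jet_vec[OF s] ..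
qed

text \<open>In adapted coordinates the projection to jets of lower order forgets the derivatives of the
  highest order, so its differential vanishes on exactly the vectors with no other components.\<close>

lemma vertical_iff:
  assumes c: "c \<in> fcharts F" "p \<in> jet_dom F r c" and v: "v \<in> tangent_space (J r) p"
  shows "v \<in> vertical_polarisation F r p \<longleftrightarrow>
    (\<forall>a\<in>jet_idx F (r - 1). v (\<lambda>j. jet_coords F r c j a) = 0)"
proof -
  define s where "s = r - 1"
  have s: "s \<le> r" by (simp add: s_def)
  let ?q = "jet_proj F s p"
  note charted = jet_bundle_charted[of r] and cs = jet_coords_on[OF c(1), of s] and cr = jet_coords_on[OF c(1), of r]
  have q: "?q \<in> jet_dom F s c" by (rule jet_proj_coords(1)[OF c s])
  have ver: "v \<in> vertical_polarisation F r p \<longleftrightarrow> tangent_map (J s) (jet_proj F s) p v = tzero"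
    using v by (simp add: vertical_polarisation_def s_def)
  show ?thesis unfolding ver s_def[symmetric]
  proof
    assume z: "tangent_map (J s) (jet_proj F s) p v = tzero"
    show "\<forall>a\<in>jet_idx F s. v (\<lambda>j. jet_coords F r c j a) = 0"
    proof
      fix a assume a: "a \<in> jet_idx F s"
      let ?g = "\<lambda>j. jet_coords F s c j a"
      have "smooth_near (J s) ?q ?g" by (rule smooth_nearI[OF coords_onD(2)[OF cs] q coords_onD(6)[OF cs a]])
      then have "v (?g \<circ> jet_proj F s) = 0" using fun_cong[OF z, of ?g] by (simp add: tangent_map_def tzero_def)
      moreover have "v (?g \<circ> jet_proj F s) = v (\<lambda>j. jet_coords F r c j a)"
        by (rule tvec_germ[OF charted v coords_onD(2)[OF cr] c(2)])
          (use jet_proj_coords(2)[OF c(1) _ s] a in \<open>auto simp: truncate_jet_def\<close>)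
      ultimately show "v (\<lambda>j. jet_coords F r c j a) = 0" by simp
    qed
  next
    assume z: "\<forall>a\<in>jet_idx F s. v (\<lambda>j. jet_coords F r c j a) = 0"
    have "v (g \<circ> jet_proj F s) = 0" if g: "smooth_near (J s) ?q g" for g
    proof -
      obtain W where W: "openin (mtop (J s)) W" "?q \<in> W" "W \<subseteq> jet_dom F s c" "smooth_fun (J s) W g"
        using smooth_nearE_in[OF g coords_onD(2)[OF cs] q] .
      define h where "h = g \<circ> inv_into (jet_dom F s c) (jet_coords F s c)"
      let ?Z = "jet_coords F s c ` W"
      have h: "C_inf (jet_idx F s) ?Z h" unfolding h_def by (rule coords_onD(7)[OF cs W(1,3,4)])
      have cop: "copen (jet_idx F s) ?Z" by (rule coords_onD(4)[OF cs W(1,3)])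
      let ?F = "\<lambda>j. truncate_jet F s (jet_coords F r c j)"
      define W0 where "W0 = {j \<in> jet_dom F r c. ?F j \<in> ?Z}"
      have smF: "smooth_fun (J r) (jet_dom F r c) (\<lambda>j. ?F j b)" if "b \<in> jet_idx F s" for b
        using coords_onD(6)[OF cr, of b] jet_idx_mono[OF s, of F] that by (auto simp: truncate_jet_def)
      have W0: "openin (mtop (J r)) W0" unfolding W0_def
        by (rule smooth_fun_preimage_open[OF charted coords_onD(2)[OF cr] cop smF truncate_coord_space])
      have pW0: "p \<in> W0" using c(2) imageI[OF W(2), of "jet_coords F s c"] jet_proj_coords(2)[OF c s] by (simp add: W0_def)
      have "v (g \<circ> jet_proj F s) = v (\<lambda>j. h (?F j))"
      proof (rule tvec_germ[OF charted v W0 pW0], intro ballI)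
        fix j assume "j \<in> W0"
        then have j: "j \<in> jet_dom F r c" by (simp add: W0_def)
        show "(g \<circ> jet_proj F s) j = h (?F j)"
          using jet_proj_coords[OF c(1) j s] inv_into_f_f[OF coords_onD(3)[OF cs], of "jet_proj F s j"]
          by (simp add: h_def flip: jet_proj_coords(2)[OF c(1) j s])
      qed
      also have "\<dots> = (\<Sum>b\<in>jet_idx F s. pd b h (?F p) * v (\<lambda>j. ?F j b))"
        by (rule tvec_chain[OF charted v W0 pW0 finite_jet_idx cop h])
          (use smooth_fun_subset[OF smF] in \<open>auto simp: W0_def\<close>)
      also have "\<dots> = 0" by (rule sum.neutral) (use z in \<open>auto simp: truncate_jet_def\<close>)
      finally show ?thesis .
    qed
    then show "tangent_map (J s) (jet_proj F s) p v = tzero" by (auto simp: tangent_map_def tzero_def)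
  qed
qed

text \<open>For a field \<open>Y\<close> in the Cartan distribution the identity
  \<open>Y u\<^sub>I = \<Sum>\<^sub>i u\<^bsub>I + e\<^sub>i\<^esub> Y x\<^sup>i\<close> holds on an open set and may be differentiated along \<open>X\<close>. The second
  derivatives of the coordinates then cancel in the bracket, up to a term that only depends on the
  values of \<open>X\<close> and \<open>Y\<close> at the point.\<close>

lemma bracket_in_cartan:
  assumes r: "r \<ge> 1" and X: "local_section_of (J r) (cartan_distribution F r) W X"
    and Y: "local_section_of (J r) (cartan_distribution F r) W Y" and p: "p \<in> W"
    and sym: "\<And>c \<alpha> I. c \<in> fcharts F \<Longrightarrow> p \<in> jet_dom F r c \<Longrightarrow> \<alpha> < m \<Longrightarrow> I \<in> multi_indices n (r - 1) \<Longrightarrow>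
      (\<Sum>i<n. X p (\<lambda>j. jet_coords F r c j (Deriv \<alpha> (add_index I i))) * Y p (\<lambda>j. jet_coords F r c j (Base i))) =
      (\<Sum>i<n. Y p (\<lambda>j. jet_coords F r c j (Deriv \<alpha> (add_index I i))) * X p (\<lambda>j. jet_coords F r c j (Base i)))"
  shows "lie_bracket (J r) X Y p \<in> cartan_distribution F r p"
proof -
  note charted = jet_bundle_charted[of r]
  have W: "openin (mtop (J r)) W" using X by (simp add: local_section_of_def)
  have pc: "p \<in> carr (J r)" using openin_subset[OF W] p by blast
  have "contact_form F r c \<alpha> I p (lie_bracket (J r) X Y p) = 0"
    if c: "c \<in> fcharts F" "p \<in> jet_dom F r c" and \<alpha>: "\<alpha> < m" and I: "I \<in> multi_indices n (r - 1)" for c \<alpha> I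
  proof -
    note cr = jet_coords_on[OF c(1), of r]
    let ?u = "\<lambda>i j. jet_coords F r c j (Deriv \<alpha> (add_index I i))" and ?x = "\<lambda>i j. jet_coords F r c j (Base i)"
      and ?w = "\<lambda>j. jet_coords F r c j (Deriv \<alpha> I)"
    have near: "smooth_near (J r) p (\<lambda>j. jet_coords F r c j a)" if "a \<in> jet_idx F r" for a
      by (rule smooth_nearI[OF coords_onD(2)[OF cr] c(2) coords_onD(6)[OF cr that]])
    have "add_index I i \<in> multi_indices n r" if "i < n" for i using add_index_multi_indices[OF I that] r by simp
    then have u: "smooth_near (J r) p (?u i)" if "i < n" for i using near \<alpha> that by (simp add: Deriv_in_jet_idx)
    have x: "smooth_near (J r) p (?x i)" if "i < n" for i using near that by (simp add: Base_in_jet_idx)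
    have w: "smooth_near (J r) p ?w" using near \<alpha> I multi_indices_mono[of "r - 1" r n] by (auto simp: Deriv_in_jet_idx)
    have key: "A p (\<lambda>q. B q ?w) = (\<Sum>i<n. ?u i p * A p (\<lambda>q. B q (?x i)) + B p (?x i) * A p (?u i))"
      if A: "local_section_of (J r) (cartan_distribution F r) W A"
        and B: "local_section_of (J r) (cartan_distribution F r) W B" for A B
    proof -
      have Ap: "A p \<in> tangent_space (J r) p" using A p by (simp add: local_section_of_def)
      have Bx: "smooth_near (J r) p (\<lambda>q. B q (?x i))" if "i < n" for i
        by (rule local_section_smooth_near[OF charted B p x[OF that]])
      have W0: "openin (mtop (J r)) (W \<inter> jet_dom F r c)" using W coords_onD(2)[OF cr] by blast
      have "A p (\<lambda>q. B q ?w) = A p (\<lambda>q. \<Sum>i<n. ?u i q * B q (?x i))"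
      proof (rule tvec_germ[OF charted Ap W0], use p c(2) in blast, intro ballI)
        fix q assume q: "q \<in> W \<inter> jet_dom F r c"
        then have "B q \<in> cartan_distribution F r q" using B by (simp add: local_section_of_def)
        then have "contact_form F r c \<alpha> I q (B q) = 0" using c(1) q \<alpha> I by (simp add: cartan_distribution_def)
        then show "B q ?w = (\<Sum>i<n. ?u i q * B q (?x i))" by (simp add: contact_form_def)
      qed
      also have "\<dots> = (\<Sum>i<n. A p (\<lambda>q. ?u i q * B q (?x i)))"
        by (rule tvec_sum[OF charted Ap pc _ , THEN conjunct2]) (use smooth_near_mult[OF charted u Bx] in auto)
      also have "\<dots> = (\<Sum>i<n. ?u i p * A p (\<lambda>q. B q (?x i)) + B p (?x i) * A p (?u i))"
        by (rule sum.cong) (use tvec_mult[OF Ap u Bx] in auto)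
      finally show ?thesis .
    qed
    have "lie_bracket (J r) X Y p ?w = X p (\<lambda>q. Y q ?w) - Y p (\<lambda>q. X q ?w)"
      using w by (simp add: lie_bracket_def)
    also have "\<dots> = (\<Sum>i<n. ?u i p * (X p (\<lambda>q. Y q (?x i)) - Y p (\<lambda>q. X q (?x i))))"
      unfolding key[OF X Y] key[OF Y X] sum.distrib right_diff_distrib sum_subtractf
      using sym[OF c \<alpha> I] by (simp add: mult.commute)
    also have "\<dots> = (\<Sum>i<n. ?u i p * lie_bracket (J r) X Y p (?x i))"
      by (rule sum.cong) (use x in \<open>auto simp: lie_bracket_def\<close>)
    finally show ?thesis by (simp add: contact_form_def)
  qed
  then show ?thesis
    using lie_bracket_tangent[OF charted X Y p p] by (simp add: cartan_distribution_def)
qed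

text \<open>Keep the components of \<open>v\<close> along the base coordinates and the derivatives of order \<open>r\<close> constant; the
  contact forms prescribe the remaining ones at every point.\<close>

lemma cartan_extension:
  assumes c: "c \<in> fcharts F" "p \<in> jet_dom F r c" and r: "r \<ge> 1" and v: "v \<in> cartan_distribution F r p"
  obtains X where "local_section_of (J r) (cartan_distribution F r) (jet_dom F r c) X" "X p = v"
proof -
  note charted = jet_bundle_charted[of r] and cr = jet_coords_on[OF c(1), of r]
  have vt: "v \<in> tangent_space (J r) p" using v by (simp add: cartan_distribution_def)
  define d where "d q a = (case a of Base i \<Rightarrow> v (\<lambda>j. jet_coords F r c j (Base i))
    | Deriv \<alpha> I \<Rightarrow> if I \<in> multi_indices n (r - 1)
        then \<Sum>i<n. jet_coords F r c q (Deriv \<alpha> (add_index I i)) * v (\<lambda>j. jet_coords F r c j (Base i))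
        else v (\<lambda>j. jet_coords F r c j (Deriv \<alpha> I)))" for q a
  define X where "X q = coord_vec (J r) (jet_dom F r c) (jet_coords F r c) (jet_idx F r) q (d q)" for q
  have Xt: "X q \<in> tangent_space (J r) q" if "q \<in> jet_dom F r c" for q
    unfolding X_def by (rule coord_vec_tangent[OF charted cr that])
  have Xc: "X q (\<lambda>j. jet_coords F r c j a) = d q a" if "q \<in> jet_dom F r c" "a \<in> jet_idx F r" for q a
    unfolding X_def by (rule coord_vec_coord[OF charted cr that])
  have mi: "I \<in> multi_indices n r" if "I \<in> multi_indices n (r - 1)" for I
    using that multi_indices_mono[of "r - 1" r n] by auto
  have ai: "add_index I i \<in> multi_indices n r" if "I \<in> multi_indices n (r - 1)" "i < n" for I i
    using add_index_multi_indices[OF that] r by simp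
  have "X q \<in> cartan_distribution F r q" if q: "q \<in> jet_dom F r c" for q
    unfolding cartan_iff[OF c(1) q r Xt[OF q]] contact_form_def
    using Xc[OF q] mi by (auto simp: Deriv_in_jet_idx Base_in_jet_idx d_def)
  moreover have "smooth_fun (J r) (jet_dom F r c) (\<lambda>q. d q a)" if a: "a \<in> jet_idx F r" for a
  proof (cases a)
    case (Base i)
    then show ?thesis by (simp add: d_def smooth_fun_const[OF charted coords_onD(2)[OF cr]])
  next
    case (Deriv \<alpha> I)
    have \<alpha>: "\<alpha> < m" using a Deriv by (simp add: Deriv_in_jet_idx)
    show ?thesis
    proof (cases "I \<in> multi_indices n (r - 1)")
      case True
      have "smooth_fun (J r) (jet_dom F r c)
          (\<lambda>q. \<Sum>i<n. jet_coords F r c q (Deriv \<alpha> (add_index I i)) * v (\<lambda>j. jet_coords F r c j (Base i)))"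
        by (intro smooth_fun_sum[OF charted coords_onD(2)[OF cr]] smooth_fun_mult[OF charted coords_onD(2)[OF cr]]
            smooth_fun_const[OF charted coords_onD(2)[OF cr]] coords_onD(6)[OF cr])
          (use \<alpha> ai[OF True] in \<open>auto simp: Deriv_in_jet_idx\<close>)
      then show ?thesis using True Deriv by (simp add: d_def)
    next
      case False
      then show ?thesis using Deriv by (simp add: d_def smooth_fun_const[OF charted coords_onD(2)[OF cr]])
    qed
  qed
  ultimately have "local_section_of (J r) (cartan_distribution F r) (jet_dom F r c) X"
    unfolding X_def by (intro coord_vec_field[OF charted cr]) (auto simp: X_def)
  moreover have "X p = v"
  proof (rule tvec_eqI[OF charted Xt[OF c(2)] vt cr c(2)])
    fix a assume a: "a \<in> jet_idx F r"
    have "d p a = v (\<lambda>j. jet_coords F r c j a)"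
    proof (cases a)
      case (Deriv \<alpha> I)
      then have "\<alpha> < m" using a by (simp add: Deriv_in_jet_idx)
      then have "I \<in> multi_indices n (r - 1) \<Longrightarrow> contact_form F r c \<alpha> I p v = 0"
        using v c by (simp add: cartan_distribution_def)
      then show ?thesis using Deriv by (simp add: d_def contact_form_def)
    qed (simp add: d_def)
    then show "X p (\<lambda>q. jet_coords F r c q a) = v (\<lambda>q. jet_coords F r c q a)" using Xc[OF c(2) a] by simp
  qed
  ultimately show ?thesis using that by blast
qed

text \<open>By \<open>bracket_in_cartan\<close> the symmetry condition puts the bracket of every pair of extensions of \<open>a\<close>
  and \<open>b\<close> into the distribution, so that the coset defining the Levi tensor is the zero coset; that
  extensions exist makes it nonempty.\<close>

lemma levi_eqI:
  assumes r: "r \<ge> 1" and c0: "c0 \<in> fcharts F" "p \<in> jet_dom F r c0"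
    and a: "a \<in> cartan_distribution F r p" and b: "b \<in> cartan_distribution F r p"
    and sym: "\<And>c \<alpha> I. c \<in> fcharts F \<Longrightarrow> p \<in> jet_dom F r c \<Longrightarrow> \<alpha> < m \<Longrightarrow> I \<in> multi_indices n (r - 1) \<Longrightarrow>
      (\<Sum>i<n. a (\<lambda>j. jet_coords F r c j (Deriv \<alpha> (add_index I i))) * b (\<lambda>j. jet_coords F r c j (Base i))) =
      (\<Sum>i<n. b (\<lambda>j. jet_coords F r c j (Deriv \<alpha> (add_index I i))) * a (\<lambda>j. jet_coords F r c j (Base i)))"
  shows "levi (J r) (cartan_distribution F r) p a b = cartan_distribution F r p"
proof (intro equalityI subsetI)
  let ?D = "cartan_distribution F r"
  have br: "lie_bracket (J r) X Y p \<in> ?D p"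
    if "local_section_of (J r) ?D W X" "local_section_of (J r) ?D W Y" "p \<in> W" "X p = a" "Y p = b" for W X Y
    by (rule bracket_in_cartan[OF r that(1-3)]) (use sym that(4,5) in simp)
  {
    fix w assume "w \<in> levi (J r) ?D p a b"
    then obtain W X Y where W: "p \<in> W" "local_section_of (J r) ?D W X" "local_section_of (J r) ?D W Y" "X p = a" "Y p = b"
      "(\<lambda>f. w f - lie_bracket (J r) X Y p f) \<in> ?D p" unfolding levi_def by blast
    have "(\<lambda>f. 1 * (w f - lie_bracket (J r) X Y p f) + 1 * lie_bracket (J r) X Y p f) \<in> ?D p"
      by (rule cartan_lincomb[OF W(6) br[OF W(2,3,1,4,5)]])
    then show "w \<in> ?D p" by simp
  next
    fix w assume w: "w \<in> ?D p"
    obtain X where X: "local_section_of (J r) ?D (jet_dom F r c0) X" "X p = a" using cartan_extension[OF c0 r a] .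
    obtain Y where Y: "local_section_of (J r) ?D (jet_dom F r c0) Y" "Y p = b" using cartan_extension[OF c0 r b] .
    have "(\<lambda>f. 1 * w f + (-1) * lie_bracket (J r) X Y p f) \<in> ?D p"
      by (rule cartan_lincomb[OF w br[OF X(1) Y(1) c0(2) X(2) Y(2)]])
    then have "(\<lambda>f. w f - lie_bracket (J r) X Y p f) \<in> ?D p" by simp
    moreover have "w \<in> tangent_space (J r) p" using w by (simp add: cartan_distribution_def)
    ultimately show "w \<in> levi (J r) ?D p a b" unfolding levi_def using X Y c0(2) by blast
  }
qed

end

section \<open>Legendrian submanifolds and prolongations\<close>

lemma coords_on_subset:
  assumes c: "coords_on M W \<kappa> B" and W': "openin (mtop M) W'" "W' \<subseteq> W"
  shows "coords_on M W' \<kappa> B"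
proof -
  have inj: "inj_on \<kappa> W'" by (rule inj_on_subset[OF coords_onD(3)[OF c] W'(2)])
  have op: "copen B (\<kappa> ` V)" if "openin (mtop M) V" "V \<subseteq> W'" for V
    by (rule coords_onD(4)[OF c that(1)]) (use that W' in blast)
  have "openin (mtop M) {p \<in> W'. \<kappa> p \<in> X}" if "copen B X" for X
  proof -
    have "{p \<in> W'. \<kappa> p \<in> X} = W' \<inter> {p \<in> W. \<kappa> p \<in> X}" using W'(2) by blast
    then show ?thesis using W'(1) coords_onD(5)[OF c that] by auto
  qed
  moreover have "C_inf B (\<kappa> ` V) (f \<circ> inv_into W' \<kappa>)"
    if V: "openin (mtop M) V" "V \<subseteq> W'" and f: "smooth_fun M V f" for V f
  proof (rule C_inf_cong[OF coords_onD(1)[OF c] op[OF V] _ coords_onD(7)[OF c V(1) _ f]])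
    show "\<forall>x\<in>\<kappa> ` V. (f \<circ> inv_into W \<kappa>) x = (f \<circ> inv_into W' \<kappa>) x"
      using V(2) W'(2) inv_into_f_f[OF inj] inv_into_f_f[OF coords_onD(3)[OF c]] by (auto simp: subset_iff)
  qed (use V W' in blast)
  ultimately show ?thesis
    unfolding coords_on_def using coords_onD(1)[OF c] W'(1) inj op smooth_fun_subset[OF coords_onD(6)[OF c] W'(2)]
    by blast
qed

lemma tangent_map_inclusion_eq:
  "smooth_near M p f \<Longrightarrow> tangent_map M (\<lambda>x. x) p v f = v f"
  by (simp add: inclusion_tangent_map)

lemma submanifold_injective:
  assumes S: "embedded_submanifold S M" and p: "p \<in> carr S" and v: "v \<in> tangent_space S p"
    and z: "tangent_map M (\<lambda>x. x) p v = tzero"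
  shows "v = tzero"
proof -
  have "inj_on (tangent_map M (\<lambda>x. x) p) (tangent_space S p)" using S p by (simp add: embedded_submanifold_def)
  moreover have "tangent_map M (\<lambda>x. x) p tzero = tzero" by (auto simp: inclusion_tangent_map tzero_def)
  ultimately show ?thesis using inj_onD[OF _ _ v tzero_in_tangent_space] z by metis
qed

context fibred
begin

lemma vertical_subset_cartan:
  assumes c: "c \<in> fcharts F" "p \<in> jet_dom F r c" and r: "r \<ge> 1" and v: "v \<in> vertical_polarisation F r p"
  shows "v \<in> cartan_distribution F r p"
proof -
  have vt: "v \<in> tangent_space (J r) p" using v by (simp add: vertical_polarisation_def)
  have "\<forall>a\<in>jet_idx F (r - 1). v (\<lambda>j. jet_coords F r c j a) = 0" using vertical_iff[OF c vt] v by blast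
  then show ?thesis unfolding cartan_iff[OF c r vt]
    by (auto simp: contact_form_def Base_in_jet_idx Deriv_in_jet_idx)
qed

text \<open>The contact forms express the derivatives of order less than \<open>r\<close> through the components along
  the base: a Cartan vector over the zero vector of the base is vertical.\<close>

lemma cartan_vertical:
  assumes c: "c \<in> fcharts F" "p \<in> jet_dom F r c" and v: "v \<in> cartan_distribution F r p"
    and z: "\<And>i. i < n \<Longrightarrow> v (\<lambda>j. jet_coords F r c j (Base i)) = 0"
  shows "v \<in> vertical_polarisation F r p"
proof -
  have vt: "v \<in> tangent_space (J r) p" using v by (simp add: cartan_distribution_def)
  have "v (\<lambda>j. jet_coords F r c j a) = 0" if a: "a \<in> jet_idx F (r - 1)" for a
  proof (cases a)
    case (Base i)
    then show ?thesis using a z by (simp add: Base_in_jet_idx)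
  next
    case (Deriv \<alpha> I)
    then have "contact_form F r c \<alpha> I p v = 0" using a v c by (simp add: cartan_distribution_def Deriv_in_jet_idx)
    then show ?thesis using Deriv z by (simp add: contact_form_def)
  qed
  then show ?thesis using vertical_iff[OF c vt] by blast
qed

text \<open>A lift of the base vector with components \<open>d\<close>; the components in the direction of
  derivatives of order \<open>r\<close> are unconstrained. For \<open>I\<close> of order \<open>r\<close> the formula below reads coordinates outside
  \<^const>\<open>jet_idx\<close>, which are zero.\<close>

lemma cartan_lift:
  assumes c: "c \<in> fcharts F" "p \<in> jet_dom F r c" and r: "r \<ge> 1"
  obtains v where "v \<in> cartan_distribution F r p" "\<And>i. i < n \<Longrightarrow> v (\<lambda>j. jet_coords F r c j (Base i)) = d i"
proof -
  note charted = jet_bundle_charted[of r] and cr = jet_coords_on[OF c(1), of r]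
  define e where "e a = (case a of Base i \<Rightarrow> d i
    | Deriv \<alpha> I \<Rightarrow> \<Sum>i<n. jet_coords F r c p (Deriv \<alpha> (add_index I i)) * d i)" for a
  define v where "v = coord_vec (J r) (jet_dom F r c) (jet_coords F r c) (jet_idx F r) p e"
  have vt: "v \<in> tangent_space (J r) p" unfolding v_def by (rule coord_vec_tangent[OF charted cr c(2)])
  have vc: "v (\<lambda>j. jet_coords F r c j a) = e a" if "a \<in> jet_idx F r" for a
    unfolding v_def by (rule coord_vec_coord[OF charted cr c(2) that])
  have "v \<in> cartan_distribution F r p"
    unfolding cartan_iff[OF c r vt] contact_form_def
    using vc multi_indices_mono[of "r - 1" r n] by (auto simp: Deriv_in_jet_idx Base_in_jet_idx e_def subset_iff)
  then show ?thesis using that vc by (simp add: Base_in_jet_idx e_def)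
qed

lemma submanifold_jet_coords:
  assumes S: "embedded_submanifold S (J r)" and c: "c \<in> fcharts F"
  shows "openin (mtop S) (jet_dom F r c \<inter> carr S)"
    "\<And>a. a \<in> jet_idx F r \<Longrightarrow> smooth_fun S (jet_dom F r c \<inter> carr S) (\<lambda>j. jet_coords F r c j a)"
  using submanifold_restrict[OF S jet_bundle_charted jet_dom_open[OF c]] coords_onD(6)[OF jet_coords_on[OF c, of r]]
    smooth_fun_const[OF jet_bundle_charted jet_dom_open[OF c], of r 0]
  by blast+

lemma sub_tangent_jet_coord:
  assumes c: "c \<in> fcharts F" "p \<in> jet_dom F r c" and a: "a \<in> jet_idx F r"
  shows "tangent_map (J r) (\<lambda>x. x) p v (\<lambda>j. jet_coords F r c j a) = v (\<lambda>j. jet_coords F r c j a)"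
  using smooth_nearI[OF jet_dom_open[OF c(1)] c(2) coords_onD(6)[OF jet_coords_on[OF c(1)] a]]
  by (rule tangent_map_inclusion_eq)

text \<open>On the image of a prolongation the derivative coordinates are the derivatives of the section,
  as functions of the base coordinates.\<close>

lemma prolongation_tangent:
  assumes S: "embedded_submanifold S (J r)" and W: "openin (mtop S) W" "W = jet_of F r \<sigma> ` U0"
    and sec: "local_section F U0 \<sigma>" and x0: "x0 \<in> U0"
    and c: "c \<in> fcharts F" "jet_of F r \<sigma> x0 \<in> jet_dom F r c"
    and v: "v \<in> tangent_space S (jet_of F r \<sigma> x0)" and \<alpha>: "\<alpha> < m" and I: "I \<in> multi_indices n r"
  shows "v (\<lambda>j. jet_coords F r c j (Deriv \<alpha> I)) =
    (\<Sum>l<n. section_deriv F c \<alpha> (add_index I l) \<sigma> x0 * v (\<lambda>j. jet_coords F r c j (Base l)))"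
proof -
  obtain V \<psi> U \<phi> where ceq: "c = ((V, \<psi>), (U, \<phi>))" by (metis prod.collapse)
  note c1 = c(1)[unfolded ceq]
  note cV = fchartD(1)[OF c1] and cU = fchartD(2)[OF c1]
  let ?p = "jet_of F r \<sigma> x0"
  have chartedS: "charted_mfd S" using S smooth_manifold_charted by (auto simp: embedded_submanifold_def)
  have near: "section_near F x \<sigma>" if "x \<in> U0" for x using sec that by (auto simp: section_near_def)
  have \<sigma>0: "\<sigma> x0 \<in> V" using jet_dom_jet_ofD[OF c(2) near[OF x0]] by (simp add: ceq)
  obtain N where N: "openin (mtop Q) N" "x0 \<in> N" "\<And>x'. x' \<in> N \<Longrightarrow> section_near F x' \<sigma>"
    "\<And>x'. x' \<in> N \<Longrightarrow> \<sigma> x' \<in> V" "\<And>x'. x' \<in> N \<Longrightarrow> prj F (\<sigma> x') = x'"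
    "\<And>V'' \<psi> U \<phi>. ((V'', \<psi>), (U, \<phi>)) \<in> fcharts F \<Longrightarrow> V \<subseteq> V'' \<Longrightarrow> N \<subseteq> U"
    "\<And>V'' \<psi> U \<phi> k. ((V'', \<psi>), (U, \<phi>)) \<in> fcharts F \<Longrightarrow> V \<subseteq> V'' \<Longrightarrow> k < mdim E \<Longrightarrow>
      C_inf {..<n} (\<phi> ` N) (\<lambda>y. \<psi> (\<sigma> (inv_into U \<phi> y)) k)"
    using section_nhd[OF near[OF x0] coords_onD(2)[OF cV] \<sigma>0] by blast
  have dim: "n + m = mdim E" by (rule fchart_dim[OF c1 \<sigma>0])
  have NU: "N \<subseteq> U" using N(6)[OF c1] by blast
  have cop: "copen {..<n} (\<phi> ` N)" by (rule coords_onD(4)[OF cU N(1) NU])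
  define f where "f = (\<lambda>y. \<psi> (\<sigma> (inv_into U \<phi> y)) (n + \<alpha>))"
  have f: "C_inf {..<n} (\<phi> ` N) f" unfolding f_def by (rule N(7)[OF c1]) (use dim \<alpha> in auto)
  define h where "h = mpd n I f"
  have h: "C_inf {..<n} (\<phi> ` N) h" unfolding h_def by (rule C_inf_mpd[OF order.refl f])
  let ?B = "\<lambda>q. base_part F (jet_coords F r c q)"
  have op1: "openin (mtop S) (W \<inter> (jet_dom F r c \<inter> carr S))"
    using W(1) submanifold_jet_coords(1)[OF S c(1)] by blast
  define W0 where "W0 = {q \<in> W \<inter> (jet_dom F r c \<inter> carr S). ?B q \<in> \<phi> ` N}"
  have smB: "smooth_fun S (W \<inter> (jet_dom F r c \<inter> carr S)) (\<lambda>q. ?B q b)" if "b \<in> {..<n}" for b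
  proof -
    have "(\<lambda>q. ?B q b) = (\<lambda>q. jet_coords F r c q (Base b))" using that by (simp add: base_part_def)
    moreover have "smooth_fun S (W \<inter> (jet_dom F r c \<inter> carr S)) (\<lambda>q. jet_coords F r c q (Base b))"
      by (rule smooth_fun_subset[OF submanifold_jet_coords(2)[OF S c(1)] Int_lower2])
        (use that in \<open>simp add: Base_in_jet_idx\<close>)
    ultimately show ?thesis by simp
  qed
  have W0: "openin (mtop S) W0" unfolding W0_def
    by (rule smooth_fun_preimage_open[OF chartedS op1 cop smB]) (auto simp: base_part_def coord_space_def)
  have rep: "\<exists>x\<in>U0. q = jet_of F r \<sigma> x \<and> \<sigma> x \<in> V \<and> x \<in> U \<and> ?B q = \<phi> x \<and> jet_coords F r c q = jet_vec F c r \<sigma> x"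
    if q: "q \<in> W" "q \<in> jet_dom F r c" for q
  proof -
    obtain x where x: "x \<in> U0" "q = jet_of F r \<sigma> x" using q(1) W(2) by blast
    have sx: "\<sigma> x \<in> fst (fst c)" using jet_dom_jet_ofD[OF _ near[OF x(1)]] q(2) x(2) by blast
    then have xV: "\<sigma> x \<in> V" by (simp add: ceq)
    have xU: "x \<in> U" by (rule total_part_jet_vec(3)[OF c1 near[OF x(1)] xV])
    have jc: "jet_coords F r c q = jet_vec F c r \<sigma> x" unfolding x(2) by (rule jet_coords_jet_of[OF c(1) near[OF x(1)] sx])
    then show ?thesis using x xV xU base_part_jet_vec[OF c1 xU] by (auto simp: ceq)
  qed
  have pW: "?p \<in> W" using x0 W(2) by blast
  have pS: "?p \<in> carr S" using openin_subset[OF W(1)] pW by blast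
  have Bp: "?B ?p = \<phi> x0" and jp: "jet_coords F r c ?p = jet_vec F c r \<sigma> x0"
  proof -
    show *: "jet_coords F r c ?p = jet_vec F c r \<sigma> x0" by (rule jet_coords_jet_of[OF c(1) near[OF x0]]) (simp add: ceq \<sigma>0)
    show "?B ?p = \<phi> x0" unfolding * unfolding ceq by (rule base_part_jet_vec[OF c1]) (use N(2) NU in blast)
  qed
  have pW0: "?p \<in> W0" using pW c(2) pS Bp N(2) by (auto simp: W0_def)
  have "v (\<lambda>j. jet_coords F r c j (Deriv \<alpha> I)) = v (\<lambda>q. h (?B q))"
  proof (rule tvec_germ[OF chartedS v W0 pW0], intro ballI)
    fix q assume "q \<in> W0"
    then have q: "q \<in> W" "q \<in> jet_dom F r c" by (auto simp: W0_def)
    obtain x where "?B q = \<phi> x" "jet_coords F r c q = jet_vec F c r \<sigma> x" using rep[OF q] by blast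
    then show "jet_coords F r c q (Deriv \<alpha> I) = h (?B q)"
      using \<alpha> I by (simp add: jet_vec_def Deriv_in_jet_idx section_deriv_def ceq h_def f_def)
  qed
  also have "\<dots> = (\<Sum>l<n. pd l h (?B ?p) * v (\<lambda>q. ?B q l))"
  proof (rule tvec_chain[OF chartedS v W0 pW0 finite_lessThan cop h])
    show "smooth_fun S W0 (\<lambda>q. ?B q b)" if "b \<in> {..<n}" for b
      by (rule smooth_fun_subset[OF smB[OF that]]) (auto simp: W0_def)
  qed (simp add: W0_def)
  also have "\<dots> = (\<Sum>l<n. section_deriv F c \<alpha> (add_index I l) \<sigma> x0 * v (\<lambda>j. jet_coords F r c j (Base l)))"
  proof (rule sum.cong)
    fix l assume l: "l \<in> {..<n}"
    have "pd l h (\<phi> x0) = mpd n (add_index I l) f (\<phi> x0)"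
      unfolding h_def by (rule pd_mpd[OF cop _ f]) (use l N(2) in auto)
    moreover have "section_deriv F c \<alpha> (add_index I l) \<sigma> x0 = mpd n (add_index I l) f (\<phi> x0)"
      by (simp add: section_deriv_def ceq f_def)
    moreover have "(\<lambda>q. ?B q l) = (\<lambda>j. jet_coords F r c j (Base l))" using l by (simp add: base_part_def)
    ultimately show "pd l h (?B ?p) * v (\<lambda>q. ?B q l) =
        section_deriv F c \<alpha> (add_index I l) \<sigma> x0 * v (\<lambda>j. jet_coords F r c j (Base l))"
      unfolding Bp by simp
  qed simp
  finally show ?thesis .
qed

text \<open>If the differentials of the base coordinates span the cotangent space of \<open>S\<close>, then some of them
  form a chart. That all of them are used is shown by different arguments in the two directions of
  the theorem, hence the hypothesis that omitting one is contradictory.\<close>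

lemma base_coords_chart:
  fixes S :: "(('e, 'q) jet, 'k) mfd"
  assumes S: "embedded_submanifold S (J r)" and p: "p \<in> carr S" and c: "c \<in> fcharts F" "p \<in> jet_dom F r c"
    and sp: "\<And>v. v \<in> tangent_space S p \<Longrightarrow> (\<And>i. i < n \<Longrightarrow> v (\<lambda>j. jet_coords F r c j (Base i)) = 0) \<Longrightarrow> v = tzero"
    and onto: "\<And>W A l (\<kappa> :: ('e, 'q) jet \<Rightarrow> 'k \<Rightarrow> real) \<beta>. p \<in> W \<Longrightarrow> coords_on S W \<kappa> A \<Longrightarrow> l < n \<Longrightarrow> l \<notin> \<beta> ` A \<Longrightarrow> \<beta> ` A \<subseteq> {..<n} \<Longrightarrow>
      (\<And>q a. q \<in> W \<Longrightarrow> a \<in> A \<Longrightarrow> \<kappa> q a = jet_coords F r c q (Base (\<beta> a))) \<Longrightarrow> False"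
  obtains W where "p \<in> W" "W \<subseteq> jet_dom F r c \<inter> carr S"
    "coords_on S W (\<lambda>q. base_part F (jet_coords F r c q)) {..<n}"
proof -
  have chartedS: "charted_mfd S" using S smooth_manifold_charted by (auto simp: embedded_submanifold_def)
  note opD = submanifold_jet_coords[OF S c(1)]
  obtain U0 \<phi>0 where c0: "p \<in> U0" "coords_on S U0 \<phi>0 (idx S)" using charted_mfd_cover[OF chartedS p] by blast
  define f where "f i = (\<lambda>j. jet_coords F r c j (Base i))" for i
  have f: "smooth_near S p (f i)" if "i \<in> {..<n}" for i
    unfolding f_def by (rule smooth_nearI[OF opD(1) _ opD(2)]) (use that p c(2) in \<open>auto simp: Base_in_jet_idx\<close>)
  obtain W \<kappa> \<beta> where W: "p \<in> W" "coords_on S W \<kappa> (idx S)" "inj_on \<beta> (idx S)" "\<beta> ` idx S \<subseteq> {..<n}"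
    "\<And>q a. q \<in> W \<Longrightarrow> a \<in> idx S \<Longrightarrow> \<kappa> q a = f (\<beta> a) q"
    by (rule exchange_coordinates[OF chartedS c0(2,1), of "{..<n}" f]) (use f sp in \<open>auto simp: f_def\<close>)
  have "\<beta> ` idx S = {..<n}"
  proof (rule ccontr)
    assume "\<beta> ` idx S \<noteq> {..<n}"
    then obtain l where l: "l < n" "l \<notin> \<beta> ` idx S" using W(4) by blast
    show False by (rule onto[OF W(1,2) l W(4)]) (simp add: W(5) f_def)
  qed
  then have bij: "bij_betw \<beta> (idx S) {..<n}" using W(3) by (simp add: bij_betw_def)
  from relabel_coordinates[OF chartedS W(2) bij, of f] W(5)
  have "coords_on S W (\<lambda>q b. if b \<in> {..<n} then f b q else 0) {..<n}" by blast
  moreover have "(\<lambda>q b. if b \<in> {..<n} then f b q else 0) = (\<lambda>q. base_part F (jet_coords F r c q))"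
    by (auto simp: f_def base_part_def fun_eq_iff)
  ultimately have cW: "coords_on S W (\<lambda>q. base_part F (jet_coords F r c q)) {..<n}" by simp
  show ?thesis
    by (rule that[of "W \<inter> (jet_dom F r c \<inter> carr S)"])
      (use W(1) c(2) p coords_on_subset[OF cW] coords_onD(2)[OF cW] opD(1) in auto)
qed

lemma add_index_commute: "add_index (add_index I i) l = add_index (add_index I l) i"
  by (cases "i = l") (auto simp: fun_upd_twist)

text \<open>If some \<open>x\<^sup>l\<close> were missing among base coordinates that form a chart of the prolongation, then
  moving the base point in the direction of \<open>x\<^sup>l\<close> would not move the jet.\<close>

lemma prolongation_base_coords:
  assumes S: "embedded_submanifold S (J r)" and W: "openin (mtop S) W" "W = jet_of F r \<sigma> ` U0"
    and sec: "local_section F U0 \<sigma>" and x0: "x0 \<in> U0"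
    and c: "c \<in> fcharts F" "jet_of F r \<sigma> x0 \<in> jet_dom F r c"
    and \<kappa>: "jet_of F r \<sigma> x0 \<in> W1" "coords_on S W1 \<kappa> A" and l: "l < n" "l \<notin> \<beta> ` A" and \<beta>: "\<beta> ` A \<subseteq> {..<n}"
    and eq: "\<And>q a. q \<in> W1 \<Longrightarrow> a \<in> A \<Longrightarrow> \<kappa> q a = jet_coords F r c q (Base (\<beta> a))"
  shows False
proof -
  obtain V \<psi> U \<phi> where ceq: "c = ((V, \<psi>), (U, \<phi>))" by (metis prod.collapse)
  note c1 = c(1)[unfolded ceq]
  note cV = fchartD(1)[OF c1] and cU = fchartD(2)[OF c1]
  let ?p = "jet_of F r \<sigma> x0"
  have near: "section_near F x \<sigma>" if "x \<in> U0" for x using sec that by (auto simp: section_near_def)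
  have \<sigma>0: "\<sigma> x0 \<in> V" using jet_dom_jet_ofD[OF c(2) near[OF x0]] by (simp add: ceq)
  obtain N1 where N1: "openin (mtop Q) N1" "x0 \<in> N1" "\<And>x'. x' \<in> N1 \<Longrightarrow> section_near F x' \<sigma>"
    "\<And>x'. x' \<in> N1 \<Longrightarrow> \<sigma> x' \<in> V" "\<And>x'. x' \<in> N1 \<Longrightarrow> prj F (\<sigma> x') = x'"
    "\<And>V'' \<psi> U \<phi>. ((V'', \<psi>), (U, \<phi>)) \<in> fcharts F \<Longrightarrow> V \<subseteq> V'' \<Longrightarrow> N1 \<subseteq> U"
    "\<And>V'' \<psi> U \<phi> k. ((V'', \<psi>), (U, \<phi>)) \<in> fcharts F \<Longrightarrow> V \<subseteq> V'' \<Longrightarrow> k < mdim E \<Longrightarrow>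
      C_inf {..<n} (\<phi> ` N1) (\<lambda>y. \<psi> (\<sigma> (inv_into U \<phi> y)) k)"
    using section_nhd[OF near[OF x0] coords_onD(2)[OF cV] \<sigma>0] by blast
  define N where "N = N1 \<inter> U0"
  have N: "openin (mtop Q) N" "x0 \<in> N" "N \<subseteq> U0" "\<And>x. x \<in> N \<Longrightarrow> \<sigma> x \<in> V"
    using N1 x0 local_sectionD(1)[OF sec] by (auto simp: N_def)
  have dim: "n + m = mdim E" by (rule fchart_dim[OF c1 \<sigma>0])
  have NU: "N \<subseteq> U" using N1(6)[OF c1] by (auto simp: N_def)
  have sm: "C_inf {..<n} (\<phi> ` N) (\<lambda>y. \<psi> (\<sigma> (inv_into U \<phi> y)) (n + \<alpha>))" if "\<alpha> < m" for \<alpha>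
    by (rule C_inf_subset[OF _ N1(7)[OF c1]]) (use dim that in \<open>auto simp: N_def\<close>)
  have cop: "copen {..<n} (\<phi> ` N)" by (rule coords_onD(4)[OF cU N(1) NU])
  have inv: "inv_into U \<phi> (\<phi> x) = x" if "x \<in> N" for x
    by (rule inv_into_f_f[OF coords_onD(3)[OF cU]]) (use that NU in blast)
  obtain W2 where W2: "openin (mtop (J r)) W2" "W1 = W2 \<inter> carr S"
  proof -
    have "mtop S = subtopology (mtop (J r)) (carr S)" using S by (simp add: embedded_submanifold_def)
    then have "openin (subtopology (mtop (J r)) (carr S)) W1" using coords_onD(2)[OF \<kappa>(2)] by simp
    then show thesis using that unfolding openin_subtopology by blast
  qed
  let ?Z = "jet_coords F r c ` (jet_dom F r c \<inter> W2)"
  have Z: "copen (jet_idx F r) ?Z" by (rule jet_coords_open_map[OF c(1) W2(1)])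
  let ?g = "\<lambda>y. jet_vec F c r \<sigma> (inv_into U \<phi> y)"
  have jc: "jet_coords F r c (jet_of F r \<sigma> x) = jet_vec F c r \<sigma> x" if "x \<in> N" for x
    by (rule jet_coords_jet_of[OF c(1)]) (use that N near in \<open>auto simp: ceq\<close>)
  have "copen {..<n} {y \<in> \<phi> ` N. ?g y \<in> ?Z}"
  proof (rule copen_preimage[OF cop Z])
    show "continuous_on (\<phi> ` N) (\<lambda>y. ?g y a)" if "a \<in> jet_idx F r" for a
      unfolding ceq by (rule C_inf_imp_continuous, rule jet_vec_component(1)[OF c1 N(1) NU sm that])
  qed (rule jet_vec_coord_space)
  moreover have "\<phi> x0 \<in> {y \<in> \<phi> ` N. ?g y \<in> ?Z}"
  proof -
    have "jet_coords F r c ?p \<in> ?Z" using c(2) \<kappa>(1) W2(2) by blast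
    then show ?thesis using N(2) inv[OF N(2)] jc[OF N(2)] by simp
  qed
  ultimately obtain e where e: "e > 0" "cube {..<n} (\<phi> x0) e \<subseteq> {y \<in> \<phi> ` N. ?g y \<in> ?Z}"
    by (rule copen_contains_cube[OF finite_lessThan])
  define y1 where "y1 = (\<phi> x0)(l := \<phi> x0 l + e / 2)"
  have "\<phi> x0 \<in> coord_space {..<n}" by (rule coords_on_in_coord_space[OF cU]) (use N(2) NU in blast)
  then have "y1 \<in> cube {..<n} (\<phi> x0) e" using e(1) l(1) by (auto simp: y1_def cube_def coord_space_def)
  then obtain x1 where x1: "x1 \<in> N" "y1 = \<phi> x1" "?g y1 \<in> ?Z" using e(2) by blast
  let ?q = "jet_of F r \<sigma> x1"
  have qd: "?q \<in> jet_dom F r c" by (rule jet_domI) (use x1(1) N near in \<open>auto simp: ceq\<close>)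
  have "jet_coords F r c ?q \<in> ?Z" using x1 inv jc by simp
  then have "?q \<in> W2" using inj_onD[OF jet_coords_inj[OF c(1)]] qd by blast
  moreover have "?q \<in> carr S" using x1(1) N(3) W openin_subset[OF W(1)] by blast
  ultimately have q1: "?q \<in> W1" using W2(2) by blast
  have bc: "jet_coords F r c (jet_of F r \<sigma> x) (Base i) = \<phi> x i" if "x \<in> N" "i < n" for x i
    using jc[OF that(1)] that(2) by (simp add: jet_vec_def Base_in_jet_idx ceq)
  have "\<kappa> ?q = \<kappa> ?p"
  proof (rule coord_space_eqI[OF coords_on_in_coord_space[OF \<kappa>(2) q1] coords_on_in_coord_space[OF \<kappa>(2,1)]])
    fix a assume a: "a \<in> A"
    have "\<beta> a < n" "\<beta> a \<noteq> l" using a \<beta> l by auto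
    then show "\<kappa> ?q a = \<kappa> ?p a"
      unfolding eq[OF q1 a] eq[OF \<kappa>(1) a] using bc x1(1) N(2) by (simp add: x1(2)[symmetric] y1_def)
  qed
  then have "?q = ?p" using inj_onD[OF coords_onD(3)[OF \<kappa>(2)]] q1 \<kappa>(1) by blast
  then have "\<phi> x1 l = \<phi> x0 l" using bc[OF x1(1) l(1)] bc[OF N(2) l(1)] by simp
  then show False using e(1) by (simp add: x1(2)[symmetric] y1_def)
qed

text \<open>Tangent vectors of a prolongation satisfy
  \<open>v (u\<^sub>I) = \<Sum>\<^sub>l \<partial>\<^bsub>I + e\<^sub>l\<^esub> s v (x\<^sup>l)\<close> for \<open>|I| \<le> r\<close>. For \<open>|I| < r\<close> this says that they lie in the Cartan distribution;
  for \<open>|I| = r\<close> the coefficients are symmetric in the directions because derivatives commute, which is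
  isotropy. The base coordinates form a chart of \<open>S\<close>, so each Cartan vector has the same base
  components as a tangent vector of \<open>S\<close>, and the difference is vertical.\<close>

lemma prolongation_polarised_legendrian:
  fixes S :: "(('e, 'q) jet, 'k) mfd"
  assumes r: "r \<ge> 1" and S: "embedded_submanifold S (J r)" and W: "openin (mtop S) W" "W = jet_of F r \<sigma> ` U0"
    and sec: "local_section F U0 \<sigma>" and x0: "x0 \<in> U0" and p: "p = jet_of F r \<sigma> x0"
  shows "polarised_legendrian (J r) (cartan_distribution F r) (vertical_polarisation F r) p (sub_tangent_space S (J r) p)"
proof -
  let ?D = "cartan_distribution F r" and ?P = "vertical_polarisation F r" and ?T = "sub_tangent_space S (J r) p"
  let ?i = "tangent_map (J r) (\<lambda>x. x) p"
  note charted = jet_bundle_charted[of r]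
  have chartedS: "charted_mfd S" using S smooth_manifold_charted by (auto simp: embedded_submanifold_def)
  have pS: "p \<in> carr S" using openin_subset[OF W(1)] W(2) x0 p by blast
  then have "p \<in> carr (J r)" using S by (auto simp: embedded_submanifold_def)
  then obtain c0 where c0: "c0 \<in> fcharts F" "p \<in> jet_dom F r c0" by (rule jet_carrierE)
  have near: "section_near F x0 \<sigma>" using sec x0 by (auto simp: section_near_def)
  have TE: "\<exists>v'\<in>tangent_space S p. v = ?i v'" if "v \<in> ?T" for v using that by (auto simp: sub_tangent_space_def)
  have Tt: "v \<in> tangent_space (J r) p" if "v \<in> ?T" for v
    using TE[OF that] inclusion_tangent[OF S charted pS] by blast
  have prol: "v (\<lambda>j. jet_coords F r c j (Deriv \<alpha> I)) =
      (\<Sum>l<n. section_deriv F c \<alpha> (add_index I l) \<sigma> x0 * v (\<lambda>j. jet_coords F r c j (Base l)))"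
    if v: "v \<in> ?T" and c: "c \<in> fcharts F" "p \<in> jet_dom F r c" and \<alpha>: "\<alpha> < m" and I: "I \<in> multi_indices n r" for v c \<alpha> I
  proof -
    obtain v' where v': "v' \<in> tangent_space S p" "v = ?i v'" using TE[OF v] by blast
    have "v (\<lambda>j. jet_coords F r c j a) = v' (\<lambda>j. jet_coords F r c j a)" if "a \<in> jet_idx F r" for a
      unfolding v'(2) by (rule sub_tangent_jet_coord[OF c that])
    then show ?thesis
      using prolongation_tangent[OF S W sec x0 c(1) c(2)[unfolded p] v'(1)[unfolded p] \<alpha> I] \<alpha> I
      by (simp add: Deriv_in_jet_idx Base_in_jet_idx)
  qed
  have pc: "jet_coords F r c p (Deriv \<alpha> I) = section_deriv F c \<alpha> I \<sigma> x0"
    if c: "c \<in> fcharts F" "p \<in> jet_dom F r c" and "\<alpha> < m" "I \<in> multi_indices n r" for c \<alpha> I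
  proof -
    have "\<sigma> x0 \<in> fst (fst c)" using jet_dom_jet_ofD[OF _ near] c(2) p by blast
    then show ?thesis using jet_coords_jet_of[OF c(1) near, of r] that by (simp add: p jet_vec_def Deriv_in_jet_idx)
  qed
  have mi: "I \<in> multi_indices n r" "i < n \<Longrightarrow> add_index I i \<in> multi_indices n r" if "I \<in> multi_indices n (r - 1)" for I i
    using that multi_indices_mono[of "r - 1" r n] add_index_multi_indices[OF that, of i] r by auto
  have TD: "v \<in> ?D p" if v: "v \<in> ?T" for v
    unfolding cartan_iff[OF c0 r Tt[OF v]] contact_form_def
    using prol[OF v c0] pc[OF c0] mi by auto
  have PD: "v \<in> ?D p" if "v \<in> ?P p" for v by (rule vertical_subset_cartan[OF c0 r that])
  have levi: "levi (J r) ?D p a b = ?D p" if a: "a \<in> ?T" and b: "b \<in> ?T" for a b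
  proof (rule levi_eqI[OF r c0 TD[OF a] TD[OF b]])
    fix c \<alpha> I assume c: "c \<in> fcharts F" "p \<in> jet_dom F r c" and \<alpha>: "\<alpha> < m" and I: "I \<in> multi_indices n (r - 1)"
    let ?d = "\<lambda>i l. section_deriv F c \<alpha> (add_index (add_index I i) l) \<sigma> x0"
    let ?x = "\<lambda>v i. v (\<lambda>j. jet_coords F r c j (Base i))"
    have *: "(\<Sum>i<n. v (\<lambda>j. jet_coords F r c j (Deriv \<alpha> (add_index I i))) * ?x w i) =
        (\<Sum>i<n. \<Sum>l<n. ?d i l * ?x v l * ?x w i)" if v: "v \<in> ?T" for v w
      by (rule sum.cong) (simp_all add: prol[OF v c \<alpha> mi(2)[OF I]] sum_distrib_right)
    have "(\<Sum>i<n. \<Sum>l<n. ?d i l * ?x a l * ?x b i) = (\<Sum>l<n. \<Sum>i<n. ?d i l * ?x a l * ?x b i)" by (rule sum.swap)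
    also have "\<dots> = (\<Sum>i<n. \<Sum>l<n. ?d i l * ?x b l * ?x a i)"
      by (intro sum.cong refl) (simp add: add_index_commute mult_ac del: fun_upd_apply)
    finally show "(\<Sum>i<n. a (\<lambda>j. jet_coords F r c j (Deriv \<alpha> (add_index I i))) * ?x b i) =
        (\<Sum>i<n. b (\<lambda>j. jet_coords F r c j (Deriv \<alpha> (add_index I i))) * ?x a i)"
      unfolding *[OF a] *[OF b] .
  qed
  have iso: "isotropic (J r) ?D p ?T" unfolding isotropic_def
    by (intro conjI subsetI ballI sub_tangent_space_subspace TD levi)
  have zeroT: "tzero \<in> ?T" using sub_tangent_space_subspace[of S "J r" p] by (simp add: tsubspace_def)
  have zeroP: "tzero \<in> ?P p"
    unfolding vertical_iff[OF c0 tzero_in_tangent_space] by (simp add: tzero_def)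
  have Tz: "v = tzero" if v: "v \<in> ?T" and z: "\<And>i. i < n \<Longrightarrow> v (\<lambda>j. jet_coords F r c0 j (Base i)) = 0" for v
  proof (rule tvec_eqI[OF charted Tt[OF v] tzero_in_tangent_space jet_coords_on[OF c0(1)] c0(2)])
    fix a assume a: "a \<in> jet_idx F r"
    show "v (\<lambda>q. jet_coords F r c0 q a) = tzero (\<lambda>q. jet_coords F r c0 q a)"
    proof (cases a)
      case (Base i)
      then show ?thesis using a z by (simp add: Base_in_jet_idx tzero_def)
    next
      case (Deriv \<alpha> I)
      then show ?thesis using a prol[OF v c0, of \<alpha> I] z by (simp add: Deriv_in_jet_idx tzero_def)
    qed
  qed
  have int: "?T \<inter> ?P p = {tzero}"
  proof (intro equalityI subsetI)
    fix v assume v: "v \<in> ?T \<inter> ?P p"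
    then have "\<forall>a\<in>jet_idx F (r - 1). v (\<lambda>j. jet_coords F r c0 j a) = 0" using vertical_iff[OF c0 Tt] by blast
    then have "v = tzero" by (intro Tz) (use v in \<open>auto simp: Base_in_jet_idx\<close>)
    then show "v \<in> {tzero}" by simp
  qed (use zeroT zeroP in auto)
  have sp: "v = tzero" if v: "v \<in> tangent_space S p" and z: "\<And>i. i < n \<Longrightarrow> v (\<lambda>j. jet_coords F r c0 j (Base i)) = 0" for v
  proof (rule submanifold_injective[OF S pS v], rule Tz)
    show "?i v \<in> ?T" using v by (auto simp: sub_tangent_space_def)
    show "?i v (\<lambda>j. jet_coords F r c0 j (Base i)) = 0" if "i < n" for i
      using sub_tangent_jet_coord[OF c0, of "Base i"] z[OF that] that by (simp add: Base_in_jet_idx)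
  qed
  obtain W1 where W1: "p \<in> W1" "W1 \<subseteq> jet_dom F r c0 \<inter> carr S"
    "coords_on S W1 (\<lambda>q. base_part F (jet_coords F r c0 q)) {..<n}"
  proof (rule base_coords_chart[OF S pS c0 sp])
    show False if "p \<in> W'" "coords_on S W' \<kappa> A" "l < n" "l \<notin> \<beta> ` A" "\<beta> ` A \<subseteq> {..<n}"
      "\<And>q a. q \<in> W' \<Longrightarrow> a \<in> A \<Longrightarrow> \<kappa> q a = jet_coords F r c0 q (Base (\<beta> a))"
      for W' A l \<beta> and \<kappa> :: "('e, 'q) jet \<Rightarrow> 'k \<Rightarrow> real"
      by (rule prolongation_base_coords[OF S W sec x0 c0(1) c0(2)[unfolded p] that(1)[unfolded p] that(2-6)])
  qed
  have "?D p = {(\<lambda>f. v f + w f) | v w. v \<in> ?T \<and> w \<in> ?P p}"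
  proof (intro equalityI subsetI)
    fix v assume v: "v \<in> ?D p"
    define w' where "w' = coord_vec S W1 (\<lambda>q. base_part F (jet_coords F r c0 q)) {..<n} p (\<lambda>i. v (\<lambda>j. jet_coords F r c0 j (Base i)))"
    have w': "w' \<in> tangent_space S p" unfolding w'_def by (rule coord_vec_tangent[OF chartedS W1(3,1)])
    have w'c: "w' (\<lambda>j. jet_coords F r c0 j (Base i)) = v (\<lambda>j. jet_coords F r c0 j (Base i))" if "i < n" for i
    proof -
      have "(\<lambda>q. base_part F (jet_coords F r c0 q) i) = (\<lambda>j. jet_coords F r c0 j (Base i))"
        using that by (simp add: base_part_def)
      then show ?thesis using coord_vec_coord[OF chartedS W1(3,1), of i] that unfolding w'_def by simp
    qed
    define w where "w = ?i w'"
    have wT: "w \<in> ?T" using w' by (auto simp: w_def sub_tangent_space_def)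
    define u where "u = (\<lambda>f. 1 * v f + (-1) * w f)"
    have "u \<in> ?D p" unfolding u_def by (rule cartan_lincomb[OF v TD[OF wT]])
    moreover have "u (\<lambda>j. jet_coords F r c0 j (Base i)) = 0" if "i < n" for i
      using w'c[OF that] sub_tangent_jet_coord[OF c0, of "Base i" w'] that by (simp add: u_def w_def Base_in_jet_idx)
    ultimately have "u \<in> ?P p" by (rule cartan_vertical[OF c0])
    moreover have "v = (\<lambda>f. w f + u f)" by (auto simp: u_def)
    ultimately show "v \<in> {(\<lambda>f. v f + w f) | v w. v \<in> ?T \<and> w \<in> ?P p}" using wT by blast
  next
    fix v assume "v \<in> {(\<lambda>f. v f + w f) | v w. v \<in> ?T \<and> w \<in> ?P p}"
    then obtain w u where "v = (\<lambda>f. w f + u f)" "w \<in> ?T" "u \<in> ?P p" by blast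
    then show "v \<in> ?D p" using cartan_lincomb[OF TD PD, of w u 1 1] by simp
  qed
  then show ?thesis unfolding polarised_legendrian_def using iso int by blast
qed

text \<open>A Legendrian tangent space is mapped isomorphically to the tangent space of the base, so \<open>S\<close> is
  locally a graph \<open>u\<^sub>I = g\<^sub>I (x)\<close>. The contact forms vanish on it, which reads \<open>\<partial>\<^sub>i g\<^sub>I = g\<^bsub>I + e\<^sub>i\<^esub>\<close> for
  \<open>|I| < r\<close>. Hence \<open>g\<^sub>I = \<partial>\<^sub>I g\<^sub>0\<close>, and \<open>S\<close> is the prolongation of the section with fibre
  coordinates \<open>g\<^sub>0\<close>.\<close>

lemma polarised_legendrian_prolongation:
  fixes S :: "(('e, 'q) jet, 'k) mfd"
  assumes r: "r \<ge> 1" and S: "embedded_submanifold S (J r)" and p: "p \<in> carr S"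
    and leg0: "\<forall>q\<in>carr S. polarised_legendrian (J r) (cartan_distribution F r) (vertical_polarisation F r) q
      (sub_tangent_space S (J r) q)"
  obtains W U \<sigma> where "openin (mtop S) W" "p \<in> W" "local_section F U \<sigma>" "W = jet_of F r \<sigma> ` U"
proof -
  let ?D = "cartan_distribution F r" and ?P = "vertical_polarisation F r"
  let ?i = "tangent_map (J r) (\<lambda>x. x)"
  note charted = jet_bundle_charted[of r] and leg = bspec[OF leg0]
  have chartedS: "charted_mfd S" using S smooth_manifold_charted by (auto simp: embedded_submanifold_def)
  have "p \<in> carr (J r)" using S p by (auto simp: embedded_submanifold_def)
  then obtain c where c: "c \<in> fcharts F" "p \<in> jet_dom F r c" by (rule jet_carrierE)
  obtain V \<psi> U \<phi> where ceq: "c = ((V, \<psi>), (U, \<phi>))" by (metis prod.collapse)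
  note c1 = c(1)[unfolded ceq]
  note cV = fchartD(1)[OF c1] and cU = fchartD(2)[OF c1]
  have TD: "?i q v \<in> ?D q" if "q \<in> carr S" "v \<in> tangent_space S q" for q v
    using leg[OF that(1)] that(2) unfolding polarised_legendrian_def isotropic_def sub_tangent_space_def by blast
  have sp: "v = tzero" if v: "v \<in> tangent_space S p" and z: "\<And>i. i < n \<Longrightarrow> v (\<lambda>j. jet_coords F r c j (Base i)) = 0" for v
  proof (rule submanifold_injective[OF S p v])
    have "?i p v \<in> ?P p"
      by (rule cartan_vertical[OF c TD[OF p v]]) (use z sub_tangent_jet_coord[OF c] in \<open>simp add: Base_in_jet_idx\<close>)
    then show "?i p v = tzero"
      using leg[OF p] v unfolding polarised_legendrian_def sub_tangent_space_def by blast
  qed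
  obtain W where W: "p \<in> W" "W \<subseteq> jet_dom F r c \<inter> carr S"
    "coords_on S W (\<lambda>q. base_part F (jet_coords F r c q)) {..<n}"
  proof (rule base_coords_chart[OF S p c sp])
    fix W' A l \<beta> and \<kappa> :: "('e, 'q) jet \<Rightarrow> 'k \<Rightarrow> real"
    assume \<kappa>: "p \<in> W'" "coords_on S W' \<kappa> A" and l: "l < n" "l \<notin> \<beta> ` A" and \<beta>: "\<beta> ` A \<subseteq> {..<n}"
      and eq: "\<And>q a. q \<in> W' \<Longrightarrow> a \<in> A \<Longrightarrow> \<kappa> q a = jet_coords F r c q (Base (\<beta> a))"
    obtain v where v: "v \<in> ?D p" "\<And>i. i < n \<Longrightarrow> v (\<lambda>j. jet_coords F r c j (Base i)) = (if i = l then 1 else 0)"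
      by (rule cartan_lift[OF c r, of "\<lambda>i. if i = l then 1 else 0"]) (rule that, assumption, blast)
    obtain w u where wu: "v = (\<lambda>f. w f + u f)" "w \<in> sub_tangent_space S (J r) p" "u \<in> ?P p"
      using leg[OF p] v(1) unfolding polarised_legendrian_def by blast
    obtain w' where w': "w' \<in> tangent_space S p" "w = ?i p w'" using wu(2) by (auto simp: sub_tangent_space_def)
    have "u \<in> tangent_space (J r) p" using wu(3) by (simp add: vertical_polarisation_def)
    then have "u (\<lambda>j. jet_coords F r c j (Base i)) = 0" if "i < n" for i
      using vertical_iff[OF c] wu(3) that by (simp add: Base_in_jet_idx)
    then have w'c: "w' (\<lambda>j. jet_coords F r c j (Base i)) = (if i = l then 1 else 0)" if "i < n" for i
      using v(2)[OF that] sub_tangent_jet_coord[OF c, of "Base i" w'] that by (simp add: wu(1) w'(2) Base_in_jet_idx)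
    have "w' = tzero"
    proof (rule tvec_eqI[OF chartedS w'(1) tzero_in_tangent_space \<kappa>(2,1)])
      fix a assume a: "a \<in> A"
      have "w' (\<lambda>q. \<kappa> q a) = w' (\<lambda>j. jet_coords F r c j (Base (\<beta> a)))"
        by (rule tvec_germ[OF chartedS w'(1) coords_onD(2)[OF \<kappa>(2)] \<kappa>(1)]) (use eq a in blast)
      also have "\<dots> = 0"
      proof -
        have "\<beta> a \<noteq> l" "\<beta> a < n" using a l(2) \<beta> by auto
        then show ?thesis using w'c by simp
      qed
      finally show "w' (\<lambda>q. \<kappa> q a) = tzero (\<lambda>q. \<kappa> q a)" by (simp add: tzero_def)
    qed
    then show False using w'c[OF l(1)] by (simp add: tzero_def)
  qed
  define \<kappa> where "\<kappa> = (\<lambda>q. base_part F (jet_coords F r c q))"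
  note cW = W(3)[folded \<kappa>_def]
  have Wo: "openin (mtop S) W" by (rule coords_onD(2)[OF cW])
  define X where "X = \<kappa> ` W"
  have X: "copen {..<n} X" unfolding X_def by (rule coords_onD(4)[OF cW Wo order.refl])
  have inv: "inv_into W \<kappa> (\<kappa> q) = q" if "q \<in> W" for q by (rule inv_into_f_f[OF coords_onD(3)[OF cW] that])
  have Wd: "q \<in> jet_dom F r c" "q \<in> carr S" if "q \<in> W" for q using W(2) that by auto
  define g where "g \<alpha> I y = jet_coords F r c (inv_into W \<kappa> y) (Deriv \<alpha> I)" for \<alpha> I y
  have smW: "smooth_fun S W (\<lambda>j. jet_coords F r c j a)" if "a \<in> jet_idx F r" for a
    by (rule smooth_fun_subset[OF submanifold_jet_coords(2)[OF S c(1) that] W(2)])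
  have g: "C_inf {..<n} X (g \<alpha> I)" if "\<alpha> < m" "I \<in> multi_indices n r" for \<alpha> I
    using coords_onD(7)[OF cW Wo order.refl smW, of "Deriv \<alpha> I"] that
    by (simp add: Deriv_in_jet_idx X_def g_def[abs_def] o_def)
  have mi: "I \<in> multi_indices n r" "i < n \<Longrightarrow> add_index I i \<in> multi_indices n r" if "I \<in> multi_indices n (r - 1)" for I i
    using that multi_indices_mono[of "r - 1" r n] add_index_multi_indices[OF that, of i] r by auto
  \<comment> \<open>The coordinate vector fields of \<open>S\<close> are annihilated by the contact forms.\<close>
  have pdg: "pd i (g \<alpha> I) y = g \<alpha> (add_index I i) y"
    if \<alpha>: "\<alpha> < m" and I: "I \<in> multi_indices n (r - 1)" and i: "i < n" and y: "y \<in> X" for \<alpha> I i y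
  proof -
    obtain q where q: "q \<in> W" "y = \<kappa> q" using y by (auto simp: X_def)
    define v where "v = coord_vec S W \<kappa> {..<n} q (\<lambda>l. if l = i then 1 else 0)"
    have v: "v \<in> tangent_space S q" unfolding v_def by (rule coord_vec_tangent[OF chartedS cW q(1)])
    have vx: "v (\<lambda>j. jet_coords F r c j (Base l)) = (if l = i then 1 else 0)" if "l < n" for l
    proof -
      have "(\<lambda>q. \<kappa> q l) = (\<lambda>j. jet_coords F r c j (Base l))" using that by (simp add: \<kappa>_def base_part_def)
      then show ?thesis using coord_vec_coord[OF chartedS cW q(1), of l] that unfolding v_def by simp
    qed
    have Ir: "Deriv \<alpha> I \<in> jet_idx F r" using \<alpha> mi(1)[OF I] by (simp add: Deriv_in_jet_idx)
    have "contact_form F r c \<alpha> I q (?i q v) = 0"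
      using TD[OF Wd(2)[OF q(1)] v] c(1) Wd(1)[OF q(1)] \<alpha> I by (simp add: cartan_distribution_def)
    then have "v (\<lambda>j. jet_coords F r c j (Deriv \<alpha> I)) =
        (\<Sum>l<n. jet_coords F r c q (Deriv \<alpha> (add_index I l)) * v (\<lambda>j. jet_coords F r c j (Base l)))"
      using sub_tangent_jet_coord[OF c(1) Wd(1)[OF q(1)]] Ir by (simp add: contact_form_def Base_in_jet_idx)
    also have "\<dots> = (\<Sum>l<n. if l = i then jet_coords F r c q (Deriv \<alpha> (add_index I l)) else 0)"
      by (rule sum.cong) (auto simp: vx)
    also have "\<dots> = jet_coords F r c q (Deriv \<alpha> (add_index I i))" using i by simp
    also have "\<dots> = g \<alpha> (add_index I i) y" using inv[OF q(1)] by (simp add: g_def q(2))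
    finally have 1: "v (\<lambda>j. jet_coords F r c j (Deriv \<alpha> I)) = g \<alpha> (add_index I i) y" .
    have "smooth_near S q (\<lambda>j. jet_coords F r c j (Deriv \<alpha> I))" by (rule smooth_nearI[OF Wo q(1) smW[OF Ir]])
    then have "v (\<lambda>j. jet_coords F r c j (Deriv \<alpha> I)) = (\<Sum>l<n. pd l (g \<alpha> I) y * (if l = i then 1 else 0))"
      by (simp add: v_def coord_vec_def g_def[abs_def] o_def q(2))
    also have "\<dots> = (\<Sum>l<n. if l = i then pd l (g \<alpha> I) y else 0)" by (rule sum.cong) auto
    also have "\<dots> = pd i (g \<alpha> I) y" using i by simp
    finally show ?thesis using 1 by simp
  qed
  have mpdg: "\<forall>y\<in>X. mpd n I (g \<alpha> (\<lambda>_. 0)) y = g \<alpha> I y"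
    if \<alpha>: "\<alpha> < m" and "\<forall>i\<ge>n. I i = 0" "(\<Sum>i<n. I i) = k" "k \<le> r" for \<alpha> I k
    using that(2-4)
  proof (induction k arbitrary: I)
    case 0
    then show ?case using multi_index_zero[of n I] by (simp add: mpd_zero)
  next
    case (Suc k)
    obtain i J where J: "i < n" "\<forall>i\<ge>n. J i = 0" "(\<Sum>i<n. J i) = k" "I = add_index J i"
      using multi_index_SucE[OF Suc.prems(1,2)] .
    have Jm: "J \<in> multi_indices n (r - 1)" using J Suc.prems(3) by (auto simp: multi_indices_def)
    have IH: "\<forall>y\<in>X. mpd n J (g \<alpha> (\<lambda>_. 0)) y = g \<alpha> J y" by (rule Suc.IH[OF J(2,3)]) (use Suc.prems in simp)
    show ?case
    proof
      fix y assume y: "y \<in> X"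
      have "mpd n I (g \<alpha> (\<lambda>_. 0)) y = pd i (mpd n J (g \<alpha> (\<lambda>_. 0))) y"
        unfolding J(4) by (rule pd_mpd[OF X J(1) g[OF \<alpha> zero_multi_index] y, symmetric])
      also have "\<dots> = pd i (g \<alpha> J) y" by (rule pd_cong[OF finite_lessThan X IH y]) (use J in simp)
      also have "\<dots> = g \<alpha> I y" unfolding J(4) by (rule pdg[OF \<alpha> Jm J(1) y])
      finally show "mpd n I (g \<alpha> (\<lambda>_. 0)) y = g \<alpha> I y" .
    qed
  qed
  define w where "w y = (\<lambda>i. if i < n then y i else if i < n + m then g (i - n) (\<lambda>_. 0) y else 0)" for y
  have wW: "w (\<kappa> q) \<in> \<psi> ` V \<and> \<kappa> q \<in> \<phi> ` U" if q: "q \<in> W" for q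
  proof -
    obtain \<tau> x where t: "q = jet_of F r \<tau> x" "section_near F x \<tau>" "\<tau> x \<in> fst (fst c)"
      using Wd(1)[OF q] by (rule jet_domE)
    then have tV: "\<tau> x \<in> V" by (simp add: ceq)
    have jc: "jet_coords F r c q = jet_vec F c r \<tau> x" unfolding t(1) by (rule jet_coords_jet_of[OF c(1) t(2,3)])
    have "w (\<kappa> q) = total_part F (jet_coords F r c q)"
      using inv[OF q] by (auto simp: w_def total_part_def g_def \<kappa>_def base_part_def)
    then have 1: "w (\<kappa> q) = \<psi> (\<tau> x)" using total_part_jet_vec(1)[OF c1 t(2) tV, of r] jc by (simp add: ceq)
    have xU: "x \<in> U" by (rule total_part_jet_vec(3)[OF c1 t(2) tV])
    have "\<kappa> q = \<phi> x" unfolding \<kappa>_def jc unfolding ceq by (rule base_part_jet_vec[OF c1 xU])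
    then show ?thesis using 1 tV xU by blast
  qed
  have XU: "X \<subseteq> \<phi> ` U" using wW by (auto simp: X_def)
  have XV: "w y \<in> \<psi> ` V" if "y \<in> X" for y using wW that by (auto simp: X_def)
  define N where "N = {x \<in> U. \<phi> x \<in> X}"
  define \<sigma> where "\<sigma> x = inv_into V \<psi> (w (\<phi> x))" for x
  have sec: "local_section F N \<sigma>" "\<And>x. x \<in> N \<Longrightarrow> \<sigma> x \<in> V \<and> \<psi> (\<sigma> x) = w (\<phi> x)"
    by (rule section_of_functions[OF c1 X XU g[OF _ zero_multi_index] w_def XV N_def \<sigma>_def]; assumption)+
  have rep: "\<psi> (\<sigma> (inv_into U \<phi> y)) (n + \<alpha>) = g \<alpha> (\<lambda>_. 0) y" if y: "y \<in> X" and \<alpha>: "\<alpha> < m" for y \<alpha>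
  proof -
    have "inv_into U \<phi> y \<in> U" "\<phi> (inv_into U \<phi> y) = y" using y XU by (auto simp: inv_into_into f_inv_into_f)
    then show ?thesis using sec(2)[of "inv_into U \<phi> y"] y \<alpha> by (simp add: N_def w_def)
  qed
  have jet: "jet_of F r \<sigma> x = inv_into W \<kappa> (\<phi> x)" if x: "x \<in> N" for x
  proof (rule inj_onD[OF jet_coords_inj[OF c(1)]])
    have near: "section_near F x \<sigma>" using sec(1) x by (auto simp: section_near_def)
    have sV: "\<sigma> x \<in> fst (fst c)" using sec(2)[OF x] by (simp add: ceq)
    have xX: "\<phi> x \<in> X" using x by (simp add: N_def)
    have qW: "inv_into W \<kappa> (\<phi> x) \<in> W" "\<kappa> (inv_into W \<kappa> (\<phi> x)) = \<phi> x"
      using xX by (auto simp: X_def inv_into_into f_inv_into_f)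
    show "jet_of F r \<sigma> x \<in> jet_dom F r c" by (rule jet_domI[OF near sV])
    show "inv_into W \<kappa> (\<phi> x) \<in> jet_dom F r c" by (rule Wd(1)[OF qW(1)])
    show "jet_coords F r c (jet_of F r \<sigma> x) = jet_coords F r c (inv_into W \<kappa> (\<phi> x))"
    proof (rule coord_space_eqI[OF jet_coords_coord_space jet_coords_coord_space])
      fix a assume a: "a \<in> jet_idx F r"
      have "jet_vec F c r \<sigma> x a = jet_coords F r c (inv_into W \<kappa> (\<phi> x)) a"
      proof (cases a)
        case (Base i)
        then have "i < n" using a by (simp add: Base_in_jet_idx)
        then have "\<kappa> (inv_into W \<kappa> (\<phi> x)) i = jet_coords F r c (inv_into W \<kappa> (\<phi> x)) (Base i)"
          by (simp add: \<kappa>_def base_part_def)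
        then show ?thesis using Base a qW(2) by (simp add: jet_vec_def ceq)
      next
        case (Deriv \<alpha> I)
        then have \<alpha>: "\<alpha> < m" and I: "I \<in> multi_indices n r" using a by (simp_all add: Deriv_in_jet_idx)
        have "mpd n I (\<lambda>y. \<psi> (\<sigma> (inv_into U \<phi> y)) (n + \<alpha>)) (\<phi> x) = mpd n I (g \<alpha> (\<lambda>_. 0)) (\<phi> x)"
          by (rule mpd_cong[OF X order.refl _ xX]) (use rep \<alpha> in blast)
        also have "\<dots> = g \<alpha> I (\<phi> x)" using mpdg[OF \<alpha> _ refl, of I] I xX by (auto simp: multi_indices_def)
        finally show ?thesis using Deriv a by (simp add: jet_vec_def section_deriv_def ceq g_def)
      qed
      then show "jet_coords F r c (jet_of F r \<sigma> x) a = jet_coords F r c (inv_into W \<kappa> (\<phi> x)) a"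
        using jet_coords_jet_of[OF c(1) near sV] by simp
    qed
  qed
  have "W = jet_of F r \<sigma> ` N"
  proof (intro equalityI subsetI)
    fix q assume q: "q \<in> W"
    then obtain x where x: "x \<in> U" "\<kappa> q = \<phi> x" using wW by blast
    have "\<phi> x \<in> X" unfolding X_def x(2)[symmetric] using q by blast
    then have "x \<in> N" using x(1) by (simp add: N_def)
    moreover have "jet_of F r \<sigma> x = q" using jet[OF \<open>x \<in> N\<close>] x(2) inv[OF q] by simp
    ultimately show "q \<in> jet_of F r \<sigma> ` N" by blast
  next
    fix q assume "q \<in> jet_of F r \<sigma> ` N"
    then obtain x where x: "x \<in> N" "q = inv_into W \<kappa> (\<phi> x)" using jet by blast
    then have "\<phi> x \<in> \<kappa> ` W" by (simp add: N_def X_def)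
    then show "q \<in> W" using x(2) by (simp add: inv_into_into)
  qed
  then show ?thesis using that[OF Wo W(1) sec(1)] by blast
qed

end

theorem proposition8p1:
  fixes F :: "('e, 'q) fibration"
    and r :: nat
    and S :: "(('e, 'q) jet, 'k) mfd"
  assumes "fibred_manifold F"
    and "r \<ge> 1"
    and "embedded_submanifold S (jet_bundle F r)"
    and "connected_space (mtop S)"
  shows "locally_holonomic F r S \<longleftrightarrow>
    polarised_legendrian_submanifold S (jet_bundle F r)
      (cartan_distribution F r) (vertical_polarisation F r)"
proof
  interpret fibred F using assms(1) by (rule fibred.intro)
  assume hol: "locally_holonomic F r S"
  have "polarised_legendrian (jet_bundle F r) (cartan_distribution F r) (vertical_polarisation F r) p
      (sub_tangent_space S (jet_bundle F r) p)" if p: "p \<in> carr S" for p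
  proof -
    from bspec[OF hol[unfolded locally_holonomic_def] p]
    obtain W U \<sigma> where W: "openin (mtop S) W" "p \<in> W" "local_section F U \<sigma>" "W = jet_of F r \<sigma> ` U"
      by (elim exE conjE) (rule that)
    obtain x where x: "x \<in> U" "p = jet_of F r \<sigma> x" using W(2,4) by blast
    show ?thesis by (rule prolongation_polarised_legendrian[OF assms(2,3) W(1,4,3) x])
  qed
  then show "polarised_legendrian_submanifold S (jet_bundle F r) (cartan_distribution F r) (vertical_polarisation F r)"
    using assms(3) by (simp add: polarised_legendrian_submanifold_def)
next
  interpret fibred F using assms(1) by (rule fibred.intro)
  assume leg: "polarised_legendrian_submanifold S (jet_bundle F r) (cartan_distribution F r) (vertical_polarisation F r)"
  show "locally_holonomic F r S"
    unfolding locally_holonomic_def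
  proof
    fix p assume p: "p \<in> carr S"
    have "\<forall>q\<in>carr S. polarised_legendrian (jet_bundle F r) (cartan_distribution F r) (vertical_polarisation F r) q
        (sub_tangent_space S (jet_bundle F r) q)"
      using leg by (simp add: polarised_legendrian_submanifold_def)
    from polarised_legendrian_prolongation[OF assms(2,3) p this]
    obtain W U \<sigma> where "openin (mtop S) W" "p \<in> W" "local_section F U \<sigma>" "W = jet_of F r \<sigma> ` U" .
    then show "\<exists>W U \<sigma>. openin (mtop S) W \<and> p \<in> W \<and> local_section F U \<sigma> \<and> W = jet_of F r \<sigma> ` U"
      by (intro exI conjI)
  qed
qed

end
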